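(* Let $K$ be a wall in $\{0\le x_1\le M\}$. Suppose there is a continuous curve $\gamma$ joining a point $P_1\in\{x_1<0\}$ to a point $P_2\in\{x_1>M\}$ such that every point of $\gamma$ has distance at least $R_0$ from $K$. Then propagation occurs: $\bar v(x_1,y)\to1$ as $x_1\to+\infty$.
   Context: Standing setting: $N\ge2$, $x=(x_1,y)$, $y\in\mathbb R^{N-1}$. $f\in C^1(\mathbb R)$ is bistable: for some $\alpha\in(0,1)$, $f(0)=f(\alpha)=f(1)=0$, $f'(0)<0$, $f'(\alpha)>0$, $f'(1)<0$, $f<0$ on $(0,\alpha)$, $f>0$ on $(\alpha,1)$, $\int_0^1f>0$. Let $c>0$, $\phi$ be the unique traveling wave: $\phi''+c\phi'+f(\phi)=0$, $0<\phi<1$, $\phi(-\infty)=1$, $\phi(+\infty)=0$, $\phi(0)=\alpha$. A wall is a closed set $K\subset\{0\le x_1\le M\}$ (some $M>0$) with uniformly smooth boundary such that $\Omega:=\mathbb R^N\setminus K$ is connected. $\bar u$ is the unique entire solution of $u_t=\Delta u+f(u)$ in $\Omega$, $\partial_\nu u=0$ on $\partial\Omega$, with $0<\bar u<1$ and $\sup_{x\in\Omega}|\bar u(t,x)-\phi(x_1-ct)|\to0$ as $t\to-\infty$; the limit profile is $\bar v:=\lim_{t\to+\infty}\bar u(t,\cdot)$. $R_0:=\min\{R>0:\ \text{the problem }\Delta\Psi+f(\Psi)=0\text{ in }|x|<R,\ \Psi=0\text{ on }|x|=R,\ 0<\Psi<1\text{ in }|x|<R\text{ has a solution}\}$ (this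 minimum exists). *)

theory Defs
  imports "HOL-Analysis.Analysis"
begin

text \<open>Points of R^N are written x = (x1, y) with x1 :: real and y in a Euclidean space 'b
  (so N = 1 + DIM('b) \<ge> 2).  Laplacian of a C^2 function = trace of its second Frechet
  derivative: sum over b in Basis of D2u x b b.\<close>

definition laplace_of :: "('a::euclidean_space \<Rightarrow>\<^sub>L 'a \<Rightarrow>\<^sub>L real) \<Rightarrow> real" where
  "laplace_of H = (\<Sum>b\<in>Basis. blinfun_apply (blinfun_apply H b) b)"

definition bistable :: "(real \<Rightarrow> real) \<Rightarrow> (real \<Rightarrow> real) \<Rightarrow> real \<Rightarrow> bool" where
  "bistable f f' \<alpha> \<longleftrightarrow>
     (\<forall>s. (f has_real_derivative f' s) (at s)) \<and> continuous_on UNIV f' \<and>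
     0 < \<alpha> \<and> \<alpha> < 1 \<and> f 0 = 0 \<and> f \<alpha> = 0 \<and> f 1 = 0 \<and>
     f' 0 < 0 \<and> f' \<alpha> > 0 \<and> f' 1 < 0 \<and>
     (\<forall>s. 0 < s \<and> s < \<alpha> \<longrightarrow> f s < 0) \<and> (\<forall>s. \<alpha> < s \<and> s < 1 \<longrightarrow> f s > 0) \<and>
     f integrable_on {0..1} \<and> integral {0..1} f > 0"

definition traveling_wave :: "(real \<Rightarrow> real) \<Rightarrow> real \<Rightarrow> real \<Rightarrow> (real \<Rightarrow> real) \<Rightarrow> bool" where
  "traveling_wave f \<alpha> c \<phi> \<longleftrightarrow>
     (\<exists>\<phi>' \<phi>''. (\<forall>s. (\<phi> has_real_derivative \<phi>' s) (at s) \<and> (\<phi>' has_real_derivative \<phi>'' s) (at s)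
                  \<and> \<phi>'' s + c * \<phi>' s + f (\<phi> s) = 0)) \<and>
     (\<forall>s. 0 < \<phi> s \<and> \<phi> s < 1) \<and>
     (\<phi> \<longlongrightarrow> 1) at_bot \<and> (\<phi> \<longlongrightarrow> 0) at_top \<and> \<phi> 0 = \<alpha>"

text \<open>g is a local defining function of K near p (radius r), with gradient field G:
  K coincides near p with the sublevel set {g \<le> 0}, and the gradient G p is nonzero.
  Then G p is normal to the boundary of K at p.\<close>
definition local_defining_fun :: "'a::euclidean_space set \<Rightarrow> 'a \<Rightarrow> real \<Rightarrow> ('a \<Rightarrow> real) \<Rightarrow> ('a \<Rightarrow> 'a) \<Rightarrow> bool" where
  "local_defining_fun K p r g G \<longleftrightarrow>
     0 < r \<and> (\<forall>x\<in>ball p r. (g has_derivative (\<lambda>h. G x \<bullet> h)) (at x)) \<and>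
     continuous_on (ball p r) G \<and> G p \<noteq> 0 \<and>
     K \<inter> ball p r = {x \<in> ball p r. g x \<le> 0}"

definition unif_smooth_boundary :: "'a::euclidean_space set \<Rightarrow> bool" where
  "unif_smooth_boundary K \<longleftrightarrow>
     (\<exists>r>0. \<exists>C>0. \<forall>p\<in>frontier K. \<exists>g G H.
        local_defining_fun K p r g G \<and>
        (\<forall>x\<in>ball p r. (G has_derivative blinfun_apply (H x)) (at x) \<and>
                        norm (H x) \<le> C \<and> 1 / C \<le> norm (G x)) \<and>
        continuous_on (ball p r) H)"

definition wall :: "(real \<times> 'b::euclidean_space) set \<Rightarrow> real \<Rightarrow> bool" where
  "wall K M \<longleftrightarrow> 0 < M \<and> closed K \<and> K \<subseteq> {x. 0 \<le> fst x \<and> fst x \<le> M} \<and>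
     unif_smooth_boundary K \<and> connected (- K)"

definition neumann_solution :: "(real \<Rightarrow> real) \<Rightarrow> 'a::euclidean_space set \<Rightarrow> (real \<Rightarrow> 'a \<Rightarrow> real) \<Rightarrow> bool" where
  "neumann_solution f \<Omega> u \<longleftrightarrow>
     continuous_on (UNIV \<times> closure \<Omega>) (\<lambda>(t, x). u t x) \<and>
     (\<forall>t. \<exists>Du D2u.
        (\<forall>x\<in>\<Omega>. (u t has_derivative blinfun_apply (Du x)) (at x) \<and>
                 (Du has_derivative blinfun_apply (D2u x)) (at x) \<and>
                 ((\<lambda>s. u s x) has_real_derivative (laplace_of (D2u x) + f (u t x))) (at t)) \<and>
        continuous_on \<Omega> D2u) \<and>
     (\<forall>t. \<forall>p\<in>frontier \<Omega>. \<exists>Du.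
        (u t has_derivative Du) (at p within closure \<Omega>) \<and>
        (\<forall>r g G. local_defining_fun (- \<Omega>) p r g G \<longrightarrow> Du (G p) = 0))"

definition dirichlet_ball_solution :: "(real \<Rightarrow> real) \<Rightarrow> real \<Rightarrow> ('a::euclidean_space \<Rightarrow> real) \<Rightarrow> bool" where
  "dirichlet_ball_solution f R \<Psi> \<longleftrightarrow>
     continuous_on (cball 0 R) \<Psi> \<and>
     (\<exists>D D2. \<forall>x\<in>ball 0 R. (\<Psi> has_derivative blinfun_apply (D x)) (at x) \<and>
                          (D has_derivative blinfun_apply (D2 x)) (at x) \<and>
                          laplace_of (D2 x) + f (\<Psi> x) = 0) \<and>
     (\<forall>x\<in>sphere 0 R. \<Psi> x = 0) \<and>
     (\<forall>x\<in>ball 0 R. 0 < \<Psi> x \<and> \<Psi> x < 1)"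

end

theory Submission
  imports Defs
begin

text \<open>
  Let \<open>\<Psi>\<close> solve the Dirichlet problem in a ball of radius \<open>R\<close> close to \<open>R\<^sub>0\<close>. Sliding a family of radial
  profiles down onto \<open>\<Psi>\<close> yields a radial solution in the same ball; it is decreasing, because its energy is
  nonincreasing in the radius. Perturbing the reaction by \<open>- \<eta>\<close> gives a strict radial subsolution with
  radius below \<open>R\<^sub>0 + \<delta>\<close>. Because it is strict, it stays a subsolution when its centre moves slowly; no strong
  maximum principle is needed. When the centre has distance almost \<open>R\<^sub>0\<close> to the wall, the wall normals at
  points of the ball point towards the centre, so the moving bump is compatible with the Neumann condition.
  As \<open>t \<rightarrow> -\<infinity>\<close> the solution \<open>u\<close> lies above a bump placed far to the left. Moving the bump along a smooth curve
  close to \<open>\<gamma>\<close> and then anywhere to the right of the wall shows that \<open>u\<close> is eventually larger than the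
  central value \<open>a > \<alpha>\<close> on large balls there, where the reaction is positive and pushes \<open>u\<close> up to 1.
\<close>

section \<open>The radial equation\<close>

text \<open>\<open>\<Psi>\<close> is not assumed radial, and no symmetry theorem is proved for it.
  Some radial profile that vanishes at the same radius is enough, and a profile kept above
  \<open>\<Psi>\<close> and pressed down until its zero sits on the sphere is one. Three signs of
  the shift in \<open>g + \<mu>\<close> carry the argument: positive for the strict supersolutions
  that slide, zero for the equation itself, negative for the moving bumps. The negative shift costs
  radius: the bump may be slightly larger than \<open>R0\<close>, so its ball may cut into the wall
  although the curve keeps distance \<open>R0\<close>. This fixes the order of the choices.
  Compactness of the curve gives a margin \<open>\<delta>\<close> within which the wall still faces
  the centre; only afterwards is a bump of radius below \<open>R0 + \<delta>\<close> selected, and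
  its strictness \<open>\<eta>\<close> bounds the speed of its centre.\<close>

lemma antiderivative_on_UNIV:
  fixes k :: "real \<Rightarrow> real"
  assumes "continuous_on UNIV k"
  obtains A where "A 0 = 0" "\<And>x. (A has_real_derivative k x) (at x)"
proof -
  have "\<exists>F. \<forall>x::real. (-\<infinity>::ereal) < x \<longrightarrow> x < (\<infinity>::ereal) \<longrightarrow> (F has_vector_derivative k x) (at x)"
    using assms by (intro einterval_antiderivative) (auto simp: continuous_on_eq_continuous_at)
  then obtain F where F: "\<And>x. (F has_real_derivative k x) (at x)"
    by (auto simp: has_real_derivative_iff_has_vector_derivative)
  show thesis
    by (rule that[of "\<lambda>x. F x - F 0"]) (auto intro!: derivative_eq_intros F)
qed

lemma abs_le_exp_weight_nonneg:
  fixes A A' :: "real \<Rightarrow> real"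
  assumes "A 0 = 0" and A: "\<And>x. (A has_real_derivative A' x) (at x)"
    and b: "\<And>x. \<bar>A' x\<bar> \<le> C * exp (l * \<bar>x\<bar>)" and l: "l > 0" and x: "0 \<le> x"
  shows "\<bar>A x\<bar> \<le> C / l * exp (l * x)"
proof -
  have C: "0 \<le> C" using b[of 0] by simp
  have H: "C / l * exp (l * 0) - s * A 0 \<le> C / l * exp (l * x) - s * A x" if s: "s = 1 \<or> s = -1" for s
  proof (rule DERIV_nonneg_imp_nondecreasing[OF x])
    fix y assume "0 \<le> y" "y \<le> x"
    moreover have "((\<lambda>y. C / l * exp (l * y) - s * A y) has_real_derivative
        C * exp (l * y) - s * A' y) (at y)"
      using l by (auto intro!: derivative_eq_intros A)
    moreover have "0 \<le> C * exp (l * y) - s * A' y" using b[of y] s \<open>0 \<le> y\<close> by auto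
    ultimately show "\<exists>d. ((\<lambda>y. C / l * exp (l * y) - s * A y) has_real_derivative d) (at y) \<and> 0 \<le> d"
      by blast
  qed
  have "0 \<le> C / l" using C l by simp
  then show ?thesis
    using H[of 1] H[of "-1"] assms(1) by (simp add: abs_le_iff)
qed

text \<open>Integrating against the weight gains the factor \<open>1 / l\<close>. With
  \<open>l = 2 * L\<close> this turns the Lipschitz constant \<open>L\<close> of the reaction into
  the contraction factor 1/2 of the Picard map.\<close>

lemma abs_le_exp_weight:
  fixes A A' :: "real \<Rightarrow> real"
  assumes A0: "A 0 = 0" and A: "\<And>x. (A has_real_derivative A' x) (at x)"
    and b: "\<And>x. \<bar>A' x\<bar> \<le> C * exp (l * \<bar>x\<bar>)" and l: "l > 0"
  shows "\<bar>A x\<bar> \<le> C / l * exp (l * \<bar>x\<bar>)"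
proof (cases "0 \<le> x")
  case True
  with abs_le_exp_weight_nonneg[OF A0 A b l] show ?thesis by simp
next
  case False
  have "\<bar>(\<lambda>y. A (- y)) (- x)\<bar> \<le> C / l * exp (l * (- x))"
  proof (rule abs_le_exp_weight_nonneg[where A' = "\<lambda>y. - A' (- y)"])
    show "((\<lambda>y. A (- y)) has_real_derivative - A' (- y)) (at y)" for y
      using DERIV_chain2[OF A[of "- y"] DERIV_minus[OF DERIV_ident]] by simp
    show "\<bar>- A' (- y)\<bar> \<le> C * exp (l * \<bar>y\<bar>)" for y using b[of "- y"] by simp
  qed (use A0 l False in auto)
  with False show ?thesis by simp
qed

text \<open>The derivative of a radial profile in flux form. For \<open>W = w (r^2 / 2)\<close>,
  integrating \<open>(r^(n-1) W')' = - r^(n-1) (g W + \<mu>)\<close> from 0 to \<open>r\<close>,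
  dividing by \<open>r^n\<close> and substituting \<open>s = t r\<close> gives
  \<open>dw/d\<tau>\<close> as this integral, which also makes sense for
  \<open>\<tau> \<le> 0\<close>.\<close>

definition slope :: "(real \<Rightarrow> real) \<Rightarrow> nat \<Rightarrow> real \<Rightarrow> (real \<Rightarrow> real) \<Rightarrow> real \<Rightarrow> real" where
  "slope g n \<mu> w \<tau> = - integral {0..1} (\<lambda>t. t ^ (n - 1) * (g (w (t\<^sup>2 * \<tau>)) + \<mu>))"

lemma continuous_slope_param:
  fixes w :: "'p::topological_space \<Rightarrow> real \<Rightarrow> real" and \<mu> :: "'p \<Rightarrow> real"
  assumes g: "continuous_on UNIV g" and w: "continuous_on UNIV (\<lambda>(p, \<tau>). w p \<tau>)"
    and \<mu>: "continuous_on UNIV \<mu>"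
  shows "continuous_on UNIV (\<lambda>(p, \<tau>). slope g n (\<mu> p) (w p) \<tau>)"
proof -
  have "continuous_on (UNIV \<times> cbox 0 1)
      (\<lambda>(q, t). t ^ (n - 1) * (g (w (fst q) (t\<^sup>2 * snd q)) + \<mu> (fst q)))"
    unfolding case_prod_beta
    by (intro continuous_intros continuous_on_compose2[OF g] continuous_on_compose2[OF \<mu>]
        continuous_on_compose2[OF w, where f = "\<lambda>x. (fst (fst x), (snd x)\<^sup>2 * snd (fst x))", simplified]) auto
  from integral_continuous_on_param[OF this] show ?thesis
    unfolding slope_def case_prod_beta by (intro continuous_intros) (simp add: cbox_interval)
qed

lemma continuous_slope:
  assumes g: "continuous_on UNIV g" and w: "continuous_on UNIV w"
  shows "continuous_on UNIV (slope g n \<mu> w)"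
proof -
  have "continuous_on UNIV (\<lambda>(p::real, \<tau>). slope g n \<mu> w \<tau>)"
    by (rule continuous_slope_param[OF g])
      (auto simp: case_prod_beta intro!: continuous_intros continuous_on_compose2[OF w])
  from continuous_on_compose2[OF this, of UNIV "\<lambda>x. (0, x)"] show ?thesis
    by (simp add: continuous_on_Pair)
qed

lemma slope_integrable:
  fixes g w :: "real \<Rightarrow> real"
  assumes g: "continuous_on UNIV g" and w: "continuous_on UNIV w"
  shows "(\<lambda>t. t ^ (n - 1) * (g (w (t\<^sup>2 * \<tau>)) + \<mu>)) integrable_on {0..1}"
proof (rule integrable_continuous_real)
  show "continuous_on {0..1} (\<lambda>t. t ^ (n - 1) * (g (w (t\<^sup>2 * \<tau>)) + \<mu>))"
    by (intro continuous_intros continuous_on_compose2[OF g] continuous_on_compose2[OF w]) auto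
qed

lemma slope_diff_le:
  assumes g: "continuous_on UNIV g" and w: "continuous_on UNIV w" and w': "continuous_on UNIV w'"
    and b: "\<And>t. 0 \<le> t \<Longrightarrow> t \<le> 1 \<Longrightarrow> \<bar>(g (w (t\<^sup>2 * \<tau>)) + \<mu>) - (g (w' (t\<^sup>2 * \<tau>)) + \<mu>')\<bar> \<le> C"
  shows "\<bar>slope g n \<mu> w \<tau> - slope g n \<mu>' w' \<tau>\<bar> \<le> C"
proof -
  have C: "0 \<le> C" using b[of 0] by linarith
  let ?F = "\<lambda>t. t ^ (n - 1) * (g (w (t\<^sup>2 * \<tau>)) + \<mu>)"
  let ?F' = "\<lambda>t. t ^ (n - 1) * (g (w' (t\<^sup>2 * \<tau>)) + \<mu>')"
  have i: "?F integrable_on {0..1}" "?F' integrable_on {0..1}"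
    using slope_integrable[OF g w] slope_integrable[OF g w'] by auto
  have "norm (integral {0..1} (\<lambda>t. ?F t - ?F' t)) \<le> integral {0..1::real} (\<lambda>t. C)"
  proof (rule integral_norm_bound_integral)
    show "(\<lambda>t. ?F t - ?F' t) integrable_on {0..1}" using i by (rule integrable_diff)
    fix t :: real assume t: "t \<in> {0..1}"
    have "\<bar>?F t - ?F' t\<bar> = t ^ (n - 1) * \<bar>(g (w (t\<^sup>2 * \<tau>)) + \<mu>) - (g (w' (t\<^sup>2 * \<tau>)) + \<mu>')\<bar>"
      using t by (simp add: right_diff_distrib[symmetric] abs_mult power_abs)
    also have "\<dots> \<le> 1 * C"
      using t C b[of t] by (intro mult_mono) (auto intro: power_le_one)
    finally show "norm (?F t - ?F' t) \<le> C" by simp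
  qed (auto intro: integrable_const_ivl)
  then show ?thesis using i by (simp add: slope_def integral_diff abs_minus_commute)
qed

text \<open>With \<open>\<tau> = norm x ^ 2 / 2\<close> the radial equation has no singular term in its integral form;
  the weight \<open>exp (- 2 * L * \<bar>\<tau>\<bar>)\<close> makes the Picard map a global contraction.\<close>
lemma radial_ode_family:
  fixes g :: "real \<Rightarrow> real"
  assumes L: "L > 0" and lip: "\<And>x y. \<bar>g x - g y\<bar> \<le> L * \<bar>x - y\<bar>" and bdd: "\<And>x. \<bar>g x\<bar> \<le> B"
  obtains w where "\<And>a \<mu>. w a \<mu> 0 = a"
    and "\<And>a \<mu> \<tau>. (w a \<mu> has_real_derivative slope g n \<mu> (w a \<mu>) \<tau>) (at \<tau>)"
    and "\<And>a \<mu> a' \<mu>' \<tau>. \<bar>w a \<mu> \<tau> - w a' \<mu>' \<tau>\<bar> \<le> exp (2 * L * \<bar>\<tau>\<bar>) * (2 * \<bar>a - a'\<bar> + \<bar>\<mu> - \<mu>'\<bar> / L)"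
    and "\<And>c \<mu> \<tau>. g c + \<mu> = 0 \<Longrightarrow> w c \<mu> \<tau> = c"
proof -
  have gc: "continuous_on UNIV g"
    by (rule lipschitz_on_continuous_on[where L = L]) (use L lip in \<open>auto simp: lipschitz_on_def dist_real_def\<close>)
  \<comment> \<open>The sup norm of \<open>\<omega>\<close> is the weighted norm of the profile
    \<open>W \<omega>\<close>, so the complete space of bounded continuous functions describes
    profiles of exponential growth.\<close>
  define W where "W \<omega> \<tau> = exp (2 * L * \<bar>\<tau>\<bar>) * apply_bcontfun \<omega> \<tau>" for \<omega> :: "real \<Rightarrow>\<^sub>C real" and \<tau>
  have Wc: "continuous_on UNIV (W \<omega>)" for \<omega>
    unfolding W_def by (intro continuous_intros continuous_on_apply_bcontfun)
  define S where "S \<mu> \<omega> = slope g n \<mu> (W \<omega>)" for \<mu> \<omega>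
  have Sc: "continuous_on UNIV (S \<mu> \<omega>)" for \<mu> \<omega>
    unfolding S_def by (rule continuous_slope[OF gc Wc])
  have "\<exists>A. A 0 = 0 \<and> (\<forall>x. (A has_real_derivative S \<mu> \<omega> x) (at x))" for \<mu> \<omega>
    using antiderivative_on_UNIV[OF Sc] by metis
  then obtain A where A0: "\<And>\<mu> \<omega>. A \<mu> \<omega> 0 = 0"
    and A: "\<And>\<mu> \<omega> x. (A \<mu> \<omega> has_real_derivative S \<mu> \<omega> x) (at x)" by metis
  have Sd: "\<bar>S \<mu> \<omega> x - S \<mu>' \<omega>' x\<bar> \<le> (L * dist \<omega> \<omega>' + \<bar>\<mu> - \<mu>'\<bar>) * exp (2 * L * \<bar>x\<bar>)" for \<mu> \<omega> \<mu>' \<omega>' x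
    unfolding S_def
  proof (rule slope_diff_le[OF gc Wc Wc])
    fix t :: real assume t: "0 \<le> t" "t \<le> 1"
    let ?y = "t\<^sup>2 * x"
    \<comment> \<open>The slope at \<open>x\<close> reads the profile only between 0 and
      \<open>x\<close>, where the weight is at most its value at \<open>x\<close>.\<close>
    have y: "\<bar>?y\<bar> \<le> \<bar>x\<bar>" using t by (simp add: abs_mult mult_left_le_one_le power_le_one)
    have "\<bar>W \<omega> ?y - W \<omega>' ?y\<bar> = exp (2 * L * \<bar>?y\<bar>) * dist (apply_bcontfun \<omega> ?y) (apply_bcontfun \<omega>' ?y)"
      by (simp add: W_def dist_real_def right_diff_distrib[symmetric] abs_mult)
    also have "\<dots> \<le> exp (2 * L * \<bar>x\<bar>) * dist \<omega> \<omega>'"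
      using y L by (intro mult_mono dist_bounded) auto
    finally have "L * \<bar>W \<omega> ?y - W \<omega>' ?y\<bar> \<le> L * (exp (2 * L * \<bar>x\<bar>) * dist \<omega> \<omega>')"
      using L by simp
    with lip[of "W \<omega> ?y" "W \<omega>' ?y"]
    have "\<bar>g (W \<omega> ?y) - g (W \<omega>' ?y)\<bar> \<le> L * dist \<omega> \<omega>' * exp (2 * L * \<bar>x\<bar>)" by (simp add: mult_ac)
    moreover have "\<bar>\<mu> - \<mu>'\<bar> * 1 \<le> \<bar>\<mu> - \<mu>'\<bar> * exp (2 * L * \<bar>x\<bar>)"
      using L by (intro mult_left_mono) auto
    ultimately show "\<bar>g (W \<omega> ?y) + \<mu> - (g (W \<omega>' ?y) + \<mu>')\<bar> \<le> (L * dist \<omega> \<omega>' + \<bar>\<mu> - \<mu>'\<bar>) * exp (2 * L * \<bar>x\<bar>)"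
      by (simp add: distrib_right)
  qed
  have Ad: "\<bar>A \<mu> \<omega> x - A \<mu>' \<omega>' x\<bar> \<le> (L * dist \<omega> \<omega>' + \<bar>\<mu> - \<mu>'\<bar>) / (2 * L) * exp (2 * L * \<bar>x\<bar>)" for \<mu> \<omega> \<mu>' \<omega>' x
    by (rule abs_le_exp_weight[where A' = "\<lambda>x. S \<mu> \<omega> x - S \<mu>' \<omega>' x"])
      (use A0 L Sd in \<open>auto intro!: derivative_eq_intros A\<close>)
  have S_bd: "\<bar>S \<mu> \<omega> x\<bar> \<le> (B + \<bar>\<mu>\<bar>) * exp (2 * L * \<bar>x\<bar>)" for \<mu> \<omega> x
  proof -
    have "0 \<le> B" using bdd[of 0] by linarith
    have "\<bar>slope g n \<mu> (W \<omega>) x - slope (\<lambda>_. 0) n 0 (W \<omega>) x\<bar> \<le> B + \<bar>\<mu>\<bar>"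
    proof -
      let ?F = "\<lambda>t. t ^ (n - 1) * (g (W \<omega> (t\<^sup>2 * x)) + \<mu>)"
      have "norm (integral {0..1} ?F) \<le> integral {0..1::real} (\<lambda>t. B + \<bar>\<mu>\<bar>)"
      proof (rule integral_norm_bound_integral)
        fix t :: real assume t: "t \<in> {0..1}"
        have "\<bar>?F t\<bar> = t ^ (n - 1) * \<bar>g (W \<omega> (t\<^sup>2 * x)) + \<mu>\<bar>" using t by (simp add: abs_mult power_abs)
        also have "\<dots> \<le> 1 * (B + \<bar>\<mu>\<bar>)"
          using t bdd[of "W \<omega> (t\<^sup>2 * x)"] by (intro mult_mono) (auto intro: power_le_one)
        finally show "norm (?F t) \<le> B + \<bar>\<mu>\<bar>" by simp
      qed (use slope_integrable[OF gc Wc] in \<open>auto intro: integrable_const_ivl\<close>)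
      then show ?thesis by (simp add: slope_def)
    qed
    then have "\<bar>S \<mu> \<omega> x\<bar> \<le> B + \<bar>\<mu>\<bar>" by (simp add: S_def slope_def)
    also have "\<dots> \<le> (B + \<bar>\<mu>\<bar>) * exp (2 * L * \<bar>x\<bar>)" using \<open>0 \<le> B\<close> L mult_left_mono[of 1 "exp (2 * L * \<bar>x\<bar>)" "B + \<bar>\<mu>\<bar>"] by simp
    finally show ?thesis .
  qed
  have A_bd: "\<bar>A \<mu> \<omega> x\<bar> \<le> (B + \<bar>\<mu>\<bar>) / (2 * L) * exp (2 * L * \<bar>x\<bar>)" for \<mu> \<omega> x
    by (rule abs_le_exp_weight[where A' = "S \<mu> \<omega>"]) (use A0 A S_bd L in auto)
  \<comment> \<open>Boundedness of \<open>g\<close> keeps \<open>A\<close> below a multiple of the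
    weight, so \<open>P\<close> stays within bounded functions.\<close>
  define P where "P a \<mu> \<omega> = Bcontfun (\<lambda>\<tau>. exp (- (2 * L * \<bar>\<tau>\<bar>)) * (a + A \<mu> \<omega> \<tau>))" for a \<mu> \<omega>
  have P: "apply_bcontfun (P a \<mu> \<omega>) \<tau> = exp (- (2 * L * \<bar>\<tau>\<bar>)) * (a + A \<mu> \<omega> \<tau>)" for a \<mu> \<omega> \<tau>
  proof -
    have "(\<lambda>\<tau>. exp (- (2 * L * \<bar>\<tau>\<bar>)) * (a + A \<mu> \<omega> \<tau>)) \<in> bcontfun"
    proof (rule bcontfun_normI)
      have "continuous_on UNIV (A \<mu> \<omega>)" using A by (meson DERIV_continuous_on has_field_derivative_at_within)
      then show "continuous_on UNIV (\<lambda>\<tau>. exp (- (2 * L * \<bar>\<tau>\<bar>)) * (a + A \<mu> \<omega> \<tau>))"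
        by (intro continuous_intros)
      fix \<tau>
      have "\<bar>a\<bar> * 1 \<le> \<bar>a\<bar> * exp (2 * L * \<bar>\<tau>\<bar>)" using L by (intro mult_left_mono) auto
      then have "\<bar>a + A \<mu> \<omega> \<tau>\<bar> \<le> (\<bar>a\<bar> + (B + \<bar>\<mu>\<bar>) / (2 * L)) * exp (2 * L * \<bar>\<tau>\<bar>)"
        using A_bd[of \<mu> \<omega> \<tau>] unfolding distrib_right by linarith
      then show "norm (exp (- (2 * L * \<bar>\<tau>\<bar>)) * (a + A \<mu> \<omega> \<tau>)) \<le> \<bar>a\<bar> + (B + \<bar>\<mu>\<bar>) / (2 * L)"
        by (simp add: abs_mult exp_minus field_simps)
    qed
    then show ?thesis by (simp add: P_def Bcontfun_inverse)
  qed
  have Pd: "dist (P a \<mu> \<omega>) (P a' \<mu>' \<omega>') \<le> \<bar>a - a'\<bar> + dist \<omega> \<omega>' / 2 + \<bar>\<mu> - \<mu>'\<bar> / (2 * L)" for a \<mu> \<omega> a' \<mu>' \<omega>'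
  proof (rule dist_bound)
    fix \<tau>
    have "\<bar>a - a'\<bar> * 1 \<le> \<bar>a - a'\<bar> * exp (2 * L * \<bar>\<tau>\<bar>)" using L by (intro mult_left_mono) auto
    then have "\<bar>a - a'\<bar> + \<bar>A \<mu> \<omega> \<tau> - A \<mu>' \<omega>' \<tau>\<bar>
        \<le> (\<bar>a - a'\<bar> + (L * dist \<omega> \<omega>' + \<bar>\<mu> - \<mu>'\<bar>) / (2 * L)) * exp (2 * L * \<bar>\<tau>\<bar>)"
      using Ad[of \<mu> \<omega> \<tau> \<mu>' \<omega>'] unfolding distrib_right by (intro add_mono) simp_all
    then have "\<bar>(a + A \<mu> \<omega> \<tau>) - (a' + A \<mu>' \<omega>' \<tau>)\<bar>
        \<le> (\<bar>a - a'\<bar> + (L * dist \<omega> \<omega>' + \<bar>\<mu> - \<mu>'\<bar>) / (2 * L)) * exp (2 * L * \<bar>\<tau>\<bar>)"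
      by linarith
    moreover have "dist (apply_bcontfun (P a \<mu> \<omega>) \<tau>) (apply_bcontfun (P a' \<mu>' \<omega>') \<tau>)
       = exp (- (2 * L * \<bar>\<tau>\<bar>)) * \<bar>(a + A \<mu> \<omega> \<tau>) - (a' + A \<mu>' \<omega>' \<tau>)\<bar>"
      by (simp add: P dist_real_def right_diff_distrib[symmetric] abs_mult)
    moreover have "d \<le> C" if "d = exp (- y) * X" "X \<le> C * exp y" for d X C y :: real
    proof -
      have "d * exp y \<le> C * exp y" using that by (simp add: exp_minus field_simps)
      then show ?thesis by simp
    qed
    ultimately have "dist (apply_bcontfun (P a \<mu> \<omega>) \<tau>) (apply_bcontfun (P a' \<mu>' \<omega>') \<tau>)
       \<le> \<bar>a - a'\<bar> + (L * dist \<omega> \<omega>' + \<bar>\<mu> - \<mu>'\<bar>) / (2 * L)"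
      by blast
    then show "dist (apply_bcontfun (P a \<mu> \<omega>) \<tau>) (apply_bcontfun (P a' \<mu>' \<omega>') \<tau>)
        \<le> \<bar>a - a'\<bar> + dist \<omega> \<omega>' / 2 + \<bar>\<mu> - \<mu>'\<bar> / (2 * L)"
      using L by (simp add: add_divide_distrib)
  qed
  have "\<exists>!\<omega>. P a \<mu> \<omega> = \<omega>" for a \<mu>
    using banach_fix_type[of "1/2" "P a \<mu>"] Pd[of a \<mu> _ a \<mu>] by auto
  then obtain \<omega> where fp: "\<And>a \<mu>. P a \<mu> (\<omega> a \<mu>) = \<omega> a \<mu>"
    and uq: "\<And>a \<mu> \<eta>. P a \<mu> \<eta> = \<eta> \<Longrightarrow> \<eta> = \<omega> a \<mu>" by metis
  have WA: "W (\<omega> a \<mu>) \<tau> = a + A \<mu> (\<omega> a \<mu>) \<tau>" for a \<mu> \<tau>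
    unfolding W_def by (subst fp[symmetric]) (simp add: P exp_minus)
  show thesis
  proof (rule that[of "\<lambda>a \<mu>. W (\<omega> a \<mu>)"])
    show "W (\<omega> a \<mu>) 0 = a" for a \<mu> by (simp add: WA A0)
    show "(W (\<omega> a \<mu>) has_real_derivative slope g n \<mu> (W (\<omega> a \<mu>)) \<tau>) (at \<tau>)" for a \<mu> \<tau>
    proof -
      have "W (\<omega> a \<mu>) = (\<lambda>\<tau>. a + A \<mu> (\<omega> a \<mu>) \<tau>)" using WA by auto
      moreover have "((\<lambda>\<tau>. a + A \<mu> (\<omega> a \<mu>) \<tau>) has_real_derivative S \<mu> (\<omega> a \<mu>) \<tau>) (at \<tau>)"
        by (auto intro!: derivative_eq_intros A)
      ultimately show ?thesis by (metis S_def)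
    qed
    show "\<bar>W (\<omega> a \<mu>) \<tau> - W (\<omega> a' \<mu>') \<tau>\<bar> \<le> exp (2 * L * \<bar>\<tau>\<bar>) * (2 * \<bar>a - a'\<bar> + \<bar>\<mu> - \<mu>'\<bar> / L)" for a \<mu> a' \<mu>' \<tau>
    proof -
      \<comment> \<open>For two fixed points the distance \<open>d\<close> satisfies
        \<open>d \<le> |a - a'| + d / 2 + |\<mu> - \<mu>'| / (2 * L)\<close>; solving for
        \<open>d\<close> gives the constants.\<close>
      have "dist (\<omega> a \<mu>) (\<omega> a' \<mu>') \<le> 2 * \<bar>a - a'\<bar> + \<bar>\<mu> - \<mu>'\<bar> / L"
        using Pd[of a \<mu> "\<omega> a \<mu>" a' \<mu>' "\<omega> a' \<mu>'"] L by (simp add: fp field_simps)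
      with dist_bounded[of "\<omega> a \<mu>" \<tau> "\<omega> a' \<mu>'"]
      have "dist (apply_bcontfun (\<omega> a \<mu>) \<tau>) (apply_bcontfun (\<omega> a' \<mu>') \<tau>) \<le> 2 * \<bar>a - a'\<bar> + \<bar>\<mu> - \<mu>'\<bar> / L" by linarith
      then show ?thesis by (simp add: W_def right_diff_distrib[symmetric] abs_mult dist_real_def)
    qed
    \<comment> \<open>A zero of \<open>g + \<mu>\<close> yields a constant profile that is a fixed
      point, and fixed points are unique.\<close>
    show "W (\<omega> c \<mu>) \<tau> = c" if "g c + \<mu> = 0" for c \<mu> \<tau>
    proof -
      define \<eta> where "\<eta> = Bcontfun (\<lambda>\<tau>. exp (- (2 * L * \<bar>\<tau>\<bar>)) * c)"
      have \<eta>: "apply_bcontfun \<eta> = (\<lambda>\<tau>. exp (- (2 * L * \<bar>\<tau>\<bar>)) * c)" unfolding \<eta>_def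
      proof (rule Bcontfun_inverse, rule bcontfun_normI)
        show "continuous_on UNIV (\<lambda>\<tau>. exp (- (2 * L * \<bar>\<tau>\<bar>)) * c)" by (intro continuous_intros)
        show "norm (exp (- (2 * L * \<bar>\<tau>\<bar>)) * c) \<le> \<bar>c\<bar>" for \<tau>
          using L by (simp add: abs_mult mult_left_le_one_le)
      qed
      have W\<eta>: "W \<eta> = (\<lambda>_. c)" by (auto simp: W_def \<eta> exp_minus)
      then have "S \<mu> \<eta> = (\<lambda>_. 0)" using that by (simp add: S_def slope_def fun_eq_iff)
      then have "A \<mu> \<eta> \<tau> = 0" for \<tau>
        using abs_le_exp_weight[of "A \<mu> \<eta>" "\<lambda>_. 0" 0 1 \<tau>] A0 A[of \<mu> \<eta>] by auto
      then have "P c \<mu> \<eta> = \<eta>" by (intro bcontfun_eqI) (simp add: P \<eta>)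
      then have "\<eta> = \<omega> c \<mu>" by (rule uq)
      then show ?thesis using W\<eta> by metis
    qed
  qed
qed

text \<open>In the variable \<open>\<tau>\<close> the radial equation reads
  \<open>2 \<tau> w'' + n w' + g w + \<mu> = 0\<close>. Substituting \<open>sqrt \<tau> * t\<close>
  turns the slope into \<open>- Q r / r ^ n\<close> with \<open>r = sqrt \<tau>\<close>, and the
  quotient rule applies. This \<open>r\<close> is a rescaled radius, since
  \<open>norm x = sqrt (2 * \<tau>)\<close>.\<close>

lemma slope_ode:
  assumes g: "continuous_on UNIV g" and w: "continuous_on UNIV w" and n: "n \<ge> 1" and \<tau>: "\<tau> > 0"
  shows "(slope g n \<mu> w has_real_derivative - (g (w \<tau>) + \<mu> + n * slope g n \<mu> w \<tau>) / (2 * \<tau>)) (at \<tau>)"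
proof -
  have c: "continuous_on UNIV (\<lambda>r. r ^ (n - 1) * (g (w (r\<^sup>2)) + \<mu>))"
    by (intro continuous_intros continuous_on_compose2[OF g] continuous_on_compose2[OF w]) auto
  obtain Q where Q0: "Q 0 = 0"
    and Q: "\<And>r. (Q has_real_derivative r ^ (n - 1) * (g (w (r\<^sup>2)) + \<mu>)) (at r)"
    using antiderivative_on_UNIV[OF c] by blast
  have key: "slope g n \<mu> w s = - Q (sqrt s) / sqrt s ^ n" if s: "s > 0" for s
  proof -
    let ?r = "sqrt s"
    have "((\<lambda>t. ?r ^ n * (t ^ (n - 1) * (g (w (t\<^sup>2 * s)) + \<mu>))) has_integral Q (?r * 1) - Q (?r * 0)) {0..1}"
    proof (rule fundamental_theorem_of_calculus)
      fix t :: real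
      have "((\<lambda>t. Q (?r * t)) has_real_derivative (?r * t) ^ (n - 1) * (g (w ((?r * t)\<^sup>2)) + \<mu>) * ?r) (at t)"
        by (rule DERIV_chain2[OF Q]) (auto intro!: derivative_eq_intros)
      moreover have "(?r * t) ^ (n - 1) * (g (w ((?r * t)\<^sup>2)) + \<mu>) * ?r = ?r ^ n * (t ^ (n - 1) * (g (w (t\<^sup>2 * s)) + \<mu>))"
        using n s by (cases n) (auto simp: power_mult_distrib mult_ac)
      ultimately show "((\<lambda>t. Q (?r * t)) has_vector_derivative ?r ^ n * (t ^ (n - 1) * (g (w (t\<^sup>2 * s)) + \<mu>))) (at t within {0..1})"
        by (simp add: has_real_derivative_iff_has_vector_derivative has_vector_derivative_at_within)
    qed simp
    from integral_unique[OF this] have "?r ^ n * slope g n \<mu> w s = - Q ?r"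
      by (simp add: slope_def Q0)
    then show ?thesis using s by (simp add: field_simps)
  qed
  define r where "r = sqrt \<tau>"
  have r: "r > 0" "r\<^sup>2 = \<tau>" using \<tau> by (auto simp: r_def)
  have d: "((\<lambda>s. - Q (sqrt s) / sqrt s ^ n) has_real_derivative
      - (g (w \<tau>) + \<mu> + n * (- Q (sqrt \<tau>) / sqrt \<tau> ^ n)) / (2 * \<tau>)) (at \<tau>)"
  proof -
    have "((\<lambda>s. - Q (sqrt s) / sqrt s ^ n) has_real_derivative
       (- (r ^ (n - 1) * (g (w (r\<^sup>2)) + \<mu>) * (inverse r / 2)) * r ^ n - (- Q r) * (n * (inverse r / 2 * r ^ (n - 1)))) / (r ^ n * r ^ n)) (at \<tau>)"
      unfolding r_def using \<tau>
      by (auto intro!: derivative_eq_intros DERIV_chain2[OF Q] DERIV_real_sqrt simp: divide_simps)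
    moreover have "(- (r ^ (n - 1) * (g (w (r\<^sup>2)) + \<mu>) * (inverse r / 2)) * r ^ n - (- Q r) * (n * (inverse r / 2 * r ^ (n - 1)))) / (r ^ n * r ^ n)
       = - (g (w \<tau>) + \<mu> + n * (- Q r / r ^ n)) / (2 * r\<^sup>2)"
    proof -
      obtain m where m: "n = Suc m" using n by (cases n) auto
      have "(- (r ^ m * G * (inverse r / 2)) * r ^ n - (- Q r) * (n * (inverse r / 2 * r ^ m))) / (r ^ n * r ^ n)
        = - (G + n * (- Q r / r ^ n)) / (2 * r\<^sup>2)" for G
        unfolding m using r(1) by (simp add: field_simps power2_eq_square)
      from this[of "g (w \<tau>) + \<mu>"] show ?thesis by (simp add: m r(2))
    qed
    ultimately show ?thesis by (simp add: r r_def[symmetric])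
  qed
  have "eventually (\<lambda>s. s \<in> {0<..}) (nhds \<tau>)" using \<tau> by (intro eventually_nhds_in_open) auto
  then have "eventually (\<lambda>s. slope g n \<mu> w s = - Q (sqrt s) / sqrt s ^ n) (nhds \<tau>)"
    by eventually_elim (simp add: key)
  from DERIV_cong_ev[OF refl this refl] d show ?thesis by (simp add: key[OF \<tau>])
qed

lemma first_zero:
  fixes k :: "real \<Rightarrow> real"
  assumes c: "continuous_on {0..T} k" and k0: "k 0 < 0" and t: "0 \<le> t" "t \<le> T" "k t \<ge> 0"
  obtains s where "0 < s" "s \<le> T" "k s = 0" "\<And>r. 0 \<le> r \<Longrightarrow> r < s \<Longrightarrow> k r < 0"
proof -
  let ?Z = "{0..T} \<inter> k -` {0..}"
  have "closed ?Z" using c by (intro continuous_closed_preimage) auto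
  then have "compact ?Z" by (rule compact_Int_closed[of "{0..T}" ?Z, simplified Int_left_absorb, OF compact_Icc])
  moreover have "t \<in> ?Z" using t by auto
  ultimately obtain s where s: "s \<in> ?Z" and min: "\<And>r. r \<in> ?Z \<Longrightarrow> s \<le> r"
    using compact_attains_inf[of ?Z] by (metis empty_iff)
  have neg: "k r < 0" if "0 \<le> r" "r < s" for r
  proof (rule ccontr)
    assume "\<not> k r < 0"
    then have "r \<in> ?Z" using that s by auto
    with min[of r] that show False by simp
  qed
  have "s \<noteq> 0" using s k0 by auto
  then have s0: "0 < s" using s by auto
  have "k s \<le> 0"
  proof (rule ccontr)
    assume "\<not> k s \<le> 0"
    then obtain r where "0 \<le> r" "r \<le> s" "k r = 0"
      using IVT'[of k 0 0 s] k0 s0 s continuous_on_subset[OF c, of "{0..s}"] by auto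
    with neg[of r] \<open>\<not> k s \<le> 0\<close> show False by (cases "r = s") auto
  qed
  with s s0 neg show thesis by (intro that[of s]) auto
qed

lemma first_zero_pos:
  fixes h :: "real \<Rightarrow> real"
  assumes c: "continuous_on {0..T} h" and h0: "h 0 > 0" and t: "0 \<le> t" "t \<le> T" "h t \<le> 0"
  obtains s where "0 < s" "s \<le> T" "h s = 0" "\<And>r. 0 \<le> r \<Longrightarrow> r < s \<Longrightarrow> h r > 0"
proof (rule first_zero[OF continuous_on_minus[OF c] _ t(1,2)])
  fix s assume "0 < s" "s \<le> T" "- h s = 0" "\<And>r. 0 \<le> r \<Longrightarrow> r < s \<Longrightarrow> - h r < 0"
  then show thesis by (intro that[of s]) auto
qed (use h0 t in auto)

text \<open>\<open>g\<close> is the reaction cut off outside \<open>[0, 1]\<close>, and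
  \<open>w a \<mu>\<close> the profile with central value \<open>a\<close> for the reaction
  \<open>g + \<mu>\<close>. The small constants in the perturbation arguments below are measured
  against \<open>w_lip\<close>.\<close>

locale radial_family =
  fixes g :: "real \<Rightarrow> real" and L \<alpha> :: real and n :: nat and w :: "real \<Rightarrow> real \<Rightarrow> real \<Rightarrow> real"
  assumes n: "1 \<le> n" and L: "0 < L" and lip: "\<And>x y. \<bar>g x - g y\<bar> \<le> L * \<bar>x - y\<bar>"
    and \<alpha>: "0 < \<alpha>" "\<alpha> < 1" "g \<alpha> = 0"
    and g_neg: "\<And>s. 0 < s \<Longrightarrow> s < \<alpha> \<Longrightarrow> g s < 0" and g_pos: "\<And>s. \<alpha> < s \<Longrightarrow> s < 1 \<Longrightarrow> 0 < g s"
    and g0: "\<And>s. s \<le> 0 \<Longrightarrow> g s = 0" and g1: "\<And>s. 1 \<le> s \<Longrightarrow> g s = 0"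
    and int_pos: "0 < integral {0..1} g"
    and w0 [simp]: "\<And>a \<mu>. w a \<mu> 0 = a"
    and w_deriv: "\<And>a \<mu> \<tau>. (w a \<mu> has_real_derivative slope g n \<mu> (w a \<mu>) \<tau>) (at \<tau>)"
    and w_lip: "\<And>a \<mu> a' \<mu>' \<tau>. \<bar>w a \<mu> \<tau> - w a' \<mu>' \<tau>\<bar> \<le> exp (2 * L * \<bar>\<tau>\<bar>) * (2 * \<bar>a - a'\<bar> + \<bar>\<mu> - \<mu>'\<bar> / L)"
    and w_const: "\<And>c \<mu> \<tau>. g c + \<mu> = 0 \<Longrightarrow> w c \<mu> \<tau> = c"
begin

section \<open>Continuity and Lipschitz dependence of the profiles\<close>

abbreviation k :: "real \<Rightarrow> real \<Rightarrow> real \<Rightarrow> real" where "k a \<mu> \<equiv> slope g n \<mu> (w a \<mu>)"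

lemma g_cont: "continuous_on UNIV g"
  by (rule lipschitz_on_continuous_on[where L = L]) (use L lip in \<open>auto simp: lipschitz_on_def dist_real_def\<close>)

lemma w_cont1: "continuous_on S (w a \<mu>)"
  using w_deriv by (meson DERIV_continuous_on has_field_derivative_at_within)

lemma k_cont1: "continuous_on S (k a \<mu>)"
  using continuous_slope[OF g_cont w_cont1] continuous_on_subset by blast

lemma w_cont: "continuous_on UNIV (\<lambda>(p, \<tau>). w (fst p) (snd p) \<tau>)"
  unfolding continuous_on_def case_prod_beta
proof (intro ballI)
  fix x :: "(real \<times> real) \<times> real"
  let ?h = "\<lambda>y. exp (2 * L * \<bar>snd y\<bar>) * (2 * \<bar>fst (fst y) - fst (fst x)\<bar> + \<bar>snd (fst y) - snd (fst x)\<bar> / L)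
      + \<bar>w (fst (fst x)) (snd (fst x)) (snd y) - w (fst (fst x)) (snd (fst x)) (snd x)\<bar>"
  have "continuous_on UNIV ?h"
    by (intro continuous_intros continuous_on_compose2[OF w_cont1[of UNIV]]) (use L in auto)
  then have "(?h \<longlongrightarrow> ?h x) (at x)" unfolding continuous_on_def by blast
  then have h: "(?h \<longlongrightarrow> 0) (at x)" by simp
  show "((\<lambda>x. w (fst (fst x)) (snd (fst x)) (snd x)) \<longlongrightarrow> w (fst (fst x)) (snd (fst x)) (snd x)) (at x within UNIV)"
  proof (rule Lim_transform[OF tendsto_const], rule Lim_null_comparison[OF _ h], rule always_eventually, rule allI)
    fix y :: "(real \<times> real) \<times> real"
    show "norm (w (fst (fst y)) (snd (fst y)) (snd y) - w (fst (fst x)) (snd (fst x)) (snd x)) \<le> ?h y"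
      using w_lip[of "fst (fst y)" "snd (fst y)" "snd y" "fst (fst x)" "snd (fst x)"] by simp
  qed
qed

lemma k_lip: "\<bar>k a \<mu> \<tau> - k a' \<mu>' \<tau>\<bar> \<le> L * (exp (2 * L * \<bar>\<tau>\<bar>) * (2 * \<bar>a - a'\<bar> + \<bar>\<mu> - \<mu>'\<bar> / L)) + \<bar>\<mu> - \<mu>'\<bar>"
proof (rule slope_diff_le[OF g_cont w_cont1 w_cont1])
  fix t :: real assume t: "0 \<le> t" "t \<le> 1"
  let ?y = "t\<^sup>2 * \<tau>"
  have y: "\<bar>?y\<bar> \<le> \<bar>\<tau>\<bar>" using t by (simp add: abs_mult mult_left_le_one_le power_le_one)
  have "\<bar>w a \<mu> ?y - w a' \<mu>' ?y\<bar> \<le> exp (2 * L * \<bar>?y\<bar>) * (2 * \<bar>a - a'\<bar> + \<bar>\<mu> - \<mu>'\<bar> / L)" by (rule w_lip)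
  also have "\<dots> \<le> exp (2 * L * \<bar>\<tau>\<bar>) * (2 * \<bar>a - a'\<bar> + \<bar>\<mu> - \<mu>'\<bar> / L)"
    using y L by (intro mult_right_mono) auto
  finally have "L * \<bar>w a \<mu> ?y - w a' \<mu>' ?y\<bar> \<le> L * (exp (2 * L * \<bar>\<tau>\<bar>) * (2 * \<bar>a - a'\<bar> + \<bar>\<mu> - \<mu>'\<bar> / L))"
    using L by simp
  with lip[of "w a \<mu> ?y" "w a' \<mu>' ?y"]
  show "\<bar>g (w a \<mu> ?y) + \<mu> - (g (w a' \<mu>' ?y) + \<mu>')\<bar> \<le> L * (exp (2 * L * \<bar>\<tau>\<bar>) * (2 * \<bar>a - a'\<bar> + \<bar>\<mu> - \<mu>'\<bar> / L)) + \<bar>\<mu> - \<mu>'\<bar>"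
    by linarith
qed

lemma k_deriv:
  "\<tau> > 0 \<Longrightarrow> (k a \<mu> has_real_derivative - (g (w a \<mu> \<tau>) + \<mu> + n * k a \<mu> \<tau>) / (2 * \<tau>)) (at \<tau>)"
  by (rule slope_ode[OF g_cont w_cont1 n])

lemma power_integral: "((\<lambda>t. t ^ (n - 1)) has_integral 1 / n) {0..1::real}"
proof -
  have "((\<lambda>t. t ^ (n - 1)) has_integral 1 ^ n / n - 0 ^ n / n) {0..1::real}"
  proof (rule fundamental_theorem_of_calculus)
    show "((\<lambda>t. t ^ n / n) has_vector_derivative t ^ (n - 1)) (at t within {0..1})" for t :: real
      unfolding has_real_derivative_iff_has_vector_derivative[symmetric] using n
      by (auto intro!: derivative_eq_intros)
  qed simp
  then show ?thesis using n by (simp add: power_0_left)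
qed

lemma slope_le:
  assumes "\<And>t. 0 \<le> t \<Longrightarrow> t \<le> 1 \<Longrightarrow> m \<le> g (w a \<mu> (t\<^sup>2 * \<tau>)) + \<mu>"
  shows "k a \<mu> \<tau> \<le> - m / n"
proof -
  have "1 / n * m \<le> integral {0..1} (\<lambda>t. t ^ (n - 1) * (g (w a \<mu> (t\<^sup>2 * \<tau>)) + \<mu>))"
  proof (rule has_integral_le[OF has_integral_mult_left[OF power_integral]])
    show "((\<lambda>t. t ^ (n - 1) * (g (w a \<mu> (t\<^sup>2 * \<tau>)) + \<mu>)) has_integral
        integral {0..1} (\<lambda>t. t ^ (n - 1) * (g (w a \<mu> (t\<^sup>2 * \<tau>)) + \<mu>))) {0..1}"
      by (intro integrable_integral slope_integrable g_cont w_cont1)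
    show "t ^ (n - 1) * m \<le> t ^ (n - 1) * (g (w a \<mu> (t\<^sup>2 * \<tau>)) + \<mu>)" if "t \<in> {0..1}" for t
      using that assms by (intro mult_left_mono) auto
  qed
  then show ?thesis by (simp add: slope_def)
qed

lemma k_zero: "k a \<mu> 0 = - (g a + \<mu>) / n"
proof -
  have "integral {0..1} (\<lambda>t. t ^ (n - 1) * (g a + \<mu>)) = 1 / n * (g a + \<mu>)"
    by (intro integral_unique has_integral_mult_left power_integral)
  then show ?thesis by (simp add: slope_def minus_divide_left)
qed

lemma decreasing_le:
  assumes "x \<le> y" "\<And>\<tau>. x < \<tau> \<Longrightarrow> \<tau> < y \<Longrightarrow> k a \<mu> \<tau> \<le> 0"
  shows "w a \<mu> y \<le> w a \<mu> x"
proof (rule DERIV_nonpos_imp_decreasing_open[OF assms(1)])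
  show "\<exists>d. (w a \<mu> has_real_derivative d) (at \<tau>) \<and> d \<le> 0" if "x < \<tau>" "\<tau> < y" for \<tau>
    using w_deriv assms(2)[OF that] by blast
qed (rule w_cont1)

lemma decreasing_less:
  assumes "x < y" "\<And>\<tau>. x < \<tau> \<Longrightarrow> \<tau> < y \<Longrightarrow> k a \<mu> \<tau> < 0"
  shows "w a \<mu> y < w a \<mu> x"
proof (rule DERIV_neg_imp_decreasing_open[OF assms(1)])
  show "\<exists>d. (w a \<mu> has_real_derivative d) (at \<tau>) \<and> d < 0" if "x < \<tau>" "\<tau> < y" for \<tau>
    using w_deriv assms(2)[OF that] by blast
qed (rule w_cont1)

section \<open>Potential, radial energy and monotone profiles\<close>

definition F :: "real \<Rightarrow> real" where "F = (SOME F. F 0 = 0 \<and> (\<forall>x. (F has_real_derivative g x) (at x)))"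

lemma F: "F 0 = 0" "(F has_real_derivative g x) (at x)"
proof -
  have "\<exists>F. F 0 = 0 \<and> (\<forall>x. (F has_real_derivative g x) (at x))"
    using antiderivative_on_UNIV[OF g_cont] by metis
  from someI_ex[OF this, folded F_def] show "F 0 = 0" "(F has_real_derivative g x) (at x)" by auto
qed

lemma F_cont: "continuous_on S F"
  using F by (meson DERIV_continuous_on has_field_derivative_at_within)

lemma F1_pos: "0 < F 1"
proof -
  have "(g has_integral F 1 - F 0) {0..1}"
    by (rule fundamental_theorem_of_calculus)
      (auto simp: has_real_derivative_iff_has_vector_derivative[symmetric] intro: F has_field_derivative_at_within)
  then show ?thesis using int_pos by (simp add: integral_unique F)
qed

lemma F_mono: "F x < F y" if "\<alpha> \<le> x" "x < y" "y \<le> 1"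
proof (rule DERIV_pos_imp_increasing_open[where f = F, OF that(2) _ F_cont])
  fix s assume "x < s" "s < y"
  then have "g s > 0" using that by (intro g_pos) auto
  then show "\<exists>d. (F has_real_derivative d) (at s) \<and> 0 < d" using F(2) by blast
qed

lemma F_neg: "F x < 0" if "0 < x" "x \<le> \<alpha>"
proof -
  have "F x < F 0"
  proof (rule DERIV_neg_imp_decreasing_open[where f = F, OF that(1) _ F_cont])
    fix s assume "0 < s" "s < x"
    then have "g s < 0" using that by (intro g_neg) auto
    then show "\<exists>d. (F has_real_derivative d) (at s) \<and> d < 0" using F(2) by blast
  qed
  then show ?thesis by (simp add: F)
qed

text \<open>The mechanical energy \<open>W'^2 / 2 + F W\<close> in the radius: with
  \<open>r^2 = 2 * \<tau>\<close> and \<open>W' = r * k\<close> the kinetic part becomes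
  \<open>\<tau> * k^2\<close>. The term \<open>(n - 1) W' / r\<close> of the Laplacian acts as
  friction.\<close>

definition E :: "real \<Rightarrow> real \<Rightarrow> real" where "E a \<tau> = \<tau> * (k a 0 \<tau>)\<^sup>2 + F (w a 0 \<tau>)"

lemma E_deriv: "\<tau> > 0 \<Longrightarrow> (E a has_real_derivative - (n - 1) * (k a 0 \<tau>)\<^sup>2) (at \<tau>)"
  unfolding E_def[abs_def] using n
  by (auto intro!: derivative_eq_intros k_deriv DERIV_chain2[OF F(2)] w_deriv
      simp: of_nat_diff field_simps power2_eq_square)

lemma E_cont: "continuous_on S (E a)"
  unfolding E_def by (intro continuous_intros k_cont1 continuous_on_compose2[OF F_cont[of UNIV]] w_cont1) auto

lemma E_antimono: "0 \<le> x \<Longrightarrow> x \<le> y \<Longrightarrow> E a y \<le> E a x"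
proof (rule DERIV_nonpos_imp_decreasing_open[where f = "E a"])
  fix \<tau> assume "0 \<le> x" "x < \<tau>"
  then have "(E a has_real_derivative - (n - 1) * (k a 0 \<tau>)\<^sup>2) (at \<tau>)" by (intro E_deriv) simp
  moreover have "- (n - 1) * (k a 0 \<tau>)\<^sup>2 \<le> 0" using n by (intro mult_nonpos_nonneg) auto
  ultimately show "\<exists>d. (E a has_real_derivative d) (at \<tau>) \<and> d \<le> 0" by blast
qed (auto intro: E_cont)

text \<open>At such a point \<open>k\<close> has derivative \<open>- g / (2 * \<tau>) < 0\<close>,
  so \<open>k\<close> would be positive just to its left.\<close>

lemma no_first_critical_point:
  assumes \<tau>: "\<tau> > 0" and neg: "\<And>r. 0 \<le> r \<Longrightarrow> r < \<tau> \<Longrightarrow> k a 0 r < 0" and z: "k a 0 \<tau> = 0"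
    and s: "\<alpha> < w a 0 \<tau>" "w a 0 \<tau> < 1"
  shows False
proof -
  have d: "(k a 0 has_real_derivative - g (w a 0 \<tau>) / (2 * \<tau>)) (at \<tau>)"
    using k_deriv[OF \<tau>, of 0 a] z by simp
  have "- g (w a 0 \<tau>) / (2 * \<tau>) < 0" using g_pos[OF s] \<tau> by simp
  from DERIV_neg_dec_left[OF d this] obtain e where e: "e > 0" "\<And>h. 0 < h \<Longrightarrow> h < e \<Longrightarrow> k a 0 (\<tau> - h) > 0"
    using z by auto
  define h where "h = min (e / 2) (\<tau> / 2)"
  have "0 < h" "h < e" "0 \<le> \<tau> - h" "\<tau> - h < \<tau>" using e \<tau> by (auto simp: h_def min_def)
  with e(2)[of h] neg[of "\<tau> - h"] show False by auto
qed

text \<open>Backward uniqueness: 0 is an equilibrium, so a profile with value and slope zero at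
  \<open>T\<close> would vanish earlier as well. A Gronwall estimate run backwards shows it: the
  weighted square sum \<open>h\<close> is nondecreasing on \<open>[T / 2, T]\<close>.\<close>

lemma no_double_zero:
  assumes T: "T > 0" and z: "w a 0 T = 0" "k a 0 T = 0" and p: "w a 0 (T / 2) > 0"
  shows False
proof -
  \<comment> \<open>On \<open>[T / 2, T]\<close> the factor \<open>1 / \<tau>\<close> is at most
    \<open>2 / T\<close>; this gives \<open>(L + 2 * n) / T\<close> for the term with
    \<open>k'\<close>, and the summand 1 absorbs \<open>2 * w * k\<close>.\<close>
  define C where "C = 1 + (L + 2 * n) / T"
  define h where "h \<tau> = exp (C * \<tau>) * ((w a 0 \<tau>)\<^sup>2 + (k a 0 \<tau>)\<^sup>2)" for \<tau>
  have "h (T / 2) \<le> h T"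
  proof (rule DERIV_nonneg_imp_nondecreasing[where f = h])
    fix \<tau> assume t: "T / 2 \<le> \<tau>" "\<tau> \<le> T"
    then have \<tau>: "\<tau> > 0" using T by linarith
    let ?w = "w a 0 \<tau>" and ?k = "k a 0 \<tau>"
    let ?d = "exp (C * \<tau>) * (C * (?w\<^sup>2 + ?k\<^sup>2) + 2 * ?w * ?k - ?k * (g ?w + n * ?k) / \<tau>)"
    have "(h has_real_derivative ?d) (at \<tau>)"
      unfolding h_def[abs_def] using \<tau>
      by (auto intro!: derivative_eq_intros k_deriv w_deriv simp: field_simps power2_eq_square)
    moreover have "0 \<le> ?d"
    proof -
      have s: "2 * \<bar>?w\<bar> * \<bar>?k\<bar> \<le> ?w\<^sup>2 + ?k\<^sup>2"
        using sum_squares_bound[of "\<bar>?w\<bar>" "\<bar>?k\<bar>"] by simp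
      have "- (2 * ?w * ?k) \<le> \<bar>2 * ?w * ?k\<bar>" by (rule abs_ge_minus_self)
      then have 1: "- (2 * ?w * ?k) \<le> ?w\<^sup>2 + ?k\<^sup>2" using s by (simp add: abs_mult)
      have "?k * (g ?w + n * ?k) \<le> \<bar>?k\<bar> * \<bar>g ?w + n * ?k\<bar>" by (metis abs_ge_self abs_mult)
      also have "\<dots> \<le> \<bar>?k\<bar> * (L * \<bar>?w\<bar> + n * \<bar>?k\<bar>)"
        using lip[of ?w 0] g0[of 0] abs_triangle_ineq[of "g ?w" "n * ?k"]
        by (intro mult_left_mono) (auto simp: abs_mult)
      also have "\<dots> = L / 2 * (2 * \<bar>?w\<bar> * \<bar>?k\<bar>) + n * ?k\<^sup>2" by (simp add: algebra_simps power2_eq_square)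
      also have "\<dots> \<le> L / 2 * (?w\<^sup>2 + ?k\<^sup>2) + n * (?w\<^sup>2 + ?k\<^sup>2)"
        using s L by (intro add_mono mult_left_mono) auto
      finally have q: "?k * (g ?w + n * ?k) \<le> (L / 2 + n) * (?w\<^sup>2 + ?k\<^sup>2)" by (simp add: distrib_right)
      have "?k * (g ?w + n * ?k) / \<tau> \<le> (L / 2 + n) * (?w\<^sup>2 + ?k\<^sup>2) / \<tau>" using q \<tau> by (intro divide_right_mono) auto
      also have "\<dots> \<le> (L / 2 + n) * (?w\<^sup>2 + ?k\<^sup>2) / (T / 2)"
        using t T L by (intro divide_left_mono) auto
      also have "\<dots> = (C - 1) * (?w\<^sup>2 + ?k\<^sup>2)" using T by (simp add: C_def field_simps)
      finally have "0 \<le> C * (?w\<^sup>2 + ?k\<^sup>2) + 2 * ?w * ?k - ?k * (g ?w + n * ?k) / \<tau>" using 1 by (simp add: left_diff_distrib)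
      then show ?thesis by simp
    qed
    ultimately show "\<exists>d. (h has_real_derivative d) (at \<tau>) \<and> 0 \<le> d" by blast
  qed (use T in simp)
  then have "(w a 0 (T / 2))\<^sup>2 + (k a 0 (T / 2))\<^sup>2 \<le> 0" by (simp add: h_def z mult_le_0_iff)
  with p show False by (metis add_nonneg_nonneg antisym less_irrefl power2_eq_square sum_squares_eq_zero_iff zero_le_power2)
qed

text \<open>The energy at \<open>T\<close> is \<open>T * k^2 \<ge> 0\<close>, hence it is
  nonnegative on all of \<open>[0, T]\<close>. At a critical point it equals \<open>F w\<close>, and
  \<open>F < 0\<close> on \<open>(0, \<alpha>]\<close> forces the value above
  \<open>\<alpha>\<close>, where a first critical point cannot occur. At \<open>T\<close> itself
  backward uniqueness excludes slope zero.\<close>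

lemma slope_neg_up_to_zero:
  assumes a: "a < 1" and T: "T > 0" and z: "w a 0 T = 0" and p: "\<And>\<tau>. 0 \<le> \<tau> \<Longrightarrow> \<tau> < T \<Longrightarrow> w a 0 \<tau> > 0"
    and \<tau>: "0 \<le> \<tau>" "\<tau> \<le> T"
  shows "k a 0 \<tau> < 0"
proof (rule ccontr)
  have a0: "a > 0" using p[of 0] T by simp
  have En: "0 \<le> E a s" if "0 \<le> s" "s \<le> T" for s
    using E_antimono[of s T a] that T z by (auto simp: E_def F intro: order_trans[rotated])
  have "0 \<le> F a" using En[of 0] T by (simp add: E_def)
  with F_neg[of a] a0 have "\<alpha> < a" by force
  then have k0: "k a 0 0 < 0" using g_pos[of a] a n by (simp add: k_zero)
  assume "\<not> k a 0 \<tau> < 0"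
  then obtain s where s: "0 < s" "s \<le> T" "k a 0 s = 0" "\<And>r. 0 \<le> r \<Longrightarrow> r < s \<Longrightarrow> k a 0 r < 0"
    using first_zero[OF k_cont1 k0 \<tau>] by (auto simp: not_less)
  have ws: "w a 0 s < 1" using decreasing_less[of 0 s 0 a] s a by auto
  show False
  proof (cases "s = T")
    case True
    with no_double_zero[OF T z] s p[of "T / 2"] T show False by auto
  next
    case False
    then have "w a 0 s > 0" using s p by auto
    moreover have "0 \<le> F (w a 0 s)" using En[of s] s by (simp add: E_def)
    ultimately have "\<alpha> < w a 0 s" using F_neg[of "w a 0 s"] by force
    then show False using no_first_critical_point s ws by blast
  qed
qed

text \<open>The profile crosses zero with negative slope, so the crossing survives a small negative
  shift of the reaction, and so does the negative slope on a slightly longer interval.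
  \<open>S\<close> leaves room for the zero to move.\<close>

lemma strict_profile:
  assumes a: "a < 1" and T: "T > 0" and z: "w a 0 T = 0" and p: "\<And>\<tau>. 0 \<le> \<tau> \<Longrightarrow> \<tau> < T \<Longrightarrow> w a 0 \<tau> > 0"
    and S: "T < S"
  obtains \<eta> T' where "\<eta> > 0" "0 < T'" "T' < S" "w a (- \<eta>) T' = 0"
    "\<And>\<tau>. 0 \<le> \<tau> \<Longrightarrow> \<tau> < T' \<Longrightarrow> w a (- \<eta>) \<tau> > 0" "\<And>\<tau>. 0 \<le> \<tau> \<Longrightarrow> \<tau> \<le> T' \<Longrightarrow> k a (- \<eta>) \<tau> < 0" "\<alpha> < a"
proof -
  note kneg = slope_neg_up_to_zero[OF a T z p]
  have kT: "k a 0 T < 0" using kneg[of T] T by auto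
  have "isCont (k a 0) T" using k_cont1[of UNIV] by (auto simp: continuous_on_eq_continuous_at)
  then obtain d where d: "d > 0" "\<And>x. \<bar>x - T\<bar> < d \<Longrightarrow> \<bar>k a 0 x - k a 0 T\<bar> < - k a 0 T"
    using kT unfolding continuous_at_eps_delta dist_real_def by (metis neg_0_less_iff_less)
  \<comment> \<open>Going beyond \<open>T\<close> while the slope is still negative makes the
    unshifted profile strictly negative at \<open>S'\<close>.\<close>
  define S' where "S' = T + min (d / 2) ((S - T) / 2)"
  have S': "T < S'" "S' < S" "S' - T < d" using d S by (auto simp: S'_def min_def field_simps)
  have neg: "k a 0 \<tau> < 0" if "0 \<le> \<tau>" "\<tau> \<le> S'" for \<tau>
    using kneg[of \<tau>] d(2)[of \<tau>] that S' by (cases "\<tau> \<le> T") auto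
  obtain t where t: "t \<in> {0..S'}" "\<And>\<tau>. \<tau> \<in> {0..S'} \<Longrightarrow> k a 0 \<tau> \<le> k a 0 t"
    using continuous_attains_sup[of "{0..S'}" "k a 0"] k_cont1 T S' by auto
  define m where "m = - k a 0 t"
  have m: "m > 0" using neg t by (simp add: m_def)
  have wS: "w a 0 S' < 0" using decreasing_less[of T S' 0 a] S' neg T z by auto
  define c where "c = exp (2 * L * S')"
  have c: "c > 0" by (simp add: c_def)
  \<comment> \<open>By \<open>k_lip\<close> the shift changes the slope by at most
    \<open>(c + 1) * \<eta>\<close>, to be kept below \<open>m\<close>; by \<open>w_lip\<close> it
    changes the value at \<open>S'\<close> by at most \<open>c * \<eta> / L\<close>, to be kept
    below \<open>- w a 0 S'\<close>. The factors 2 make both strict.\<close>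
  define \<eta> where "\<eta> = min (m / (2 * (c + 1))) (- w a 0 S' * L / (2 * c))"
  have \<eta>: "\<eta> > 0" 
  proof -
    have "0 < - w a 0 S' * L / (2 * c)" using wS L c by (intro divide_pos_pos mult_pos_pos) auto
    then show ?thesis using m c by (simp add: \<eta>_def)
  qed
  have "(c + 1) * \<eta> \<le> (c + 1) * (m / (2 * (c + 1)))"
    using c by (intro mult_left_mono) (auto simp: \<eta>_def)
  also have "\<dots> = m / 2" using c by (simp add: field_simps)
  finally have \<eta>1: "(c + 1) * \<eta> < m" using m by simp
  have "c * \<eta> / L \<le> c * (- w a 0 S' * L / (2 * c)) / L"
    using c L by (intro divide_right_mono mult_left_mono) (auto simp: \<eta>_def)
  also have "\<dots> = - w a 0 S' / 2" using c L by (simp add: field_simps)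
  finally have \<eta>2: "c * \<eta> / L < - w a 0 S'" using wS by simp
  have kn: "k a (- \<eta>) \<tau> < 0" if "0 \<le> \<tau>" "\<tau> \<le> S'" for \<tau>
  proof -
    have "\<bar>k a (- \<eta>) \<tau> - k a 0 \<tau>\<bar> \<le> L * (exp (2 * L * \<bar>\<tau>\<bar>) * (\<eta> / L)) + \<eta>"
      using k_lip[of "- \<eta>" a \<tau> 0 a] \<eta> by simp
    also have "\<dots> \<le> L * (c * (\<eta> / L)) + \<eta>"
      using that L \<eta> by (intro add_mono mult_left_mono mult_right_mono) (auto simp: c_def)
    also have "\<dots> = (c + 1) * \<eta>" using L by (simp add: field_simps)
    finally show ?thesis using t(2)[of \<tau>] that \<eta>1 by (auto simp: m_def)
  qed
  have "\<bar>w a (- \<eta>) S' - w a 0 S'\<bar> \<le> c * \<eta> / L"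
    using w_lip[of a "- \<eta>" S' a 0] \<eta> S' T by (simp add: c_def)
  then have "w a (- \<eta>) S' < 0" using \<eta>2 by linarith
  moreover have a0: "a > 0" using p[of 0] T by simp
  ultimately obtain T' where T': "0 < T'" "T' \<le> S'" "w a (- \<eta>) T' = 0" "\<And>r. 0 \<le> r \<Longrightarrow> r < T' \<Longrightarrow> w a (- \<eta>) r > 0"
    using first_zero_pos[OF w_cont1, of a "- \<eta>" S' S'] S' T by (auto simp: less_imp_le)
  \<comment> \<open>Negative slope at the centre means \<open>g a > \<eta>\<close>, and this places
    \<open>a\<close> beyond \<open>\<alpha>\<close>.\<close>
  have "g a > 0" using kn[of 0] T S' n \<eta> by (simp add: k_zero divide_less_0_iff)
  then have "\<alpha> < a" using g_neg[of a] \<alpha>(3) a0 by (cases a \<alpha> rule: linorder_cases) auto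
  with that[OF \<eta> T'(1) _ T'(3,4)] kn T' S' show thesis by auto
qed

text \<open>A shooting argument; it makes the set of radii whose infimum is \<open>R0\<close>
  nonempty. If all profiles stayed positive, one that remains near 1 up to a large \<open>T\<close>
  would lose little energy afterwards, since friction is weak at large radius. It would then
  decrease forever, and fast enough to become negative, whether it drops to \<open>b0\<close> or
  lingers above it.\<close>

lemma ex_zero:
  obtains a T where "0 < a" "a < 1" "0 < T" "w a 0 T = 0" "\<And>\<tau>. 0 \<le> \<tau> \<Longrightarrow> \<tau> < T \<Longrightarrow> w a 0 \<tau> > 0"
proof (rule ccontr)
  assume not_thesis: "\<not> thesis"
  note found = that
  have pos: "w a 0 \<tau> > 0" if a: "0 < a" "a < 1" and "0 \<le> \<tau>" for a \<tau>
  proof (rule ccontr)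
    assume "\<not> w a 0 \<tau> > 0"
    then obtain T where "0 < T" "w a 0 T = 0" "\<And>r. 0 \<le> r \<Longrightarrow> r < T \<Longrightarrow> w a 0 r > 0"
      using first_zero_pos[OF w_cont1, of a 0 \<tau> \<tau>] a \<open>0 \<le> \<tau>\<close> by (auto simp: not_less)
    with found[OF a] not_thesis show False by blast
  qed
  have "isCont F 1" using F_cont[of UNIV] by (auto simp: continuous_on_eq_continuous_at)
  then obtain d where d: "d > 0" "\<And>x. \<bar>x - 1\<bar> < d \<Longrightarrow> \<bar>F x - F 1\<bar> < F 1"
    using F1_pos unfolding continuous_at_eps_delta dist_real_def by metis
  \<comment> \<open>Close enough to 1 for \<open>F b0 > 0\<close> and \<open>\<alpha> < b0\<close>;
    then \<open>F b0\<close> is the maximum of \<open>F\<close> on \<open>[0, b0]\<close>.\<close>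
  define b0 where "b0 = 1 - min (d / 2) ((1 - \<alpha>) / 2)"
  have "0 < min (d / 2) ((1 - \<alpha>) / 2)" "min (d / 2) ((1 - \<alpha>) / 2) < d" "min (d / 2) ((1 - \<alpha>) / 2) < 1 - \<alpha>"
    using d(1) \<alpha> by (simp_all add: min_less_iff_disj)
  then have "\<alpha> < b0" "b0 < 1" "\<bar>b0 - 1\<bar> < d" by (auto simp: b0_def)
  with d(2)[of b0] have b0: "\<alpha> < b0" "b0 < 1" "F b0 > 0" by (auto simp: abs_less_iff)
  define b1 where "b1 = (b0 + 1) / 2"
  have b1: "b0 < b1" "b1 < 1" using b0 by (auto simp: b1_def)
  have Fb: "F b0 < F b1" using F_mono[of b0 b1] b0 b1 by auto
  have F_le: "F s \<le> F b0" if "0 \<le> s" "s \<le> b0" for s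
  proof (cases "s \<le> \<alpha>")
    case True
    then show ?thesis using F_neg[of s] that b0 by (cases "s = 0") (auto simp: F)
  next
    case False
    then show ?thesis using F_mono[of s b0] that b0 by (cases "s = b0") auto
  qed
  \<comment> \<open>Half of the gap is what friction may consume; the other half keeps the energy
    above \<open>F b0\<close>.\<close>
  define q where "q = (F b1 - F b0) / 2"
  have q: "q > 0" using Fb by (simp add: q_def)
  have "bounded (F ` {0..1})"
    by (rule compact_imp_bounded[OF compact_continuous_image[OF F_cont compact_Icc]])
  then obtain C where C: "\<And>s. s \<in> {0..1} \<Longrightarrow> \<bar>F s\<bar> \<le> C"
    unfolding bounded_iff by (metis imageI real_norm_def)
  have C0: "C \<ge> 0" using C[of 0] by auto
  \<comment> \<open>Chosen so that the slope bound \<open>c\<close>, valid after \<open>T\<close>,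
    satisfies \<open>n * c \<le> q\<close>.\<close>
  define T where "T = 2 * C * (n / q)\<^sup>2 + 1"
  have T: "T > 0" using C0 by (simp add: T_def add_nonneg_pos)
  define c where "c = sqrt (2 * C / T)"
  have c0: "c \<ge> 0" using C0 T by (simp add: c_def)
  have "n * c \<le> q"
  proof (rule power2_le_imp_le)
    have "2 * C * (n / q)\<^sup>2 \<le> T" by (simp add: T_def)
    then have "n\<^sup>2 * (2 * C / T) \<le> q\<^sup>2" using q T by (simp add: field_simps)
    then show "(n * c)\<^sup>2 \<le> q\<^sup>2" using C0 T by (simp add: c_def power_mult_distrib)
  qed (use q in simp)
  \<comment> \<open>\<open>w_lip\<close> compares with the constant profile 1; this \<open>a\<close>
    keeps the deviation up to \<open>T\<close> within \<open>(1 - b1) / 2\<close>.\<close>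
  define a where "a = 1 - (1 - b1) / (4 * exp (2 * L * T))"
  have "(1 - b1) / (4 * exp (2 * L * T)) \<le> (1 - b1) / (4 * 1)"
    using b1 L T by (intro divide_left_mono mult_left_mono) auto
  also have "\<dots> < 1 - b1" using b1 by simp
  finally have a: "b1 < a" "a < 1" using b1 by (auto simp: a_def)
  have a0: "0 < a" using a b1 b0 \<alpha> by linarith
  have early: "b1 < w a 0 \<tau>" if "0 \<le> \<tau>" "\<tau> \<le> T" for \<tau>
  proof -
    have "\<bar>w a 0 \<tau> - 1\<bar> \<le> exp (2 * L * \<tau>) * (2 * (1 - a))"
      using w_lip[of a 0 \<tau> 1 0] w_const[of 1 0 \<tau>] g1[of 1] a that by simp
    also have "\<dots> \<le> exp (2 * L * T) * (2 * (1 - a))"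
      using that L a by (intro mult_right_mono) auto
    also have "\<dots> = (1 - b1) / 2" by (simp add: a_def)
    finally show ?thesis using b1 abs_ge_minus_self[of "w a 0 \<tau> - 1"] by (simp add: field_simps)
  qed
  \<comment> \<open>The dissipation rate is \<open>(n - 1) * k^2 \<le> n * c * (- k)\<close>. Its
    integral is at most \<open>n * c\<close>, because the profile drops by at most 1 in total; so
    the loss after \<open>T\<close> is at most \<open>q\<close>.\<close>
  have late: "F b1 - q \<le> E a S" if S: "T \<le> S" and neg: "\<And>r. 0 \<le> r \<Longrightarrow> r < S \<Longrightarrow> k a 0 r < 0" for S
  proof -
    have w01: "w a 0 r \<in> {0..1}" if "0 \<le> r" "r \<le> S" for r
      using pos[OF a0 a(2), of r] decreasing_le[of 0 r 0 a] neg that a by (auto simp: less_imp_le)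
    have "E a T - n * c * w a 0 T \<le> E a S - n * c * w a 0 S"
    proof (rule DERIV_nonneg_imp_increasing_open[OF S])
      fix \<tau> assume \<tau>: "T < \<tau>" "\<tau> < S"
      have "\<tau> * (k a 0 \<tau>)\<^sup>2 \<le> E a 0 - F (w a 0 \<tau>)"
        using E_antimono[of 0 \<tau> a] \<tau> T by (simp add: E_def)
      also have "\<dots> \<le> 2 * C"
        using C[of a] C[OF w01[of \<tau>]] a a0 \<tau> T by (auto simp: E_def)
      finally have "T * (k a 0 \<tau>)\<^sup>2 \<le> 2 * C"
        using \<tau> by (meson less_imp_le mult_right_mono order_trans zero_le_power2)
      then have "(k a 0 \<tau>)\<^sup>2 \<le> 2 * C / T" using T by (simp add: field_simps)
      then have kc: "- k a 0 \<tau> \<le> c" unfolding c_def by (intro real_le_rsqrt) simp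
      have "((\<lambda>\<tau>. E a \<tau> - n * c * w a 0 \<tau>) has_real_derivative
          - (n - 1) * (k a 0 \<tau>)\<^sup>2 - n * c * k a 0 \<tau>) (at \<tau>)"
        using \<tau> T by (auto intro!: derivative_eq_intros E_deriv w_deriv)
      moreover have "0 \<le> - (n - 1) * (k a 0 \<tau>)\<^sup>2 - n * c * k a 0 \<tau>"
      proof -
        have kn: "0 \<le> - k a 0 \<tau>" using neg[of \<tau>] \<tau> T by simp
        then have "(k a 0 \<tau>)\<^sup>2 \<le> c * (- k a 0 \<tau>)" using mult_right_mono[OF kc kn] by (simp add: power2_eq_square)
        then have "n * (k a 0 \<tau>)\<^sup>2 \<le> n * (c * (- k a 0 \<tau>))" by (intro mult_left_mono) auto
        then have "0 \<le> (k a 0 \<tau>)\<^sup>2 + (n * (c * (- k a 0 \<tau>)) - n * (k a 0 \<tau>)\<^sup>2)"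
          using zero_le_power2[of "k a 0 \<tau>"] by linarith
        moreover have "- (n - 1) * (k a 0 \<tau>)\<^sup>2 - n * c * k a 0 \<tau>
            = (k a 0 \<tau>)\<^sup>2 + (n * (c * (- k a 0 \<tau>)) - n * (k a 0 \<tau>)\<^sup>2)"
          using n by (simp add: of_nat_diff algebra_simps)
        ultimately show ?thesis by (simp only:)
      qed
      ultimately show "\<exists>y. ((\<lambda>\<tau>. E a \<tau> - n * c * w a 0 \<tau>) has_real_derivative y) (at \<tau>) \<and> 0 \<le> y" by blast
    qed (intro continuous_intros E_cont w_cont1)
    moreover have "F b1 \<le> E a T"
    proof -
      have "F b1 \<le> F (w a 0 T)"
        using F_mono[of b1 "w a 0 T"] early[of T] w01[of T] T S b1 b0 by auto
      then show ?thesis using T by (simp add: E_def add_increasing)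
    qed
    moreover have "n * c * w a 0 T - n * c * w a 0 S \<le> q"
    proof -
      have "n * c * (w a 0 T - w a 0 S) \<le> n * c * 1"
        using w01[of T] w01[of S] S T c0 by (intro mult_left_mono) auto
      then show ?thesis using \<open>n * c \<le> q\<close> by (simp add: right_diff_distrib)
    qed
    ultimately show ?thesis by linarith
  qed
  have e: "F b1 - q > F b0" using Fb by (simp add: q_def field_simps)
  have neg: "k a 0 \<tau> < 0" if "0 \<le> \<tau>" for \<tau>
  proof (rule ccontr)
    assume "\<not> k a 0 \<tau> < 0"
    moreover have "k a 0 0 < 0" using g_pos[of a] a b1 b0 n by (simp add: k_zero)
    ultimately obtain s where s: "0 < s" "k a 0 s = 0" "\<And>r. 0 \<le> r \<Longrightarrow> r < s \<Longrightarrow> k a 0 r < 0"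
      using first_zero[OF k_cont1 _ \<open>0 \<le> \<tau>\<close>, of 0 a \<tau>] by (auto simp: not_less)
    have ws: "w a 0 s < 1" using decreasing_less[of 0 s 0 a] s a by auto
    have "\<alpha> < w a 0 s"
    proof (cases "s \<le> T")
      case True
      then show ?thesis using early[of s] s b1 b0 by auto
    next
      case False
      \<comment> \<open>At a critical point all energy is potential, so the value must exceed
        \<open>b0\<close>.\<close>
      then have "F b0 < F (w a 0 s)" using late[of s] s e by (simp add: E_def)
      then show ?thesis using F_le[of "w a 0 s"] pos[OF a0 a(2), of s] s b0 by force
    qed
    then show False using no_first_critical_point s ws by blast
  qed
  have w_le: "w a 0 \<tau> \<le> w a 0 s" if "0 \<le> s" "s \<le> \<tau>" for s \<tau>
    using decreasing_le[OF that(2), of 0 a] neg that by (auto simp: less_imp_le)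
  show False
  proof (cases "\<exists>s\<ge>T. w a 0 s \<le> b0")
    case True
    then obtain s where s: "T \<le> s" "w a 0 s \<le> b0" by blast
    \<comment> \<open>Below \<open>b0\<close> at least \<open>q\<close> of the energy is kinetic,
      hence \<open>k \<le> - sqrt (q / \<tau>)\<close>. Integrating this bound from \<open>s\<close>
      to \<open>t\<close> gives a drop of \<open>2 * sqrt q * (sqrt t - sqrt s) = 2\<close>, more
      than the available height.\<close>
    define t where "t = (sqrt s + 1 / sqrt q)\<^sup>2"
    have rt: "sqrt t = sqrt s + 1 / sqrt q" using s T q by (simp add: t_def)
    then have st: "s \<le> t" using q by (subst real_sqrt_le_iff[symmetric]) simp
    have "w a 0 t + 2 * sqrt q * sqrt t \<le> w a 0 s + 2 * sqrt q * sqrt s"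
    proof (rule DERIV_nonpos_imp_decreasing_open[OF st])
      fix \<tau> assume \<tau>: "s < \<tau>" "\<tau> < t"
      then have \<tau>0: "\<tau> > 0" using s T by linarith
      have "F (w a 0 \<tau>) \<le> F b0"
        using F_le[of "w a 0 \<tau>"] pos[OF a0 a(2), of \<tau>] w_le[of s \<tau>] s T \<tau> by auto
      moreover have "F b1 - q \<le> E a \<tau>" using late[of \<tau>] neg s \<tau> by auto
      ultimately have "q \<le> \<tau> * (k a 0 \<tau>)\<^sup>2" by (simp add: E_def q_def field_simps)
      then have 1: "q / \<tau> \<le> (- k a 0 \<tau>)\<^sup>2" using \<tau>0 by (simp add: pos_divide_le_eq mult.commute)
      have 2: "0 \<le> - k a 0 \<tau>" using neg[of \<tau>] \<tau>0 by simp
      have "sqrt (q / \<tau>) \<le> - k a 0 \<tau>" by (rule real_le_lsqrt[OF 2 1])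
      moreover have "2 * sqrt q * (inverse (sqrt \<tau>) / 2) = sqrt (q / \<tau>)"
        by (simp add: real_sqrt_divide inverse_eq_divide)
      ultimately have "k a 0 \<tau> + 2 * sqrt q * (inverse (sqrt \<tau>) / 2) \<le> 0" by linarith
      moreover have "((\<lambda>\<tau>. w a 0 \<tau> + 2 * sqrt q * sqrt \<tau>) has_real_derivative
           k a 0 \<tau> + 2 * sqrt q * (inverse (sqrt \<tau>) / 2)) (at \<tau>)"
        by (intro DERIV_add w_deriv DERIV_cmult DERIV_real_sqrt[OF \<tau>0])
      ultimately show "\<exists>y. ((\<lambda>\<tau>. w a 0 \<tau> + 2 * sqrt q * sqrt \<tau>) has_real_derivative y) (at \<tau>) \<and> y \<le> 0"
        by blast
    qed (intro continuous_intros w_cont1)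
    then have "w a 0 t \<le> w a 0 s - 2" using q by (simp add: rt algebra_simps)
    moreover have "w a 0 s \<le> 1" using w_le[of 0 s] s T a by simp
    ultimately show False using pos[OF a0 a(2), of t] st s T by simp
  next
    case False
    then have "b0 < w a 0 s" if "T \<le> s" for s using that by (meson not_le)
    then have big: "b0 < w a 0 \<tau>" if "0 \<le> \<tau>" for \<tau>
      using early[of \<tau>] that b1 by (cases "\<tau> \<le> T") (auto simp: not_le)
    \<comment> \<open>While the profile lingers in \<open>[b0, a]\<close> the reaction is at least
      \<open>g x > 0\<close> and the slope at most \<open>- g x / n\<close>, so at
      \<open>n / g x\<close> it has dropped by 1.\<close>
    obtain x where x: "x \<in> {b0..a}" "\<And>s. s \<in> {b0..a} \<Longrightarrow> g x \<le> g s"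
      using continuous_attains_inf[of "{b0..a}" g] continuous_on_subset[OF g_cont] a b1 by auto
    have m: "g x > 0" using x b0 a by (intro g_pos) auto
    have k_le: "k a 0 \<tau> \<le> - g x / n" if "0 \<le> \<tau>" for \<tau>
    proof (rule slope_le)
      fix t :: real assume "0 \<le> t" "t \<le> 1"
      then show "g x \<le> g (w a 0 (t\<^sup>2 * \<tau>)) + 0"
        using x(2)[of "w a 0 (t\<^sup>2 * \<tau>)"] big[of "t\<^sup>2 * \<tau>"] w_le[of 0 "t\<^sup>2 * \<tau>"] that by auto
    qed
    define t where "t = n / g x"
    have t: "0 < t" using m n by (simp add: t_def)
    have "w a 0 t + g x / n * t \<le> w a 0 0 + g x / n * 0"
    proof (rule DERIV_nonpos_imp_decreasing_open[where f = "\<lambda>\<tau>. w a 0 \<tau> + g x / n * \<tau>"])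
      fix \<tau> :: real assume "0 < \<tau>"
      have "((\<lambda>\<tau>. w a 0 \<tau> + g x / n * \<tau>) has_real_derivative k a 0 \<tau> + g x / n) (at \<tau>)"
        using DERIV_add[OF w_deriv[of a 0 \<tau>] DERIV_cmult[OF DERIV_ident, of "g x / n"]] by simp
      then show "\<exists>y. ((\<lambda>\<tau>. w a 0 \<tau> + g x / n * \<tau>) has_real_derivative y) (at \<tau>) \<and> y \<le> 0"
        using k_le[of \<tau>] \<open>0 < \<tau>\<close> by (intro exI[of _ "k a 0 \<tau> + g x / n"]) auto
    qed (use t n in \<open>auto intro!: continuous_intros w_cont1\<close>)
    then have "w a 0 t \<le> a - 1" using m n by (simp add: t_def)
    then show False using pos[OF a0 a(2), of t] t a by simp
  qed
qed

end

section \<open>Radial solutions of the Dirichlet problem\<close>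

text \<open>Restriction to the line through \<open>x\<close> in direction \<open>b\<close>. Summed
  over a basis it gives the sign of the Laplacian at a minimum, for the elliptic and for the
  parabolic comparison alike.\<close>

lemma second_order_min:
  fixes p :: "'a::euclidean_space \<Rightarrow> real"
  assumes D: "eventually (\<lambda>y. (p has_derivative p' y) (at y)) (nhds x)"
    and D2: "((\<lambda>s. p' (x + s *\<^sub>R b) b) has_real_derivative H) (at 0)"
    and min: "eventually (\<lambda>y. p x \<le> p y) (nhds x)"
  shows "p' x b = 0" "0 \<le> H"
proof -
  define \<phi> where "\<phi> s = p (x + s *\<^sub>R b)" for s :: real
  define \<psi> where "\<psi> s = p' (x + s *\<^sub>R b) b" for s :: real
  have lim: "filterlim (\<lambda>s. x + s *\<^sub>R b) (nhds x) (nhds (0::real))"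
  proof -
    have "((\<lambda>s. x + s *\<^sub>R b) \<longlongrightarrow> x + 0 *\<^sub>R b) (nhds (0::real))"
      by (intro tendsto_intros) (rule filterlim_ident)
    then show ?thesis by simp
  qed
  have "eventually (\<lambda>s. (p has_derivative p' (x + s *\<^sub>R b)) (at (x + s *\<^sub>R b)) \<and> p x \<le> p (x + s *\<^sub>R b)) (nhds (0::real))"
    using eventually_compose_filterlim[OF eventually_conj[OF D min] lim] .
  then obtain d where d: "d > 0"
    and dd: "\<And>s. \<bar>s\<bar> < d \<Longrightarrow> (p has_derivative p' (x + s *\<^sub>R b)) (at (x + s *\<^sub>R b))"
    and dm: "\<And>s. \<bar>s\<bar> < d \<Longrightarrow> \<phi> 0 \<le> \<phi> s"
    unfolding eventually_nhds_metric dist_real_def \<phi>_def by auto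
  have \<phi>d: "(\<phi> has_real_derivative \<psi> s) (at s)" if "\<bar>s\<bar> < d" for s
  proof -
    have "((\<lambda>s. x + s *\<^sub>R b) has_derivative (\<lambda>h. h *\<^sub>R b)) (at s)"
      by (auto intro!: derivative_eq_intros)
    from has_derivative_compose[OF this dd[OF that]]
    have "(\<phi> has_derivative (\<lambda>h. p' (x + s *\<^sub>R b) (h *\<^sub>R b))) (at s)" by (simp add: \<phi>_def[abs_def])
    moreover have "p' (x + s *\<^sub>R b) (h *\<^sub>R b) = \<psi> s * h" for h
      using linear_cmul[OF has_derivative_linear[OF dd[OF that]]] by (simp add: \<psi>_def)
    ultimately show ?thesis by (simp add: has_field_derivative_def)
  qed
  have z: "\<psi> 0 = 0"
    using DERIV_local_min[OF \<phi>d[of 0] d] dm d by auto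
  then show "p' x b = 0" by (simp add: \<psi>_def)
  show "0 \<le> H"
  proof (rule ccontr)
    assume "\<not> 0 \<le> H"
    then have "H < 0" by simp
    have "(\<psi> has_real_derivative H) (at 0)" using D2 by (simp add: \<psi>_def[abs_def])
    from DERIV_neg_dec_right[OF this \<open>H < 0\<close>] z obtain e where e: "e > 0" "\<And>h. 0 < h \<Longrightarrow> h < e \<Longrightarrow> \<psi> h < 0"
      by auto
    define h where "h = min (d / 2) (e / 2)"
    have h: "0 < h" "h < d" "h < e" using d e by (auto simp: h_def)
    have "\<phi> h < \<phi> 0"
    proof (rule DERIV_neg_imp_decreasing_open[where f = \<phi>, OF h(1)])
      show "\<exists>y. (\<phi> has_real_derivative y) (at s) \<and> y < 0" if "0 < s" "s < h" for s
        using \<phi>d[of s] e(2)[of s] that h by auto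
      show "continuous_on {0..h} \<phi>"
      proof (rule continuous_at_imp_continuous_on, rule ballI)
        fix s assume "s \<in> {0..h}"
        then have "\<bar>s\<bar> < d" using h by auto
        then show "isCont \<phi> s" using \<phi>d DERIV_isCont by blast
      qed
    qed
    then show False using dm[of h] h by auto
  qed
qed

section \<open>Derivatives of radial functions\<close>

lemma radial_has_derivative:
  fixes W K :: "real \<Rightarrow> real" and x :: "'a::euclidean_space"
  assumes "\<And>\<tau>. (W has_real_derivative K \<tau>) (at \<tau>)"
  shows "((\<lambda>x. W (x \<bullet> x / 2)) has_derivative (\<lambda>v. (K (x \<bullet> x / 2) *\<^sub>R x) \<bullet> v)) (at x)"
proof -
  have "((\<lambda>x. x \<bullet> x / 2) has_derivative (\<lambda>v. x \<bullet> v)) (at x)"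
    by (auto intro!: derivative_eq_intros simp: inner_commute)
  from has_derivative_compose[OF this assms[unfolded has_field_derivative_def]] show ?thesis
    by simp
qed

lemma radial_gradient_has_derivative:
  fixes K :: "real \<Rightarrow> real" and x :: "'a::euclidean_space"
  assumes "(K has_real_derivative K') (at (x \<bullet> x / 2))"
  shows "((\<lambda>x. K (x \<bullet> x / 2) *\<^sub>R x) has_derivative
      (\<lambda>v. K (x \<bullet> x / 2) *\<^sub>R v + (K' * (x \<bullet> v)) *\<^sub>R x)) (at x)"
proof -
  have "((\<lambda>x. x \<bullet> x / 2) has_derivative (\<lambda>v. x \<bullet> v)) (at x)"
    by (auto intro!: derivative_eq_intros simp: inner_commute)
  from has_derivative_compose[OF this assms[unfolded has_field_derivative_def]]
  have "((\<lambda>x. K (x \<bullet> x / 2)) has_derivative (\<lambda>v. K' * (x \<bullet> v))) (at x)" .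
  from has_derivative_scaleR[OF this has_derivative_ident] show ?thesis by simp
qed

text \<open>The formula for the derivative of \<open>k\<close> is available for
  \<open>\<tau> > 0\<close> only. At the centre the factor \<open>x\<close> compensates, and
  continuity of \<open>K\<close> suffices.\<close>

lemma radial_gradient_has_derivative_zero:
  fixes K :: "real \<Rightarrow> real"
  assumes "isCont K 0"
  shows "((\<lambda>x. K (x \<bullet> x / 2) *\<^sub>R x) has_derivative (\<lambda>v. K 0 *\<^sub>R v)) (at (0::'a::euclidean_space))"
  unfolding has_derivative_at2
proof (intro conjI bounded_linear_scaleR_right)
  have c: "((\<lambda>y::'a. K (y \<bullet> y / 2)) \<longlongrightarrow> K 0) (at 0)"
  proof (rule isCont_tendsto_compose[OF assms])
    have "((\<lambda>y::'a. y \<bullet> y / 2) \<longlongrightarrow> 0 \<bullet> (0::'a) / 2) (at 0)" by (intro tendsto_intros) auto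
    then show "((\<lambda>y::'a. y \<bullet> y / 2) \<longlongrightarrow> 0) (at 0)" by simp
  qed
  have "((\<lambda>y::'a. \<bar>K (y \<bullet> y / 2) - K 0\<bar>) \<longlongrightarrow> 0) (at 0)"
    using tendsto_rabs[OF tendsto_diff[OF c tendsto_const[of "K 0"]]] by simp
  then show "((\<lambda>y::'a. (1 / norm (y - 0)) *\<^sub>R (K (y \<bullet> y / 2) *\<^sub>R y - (K (0 \<bullet> 0 / 2) *\<^sub>R 0 + K 0 *\<^sub>R (y - 0)))) \<longlongrightarrow> 0) (at 0)"
    by (rule Lim_null_comparison[rotated])
      (auto simp: eventually_at_filter scaleR_diff_left[symmetric])
qed

lemma trace_radial:
  fixes x :: "'a::euclidean_space"
  shows "(\<Sum>b\<in>Basis. (c *\<^sub>R b + (d * (x \<bullet> b)) *\<^sub>R x) \<bullet> b) = real DIM('a) * c + d * (x \<bullet> x)"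
proof -
  have "(\<Sum>b\<in>Basis. (c *\<^sub>R b + (d * (x \<bullet> b)) *\<^sub>R x) \<bullet> b) = (\<Sum>b::'a\<in>Basis. c + d * ((x \<bullet> b) * (x \<bullet> b)))"
    by (intro sum.cong) (auto simp: inner_add_left)
  also have "\<dots> = real DIM('a) * c + d * (x \<bullet> x)"
    by (simp add: sum.distrib sum_distrib_left[symmetric] euclidean_inner[of x x])
  finally show ?thesis .
qed

lemma dirichlet_ball_solutionE:
  fixes \<Psi> :: "'a::euclidean_space \<Rightarrow> real"
  assumes "dirichlet_ball_solution f R \<Psi>"
  obtains D D2 where "continuous_on (cball 0 R) \<Psi>" "\<And>x. x \<in> sphere 0 R \<Longrightarrow> \<Psi> x = 0"
    "\<And>x. x \<in> ball 0 R \<Longrightarrow> 0 < \<Psi> x" "\<And>x. x \<in> ball 0 R \<Longrightarrow> \<Psi> x < 1"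
    "\<And>x. x \<in> ball 0 R \<Longrightarrow> (\<Psi> has_derivative blinfun_apply (D x)) (at x)"
    "\<And>x. x \<in> ball 0 R \<Longrightarrow> (D has_derivative blinfun_apply (D2 x)) (at x)"
    "\<And>x. x \<in> ball 0 R \<Longrightarrow> laplace_of (D2 x) + f (\<Psi> x) = 0"
  using assms unfolding dirichlet_ball_solution_def by blast

lemma blinfun_directional_derivative:
  fixes D :: "'a::real_normed_vector \<Rightarrow> 'a \<Rightarrow>\<^sub>L real"
  assumes "(D has_derivative blinfun_apply H) (at x)"
  shows "((\<lambda>s. D (x + s *\<^sub>R b) b) has_real_derivative H b b) (at 0)"
proof -
  have "((\<lambda>s. x + s *\<^sub>R b) has_derivative (\<lambda>h. h *\<^sub>R b)) (at (0::real))"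
    by (auto intro!: derivative_eq_intros)
  from has_derivative_compose[OF this, of D "blinfun_apply H"] assms
  have "((\<lambda>s. D (x + s *\<^sub>R b)) has_derivative (\<lambda>h. H (h *\<^sub>R b))) (at (0::real))" by simp
  from bounded_bilinear.FDERIV[OF bounded_bilinear_blinfun_apply this has_derivative_const[of b]]
  have "((\<lambda>s. D (x + s *\<^sub>R b) b) has_derivative (\<lambda>h. h * H b b)) (at 0)"
    by (simp add: blinfun.scaleR_right blinfun.scaleR_left)
  moreover have "(\<lambda>h. h * H b b) = (*) (H b b)" by (auto simp: fun_eq_iff)
  ultimately show ?thesis by (simp add: has_field_derivative_def)
qed

lemma gradient_directional_derivative:
  fixes G :: "'a::real_inner \<Rightarrow> 'a"
  assumes "(G has_derivative A) (at x)"
  shows "((\<lambda>s. G (x + s *\<^sub>R b) \<bullet> b) has_real_derivative A b \<bullet> b) (at 0)"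
proof -
  have "((\<lambda>s. x + s *\<^sub>R b) has_derivative (\<lambda>h. h *\<^sub>R b)) (at (0::real))"
    by (auto intro!: derivative_eq_intros)
  from has_derivative_compose[OF this, of G A] assms
  have "((\<lambda>s. G (x + s *\<^sub>R b)) has_derivative (\<lambda>h. A (h *\<^sub>R b))) (at (0::real))" by simp
  then have "((\<lambda>s. G (x + s *\<^sub>R b) \<bullet> b) has_derivative (\<lambda>h. A (h *\<^sub>R b) \<bullet> b)) (at (0::real))"
    by (rule has_derivative_inner_left)
  moreover have "(\<lambda>h. A (h *\<^sub>R b) \<bullet> b) = (*) (A b \<bullet> b)"
    using linear_cmul[OF has_derivative_linear[OF assms]] by (auto simp: fun_eq_iff)
  ultimately show ?thesis by (simp add: has_field_derivative_def)
qed

context radial_family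
begin

text \<open>The trace is \<open>n * k + 2 * \<tau> * k'\<close>, which \<open>k_deriv\<close>
  collapses to minus the reaction. At the centre the second summand is absent and
  \<open>k_zero\<close> takes over.\<close>

lemma radial_laplacian:
  assumes "n = DIM('a::euclidean_space)"
  obtains A where "((\<lambda>x. k a \<mu> (x \<bullet> x / 2) *\<^sub>R x) has_derivative A) (at (x::'a))"
    "(\<Sum>b\<in>Basis. A b \<bullet> b) = - (g (w a \<mu> (x \<bullet> x / 2)) + \<mu>)"
proof (cases "x = 0")
  case True
  have "isCont (k a \<mu>) 0" using k_cont1[of UNIV] by (auto simp: continuous_on_eq_continuous_at)
  from radial_gradient_has_derivative_zero[OF this] True show thesis
  proof (intro that[of "\<lambda>v. k a \<mu> 0 *\<^sub>R v"])
    have "n * k a \<mu> 0 = - (g a + \<mu>)" using n by (simp add: k_zero)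
    then show "(\<Sum>b::'a\<in>Basis. (k a \<mu> 0 *\<^sub>R b) \<bullet> b) = - (g (w a \<mu> (x \<bullet> x / 2)) + \<mu>)"
      using trace_radial[where x = x and c = "k a \<mu> 0" and d = 0] True by (simp add: assms[symmetric])
  qed auto
next
  case False
  then have "x \<bullet> x / 2 > 0" by simp
  from radial_gradient_has_derivative[OF k_deriv[OF this]] show thesis
  proof (rule that)
    let ?\<tau> = "x \<bullet> x / 2"
    show "(\<Sum>b\<in>Basis. (k a \<mu> ?\<tau> *\<^sub>R b + (- (g (w a \<mu> ?\<tau>) + \<mu> + n * k a \<mu> ?\<tau>) / (2 * ?\<tau>) * (x \<bullet> b)) *\<^sub>R x) \<bullet> b)
       = - (g (w a \<mu> ?\<tau>) + \<mu>)"
      unfolding trace_radial using False assms by (simp add: field_simps)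
  qed
qed

lemma radial_dirichlet_solution:
  assumes nD: "n = DIM('a::euclidean_space)" and fg: "\<And>s. 0 < s \<Longrightarrow> s < 1 \<Longrightarrow> f s = g s"
    and a: "a < 1" and T: "T > 0" and z: "w a 0 T = 0" and p: "\<And>\<tau>. 0 \<le> \<tau> \<Longrightarrow> \<tau> < T \<Longrightarrow> w a 0 \<tau> > 0"
  shows "dirichlet_ball_solution f (sqrt (2 * T)) (\<lambda>x::'a. w a 0 (x \<bullet> x / 2))"
proof -
  let ?\<Psi> = "\<lambda>x::'a. w a 0 (x \<bullet> x / 2)"
  let ?Z = "\<lambda>x::'a. k a 0 (x \<bullet> x / 2) *\<^sub>R x"
  have ball: "0 \<le> x \<bullet> x / 2" "x \<bullet> x / 2 < T" if "x \<in> ball 0 (sqrt (2 * T))" for x :: 'a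
  proof -
    have "norm x < sqrt (2 * T)" using that by simp
    then have "(norm x)\<^sup>2 < (sqrt (2 * T))\<^sup>2" by (intro power_strict_mono) auto
    then show "0 \<le> x \<bullet> x / 2" "x \<bullet> x / 2 < T" using T by (auto simp: power2_norm_eq_inner)
  qed
  have lt1: "w a 0 \<tau> < 1" if "0 \<le> \<tau>" "\<tau> < T" for \<tau>
  proof -
    have "w a 0 \<tau> \<le> w a 0 0"
      using slope_neg_up_to_zero[OF a T z p] that by (intro decreasing_le) (auto simp: less_imp_le)
    then show ?thesis using a by simp
  qed
  have "\<exists>H. (?Z has_derivative H) (at x) \<and> (\<Sum>b\<in>Basis. H b \<bullet> b) = - g (?\<Psi> x)" for x
  proof (rule radial_laplacian[OF nD])
    fix A assume "(?Z has_derivative A) (at x)" "(\<Sum>b\<in>Basis. A b \<bullet> b) = - (g (?\<Psi> x) + 0)"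
    then show ?thesis by (intro exI[of _ A]) simp
  qed
  then have "\<forall>x. \<exists>H. (?Z has_derivative H) (at x) \<and> (\<Sum>b\<in>Basis. H b \<bullet> b) = - g (?\<Psi> x)" by blast
  from choice[OF this] obtain H where H: "\<And>x. (?Z has_derivative H x) (at x)"
    and tr: "\<And>x. (\<Sum>b\<in>Basis. H x b \<bullet> b) = - g (?\<Psi> x)" by blast
  define D where "D x = blinfun_inner_left (?Z x)" for x
  define D2 where "D2 x = Blinfun (\<lambda>v. blinfun_inner_left (H x v))" for x
  have DD: "(D has_derivative (\<lambda>v. blinfun_inner_left (H x v))) (at x)" for x
    unfolding D_def by (rule bounded_linear.has_derivative[OF bounded_linear_blinfun_inner_left H])
  have D2: "blinfun_apply (D2 x) = (\<lambda>v. blinfun_inner_left (H x v))" for x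
    unfolding D2_def by (rule bounded_linear_Blinfun_apply[OF has_derivative_bounded_linear[OF DD]])
  show ?thesis unfolding dirichlet_ball_solution_def
  proof (intro conjI exI[of _ D] exI[of _ D2] ballI)
    show "continuous_on (cball 0 (sqrt (2 * T))) ?\<Psi>"
      by (intro continuous_intros continuous_on_compose2[OF w_cont1[of UNIV]]) auto
    fix x :: 'a
    show "(?\<Psi> has_derivative blinfun_apply (D x)) (at x)"
      using radial_has_derivative[OF w_deriv, of a 0 x] by (simp add: D_def inner_commute blinfun_inner_left.rep_eq)
    show "(D has_derivative blinfun_apply (D2 x)) (at x)" using DD by (simp add: D2)
    show "?\<Psi> x = 0" if "x \<in> sphere 0 (sqrt (2 * T))"
    proof -
      have "norm x = sqrt (2 * T)" using that by simp
      then have "x \<bullet> x = 2 * T" using T by (simp add: norm_eq_sqrt_inner)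
      then show ?thesis by (simp add: z)
    qed
    assume x: "x \<in> ball 0 (sqrt (2 * T))"
    show "0 < ?\<Psi> x" "?\<Psi> x < 1" using ball[OF x] p lt1 by auto
    then show "laplace_of (D2 x) + f (?\<Psi> x) = 0"
      using tr[of x] fg by (simp add: laplace_of_def D2 inner_commute)
  qed
qed

text \<open>At an interior contact point the difference has a minimum, so its Laplacian is
  nonnegative; but the two equations make it equal to \<open>- \<eta>\<close>.\<close>

lemma strict_touching:
  fixes \<Psi> :: "'a::euclidean_space \<Rightarrow> real"
  assumes nD: "n = DIM('a)" and fg: "\<And>s. 0 < s \<Longrightarrow> s < 1 \<Longrightarrow> f s = g s"
    and \<Psi>: "dirichlet_ball_solution f R \<Psi>" and \<eta>: "\<eta> > 0"
    and le: "\<And>x. x \<in> ball 0 R \<Longrightarrow> \<Psi> x \<le> w a \<eta> (x \<bullet> x / 2)" and x: "x \<in> ball 0 R"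
  shows "\<Psi> x < w a \<eta> (x \<bullet> x / 2)"
proof (rule ccontr)
  assume "\<not> ?thesis"
  then have eq: "\<Psi> x = w a \<eta> (x \<bullet> x / 2)" using le[OF x] by simp
  obtain D D2 where \<Psi>01: "0 < \<Psi> x" "\<Psi> x < 1"
    and D: "\<And>y. y \<in> ball 0 R \<Longrightarrow> (\<Psi> has_derivative blinfun_apply (D y)) (at y)"
    and D2: "(D has_derivative blinfun_apply (D2 x)) (at x)"
    and lap: "laplace_of (D2 x) + f (\<Psi> x) = 0"
    using \<Psi> x by (elim dirichlet_ball_solutionE) blast
  obtain A where A: "((\<lambda>x. k a \<eta> (x \<bullet> x / 2) *\<^sub>R x) has_derivative A) (at x)"
    "(\<Sum>b\<in>Basis. A b \<bullet> b) = - (g (w a \<eta> (x \<bullet> x / 2)) + \<eta>)"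
    using radial_laplacian[OF nD] by blast
  let ?p' = "\<lambda>y v. (k a \<eta> (y \<bullet> y / 2) *\<^sub>R y) \<bullet> v - D y v"
  have ball: "eventually (\<lambda>y. y \<in> ball 0 R) (nhds x)" using x by (intro eventually_nhds_in_open) auto
  have "0 \<le> A b \<bullet> b - D2 x b b" for b
  proof (rule second_order_min(2)[where p = "\<lambda>y. w a \<eta> (y \<bullet> y / 2) - \<Psi> y" and p' = ?p' and x = x])
    show "eventually (\<lambda>y. ((\<lambda>y. w a \<eta> (y \<bullet> y / 2) - \<Psi> y) has_derivative ?p' y) (at y)) (nhds x)"
      using ball by eventually_elim (intro has_derivative_diff radial_has_derivative w_deriv D)
    show "eventually (\<lambda>y. w a \<eta> (x \<bullet> x / 2) - \<Psi> x \<le> w a \<eta> (y \<bullet> y / 2) - \<Psi> y) (nhds x)"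
      using ball by eventually_elim (use le eq in auto)
    show "((\<lambda>s. ?p' (x + s *\<^sub>R b) b) has_real_derivative A b \<bullet> b - D2 x b b) (at 0)"
      by (intro DERIV_diff gradient_directional_derivative blinfun_directional_derivative A D2)
  qed
  then have "0 \<le> (\<Sum>b\<in>Basis. A b \<bullet> b - D2 x b b)" by (intro sum_nonneg) auto
  also have "\<dots> = - (g (\<Psi> x) + \<eta>) + f (\<Psi> x)"
    using lap by (simp add: sum_subtractf A(2) eq laplace_of_def)
  also have "\<dots> = - \<eta>" using fg[OF \<Psi>01] by simp
  finally show False using \<eta> by simp
qed

text \<open>Adding \<open>\<eta> > 0\<close> to the reaction makes the radial profile a strict supersolution. When its central
  value decreases from 1, it can first meet the given solution only on the sphere, and it vanishes there.\<close>
lemma radial_from_dirichlet_solution: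
  fixes \<Psi> :: "'a::euclidean_space \<Rightarrow> real"
  assumes nD: "n = DIM('a)" and fg: "\<And>s. 0 < s \<Longrightarrow> s < 1 \<Longrightarrow> f s = g s"
    and \<Psi>: "dirichlet_ball_solution f R \<Psi>" and R: "R > 0"
  obtains a where "0 < a" "a < 1" "w a 0 (R\<^sup>2 / 2) = 0" "\<And>\<tau>. 0 \<le> \<tau> \<Longrightarrow> \<tau> < R\<^sup>2 / 2 \<Longrightarrow> w a 0 \<tau> > 0"
proof -
  define T where "T = R\<^sup>2 / 2"
  have T: "T > 0" using R by (simp add: T_def)
  obtain D D2 where c: "continuous_on (cball 0 R) \<Psi>" and s0: "\<And>x. x \<in> sphere 0 R \<Longrightarrow> \<Psi> x = 0"
    and p: "\<And>x. x \<in> ball 0 R \<Longrightarrow> 0 < \<Psi> x" and l1: "\<And>x. x \<in> ball 0 R \<Longrightarrow> \<Psi> x < 1"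
    using \<Psi> by (elim dirichlet_ball_solutionE) blast
  have cb: "0 \<le> x \<bullet> x / 2" "x \<bullet> x / 2 \<le> T" if "x \<in> cball 0 R" for x :: 'a
    using that power_mono[of "norm x" R 2] by (auto simp: power2_norm_eq_inner T_def)
  obtain y where y: "y \<in> cball 0 R" "\<And>x. x \<in> cball 0 R \<Longrightarrow> \<Psi> x \<le> \<Psi> y"
    using continuous_attains_sup[OF compact_cball _ c] R by auto
  define m where "m = \<Psi> y"
  have m: "m < 1" using y(1) s0[of y] l1[of y] by (cases "norm y = R") (auto simp: m_def)
  \<comment> \<open>By \<open>w_lip\<close> a shift up to \<open>\<eta>0\<close> moves the constant
    profile 1 by at most \<open>(1 - m) / 2\<close> on the ball, so it stays above the maximum
    \<open>m\<close> of \<open>\<Psi>\<close>.\<close>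
  define \<eta>0 where "\<eta>0 = (1 - m) * L / (2 * exp (2 * L * T))"
  have \<eta>0: "\<eta>0 > 0" using m L by (simp add: \<eta>0_def)
  have above: "\<Psi> x < w 1 \<eta> (x \<bullet> x / 2)" if "0 < \<eta>" "\<eta> \<le> \<eta>0" "x \<in> cball 0 R" for \<eta> x
  proof -
    let ?\<tau> = "x \<bullet> x / 2"
    have "\<bar>w 1 \<eta> ?\<tau> - 1\<bar> \<le> exp (2 * L * ?\<tau>) * (\<eta> / L)"
      using w_lip[of 1 \<eta> ?\<tau> 1 0] w_const[of 1 0 ?\<tau>] g1[of 1] that cb[OF that(3)] by simp
    also have "\<dots> \<le> exp (2 * L * T) * (\<eta>0 / L)"
      using that cb[OF that(3)] L by (intro mult_mono divide_right_mono) auto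
    also have "\<dots> = (1 - m) / 2" using L by (simp add: \<eta>0_def)
    finally show ?thesis using y(2)[OF that(3)] m using abs_ge_minus_self[of "w 1 \<eta> ?\<tau> - 1"] by (simp add: m_def field_simps)
  qed
  have "\<exists>a\<in>{0..1}. w a \<eta> T = 0 \<and> (\<forall>x\<in>cball 0 R. \<Psi> x \<le> w a \<eta> (x \<bullet> x / 2))" if \<eta>: "0 < \<eta>" "\<eta> \<le> \<eta>0" for \<eta>
  proof -
    let ?h = "\<lambda>q::real \<times> 'a. w (fst q) \<eta> (snd q \<bullet> snd q / 2) - \<Psi> (snd q)"
    have hc: "continuous_on ({0..1} \<times> cball 0 R) ?h"
      by (intro continuous_intros continuous_on_compose2[OF c]
          continuous_on_compose2[OF w_cont, of _ "\<lambda>q. ((fst q, \<eta>), snd q \<bullet> snd q / 2)", simplified]) auto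
    \<comment> \<open>Pairs of a central value and a point where the profile is not above
      \<open>\<Psi>\<close>. The largest central value among them is the first contact from above;
      the pair \<open>(0, 0)\<close> makes the set nonempty.\<close>
    let ?C = "({0..1} \<times> cball 0 R) \<inter> ?h -` {..0}"
    have cp: "compact ({0..1::real} \<times> cball (0::'a) R)" by (intro compact_Times compact_Icc compact_cball)
    have "closed ?C" using cp by (intro continuous_closed_preimage[OF hc] closed_atMost) (rule compact_imp_closed)
    from compact_Int_closed[OF cp this] have "compact ?C" by (simp only: inf.left_idem)
    moreover have "(0, 0) \<in> ?C" using R p[of 0] by (simp add: less_imp_le)
    then have "?C \<noteq> {}" by blast
    ultimately have "\<exists>q\<in>?C. \<forall>r\<in>?C. fst r \<le> fst q"
      by (rule continuous_attains_sup[OF _ _ continuous_on_fst[OF continuous_on_id]])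
    then obtain q where q: "q \<in> ?C" "\<And>r. r \<in> ?C \<Longrightarrow> fst r \<le> fst q" by blast
    obtain a x where qa: "q = (a, x)" by (cases q)
    have a01: "0 \<le> a" "a \<le> 1" and x: "x \<in> cball 0 R" and le: "w a \<eta> (x \<bullet> x / 2) \<le> \<Psi> x" using q(1) qa by auto
    have "a \<noteq> 1" using above[OF \<eta> x] le by auto
    then have a1: "a < 1" using a01 by simp
    have gt: "\<Psi> z < w b \<eta> (z \<bullet> z / 2)" if "a < b" "b \<le> 1" "z \<in> cball 0 R" for b z
      using q(2)[of "(b, z)"] that a01 qa by (auto simp: not_le[symmetric])
    \<comment> \<open>Letting \<open>b\<close> decrease to \<open>a\<close> keeps the weak
      inequality at the contact value.\<close>
    have ge: "\<Psi> z \<le> w a \<eta> (z \<bullet> z / 2)" if z: "z \<in> cball 0 R" for z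
    proof (rule tendsto_lowerbound[where F = "at_right a"])
      have "continuous_on UNIV (\<lambda>b. w b \<eta> (z \<bullet> z / 2))"
        by (intro continuous_on_compose2[OF w_cont, of _ "\<lambda>b. ((b, \<eta>), z \<bullet> z / 2)", simplified] continuous_intros) auto
      then have "isCont (\<lambda>b. w b \<eta> (z \<bullet> z / 2)) a" by (auto simp: continuous_on_eq_continuous_at)
      then show "((\<lambda>b. w b \<eta> (z \<bullet> z / 2)) \<longlongrightarrow> w a \<eta> (z \<bullet> z / 2)) (at_right a)"
        by (auto simp: isCont_def intro: filterlim_mono[OF _ order_refl at_le])
      have "eventually (\<lambda>b. b \<in> {a<..<1}) (at_right a)" by (rule eventually_at_right_real[OF a1])
      then show "eventually (\<lambda>b. \<Psi> z \<le> w b \<eta> (z \<bullet> z / 2)) (at_right a)"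
        by eventually_elim (use gt[OF _ _ z] in \<open>auto simp: less_imp_le\<close>)
    qed simp
    \<comment> \<open>Contact in the open ball is excluded, so it occurs on the sphere, where
      \<open>\<Psi>\<close> is 0.\<close>
    have "x \<notin> ball 0 R"
      using strict_touching[OF nD fg \<Psi> \<eta>(1), of a x] ge le by (force simp: less_imp_le)
    then have nx: "norm x = R" using x by auto
    then have "x \<bullet> x / 2 = T" by (simp add: T_def power2_norm_eq_inner[symmetric])
    then have "w a \<eta> T = 0" using s0[of x] nx le ge[OF x] by auto
    then show ?thesis using ge a01 by auto
  qed
  moreover have "0 < \<eta>0 / Suc j" "\<eta>0 / Suc j \<le> \<eta>0" for j using \<eta>0 by (auto simp: field_simps)
  ultimately have "\<forall>j. \<exists>a\<in>{0..1}. w a (\<eta>0 / Suc j) T = 0 \<and> (\<forall>x\<in>cball 0 R. \<Psi> x \<le> w a (\<eta>0 / Suc j) (x \<bullet> x / 2))"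
    by blast
  then obtain A where A: "\<And>j. A j \<in> {0..1}" "\<And>j. w (A j) (\<eta>0 / Suc j) T = 0"
    "\<And>j x. x \<in> cball 0 R \<Longrightarrow> \<Psi> x \<le> w (A j) (\<eta>0 / Suc j) (x \<bullet> x / 2)" by metis
  \<comment> \<open>The shift tends to 0 and the central values have a convergent subsequence. The
    zero at \<open>T\<close> and the lower bound \<open>\<Psi>\<close> pass to the limit; the latter
    gives positivity inside the ball.\<close>
  obtain a r where a: "a \<in> {0..1}" and r: "strict_mono r" and lim: "(A \<circ> r) \<longlonglongrightarrow> a"
    using compact_Icc[of 0 "1::real"] A(1) unfolding compact_def by metis
  have "(\<lambda>j. \<eta>0 / Suc j) \<longlonglongrightarrow> 0" by (rule lim_const_over_n[THEN LIMSEQ_Suc])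
  then have lim': "(\<lambda>j. \<eta>0 / Suc (r j)) \<longlonglongrightarrow> 0" using LIMSEQ_subseq_LIMSEQ[OF _ r] by (force simp: o_def)
  have wl: "(\<lambda>j. w (A (r j)) (\<eta>0 / Suc (r j)) \<tau>) \<longlonglongrightarrow> w a 0 \<tau>" for \<tau>
  proof -
    have "(\<lambda>j. ((A (r j), \<eta>0 / Suc (r j)), \<tau>)) \<longlonglongrightarrow> ((a, 0), \<tau>)"
      using lim lim' by (intro tendsto_intros) (auto simp: o_def)
    moreover have "isCont (\<lambda>(p, \<tau>). w (fst p) (snd p) \<tau>) ((a, 0), \<tau>)"
      using w_cont by (auto simp: continuous_on_eq_continuous_at)
    ultimately show ?thesis using isCont_tendsto_compose by fastforce
  qed
  have z: "w a 0 T = 0"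
    using wl[of T] unfolding A(2) by (simp only: LIMSEQ_const_iff)
  have ge: "\<Psi> x \<le> w a 0 (x \<bullet> x / 2)" if "x \<in> cball 0 R" for x
    by (rule LIMSEQ_le_const[OF wl]) (use A(3)[OF that] in auto)
  have pos: "w a 0 \<tau> > 0" if \<tau>: "0 \<le> \<tau>" "\<tau> < T" for \<tau>
  proof -
    obtain b :: 'a where b: "b \<in> Basis" by (meson ex_in_conv nonempty_Basis)
    let ?x = "sqrt (2 * \<tau>) *\<^sub>R b"
    have xx: "?x \<bullet> ?x / 2 = \<tau>" using b \<tau> by (simp add: inner_Basis)
    have "norm ?x = sqrt (2 * \<tau>)" using b \<tau> by simp
    also have "\<dots> < R" using \<tau> R by (intro real_less_lsqrt) (auto simp: T_def)
    finally have "?x \<in> ball 0 R" by simp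
    then show ?thesis using p[of ?x] ge[of ?x] xx by auto
  qed
  have "0 < a" using pos[of 0] T by simp
  \<comment> \<open>The profile with central value 1 is constant and has no zero.\<close>
  moreover have "a \<noteq> 1" using z w_const[of 1 0 T] g1[of 1] by auto
  ultimately have "0 < a" "a < 1" using a by auto
  then show thesis by (rule that[OF _ _ z[unfolded T_def] pos[unfolded T_def]])
qed

end

section \<open>The critical radius\<close>

context radial_family
begin

text \<open>The slope is bounded by \<open>L\<close>, and the profile has to fall from above
  \<open>\<alpha>\<close> to 0. This keeps the critical radius away from 0.\<close>

lemma zero_lower_bound:
  assumes a: "a < 1" and T: "T > 0" and z: "w a 0 T = 0" and p: "\<And>\<tau>. 0 \<le> \<tau> \<Longrightarrow> \<tau> < T \<Longrightarrow> w a 0 \<tau> > 0"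
  shows "\<alpha> \<le> L * T"
proof -
  have a0: "a > 0" using p[of 0] T by simp
  have "k a 0 0 < 0" using slope_neg_up_to_zero[OF a T z p] T by simp
  then have "g a > 0" using n by (simp add: k_zero zero_less_divide_iff)
  then have "\<alpha> < a" using g_neg[of a] \<alpha>(3) a0 by (cases a \<alpha> rule: linorder_cases) auto
  have g_le: "\<bar>g s\<bar> \<le> L" for s
  proof (cases "0 \<le> s \<and> s \<le> 1")
    case True
    have "\<bar>g s\<bar> \<le> L * \<bar>s\<bar>" using lip[of s 0] g0[of 0] by simp
    also have "\<dots> \<le> L * 1" using True L by (intro mult_left_mono) auto
    finally show ?thesis by simp
  next
    case False
    then show ?thesis using g0[of s] g1[of s] L by auto
  qed
  have k_le: "\<bar>k a 0 \<tau>\<bar> \<le> L" for \<tau>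
  proof -
    have "\<bar>slope g n 0 (w a 0) \<tau> - slope g n 0 (\<lambda>_. 0) \<tau>\<bar> \<le> L"
      by (rule slope_diff_le[OF g_cont w_cont1]) (use g_le g0[of 0] in auto)
    moreover have "slope g n 0 (\<lambda>_. 0) \<tau> = 0" using g0[of 0] by (simp add: slope_def)
    ultimately show ?thesis by simp
  qed
  have "w a 0 0 + L * 0 \<le> w a 0 T + L * T"
  proof (rule DERIV_nonneg_imp_nondecreasing[where f = "\<lambda>\<tau>. w a 0 \<tau> + L * \<tau>"])
    fix \<tau>
    have "((\<lambda>\<tau>. w a 0 \<tau> + L * \<tau>) has_real_derivative k a 0 \<tau> + L) (at \<tau>)"
      using DERIV_add[OF w_deriv[of a 0 \<tau>] DERIV_cmult[OF DERIV_ident, of L]] by simp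
    moreover have "0 \<le> k a 0 \<tau> + L" using k_le[of \<tau>] by linarith
    ultimately show "\<exists>y. ((\<lambda>\<tau>. w a 0 \<tau> + L * \<tau>) has_real_derivative y) (at \<tau>) \<and> 0 \<le> y" by blast
  qed (use T in simp)
  then show ?thesis using z \<open>\<alpha> < a\<close> by simp
qed

text \<open>For the second claim, a radius in \<open>S\<close> just above the infimum carries a
  radial profile, and the shift of the reaction uses up the remaining gap to
  \<open>Inf S + \<delta>\<close>.\<close>

lemma critical_radius:
  fixes f :: "real \<Rightarrow> real"
  defines "S \<equiv> {R. 0 < R \<and> (\<exists>\<Psi> :: 'a::euclidean_space \<Rightarrow> real. dirichlet_ball_solution f R \<Psi>)}"
  assumes nD: "n = DIM('a)" and fg: "\<forall>s\<in>{0..1}. f s = g s"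
  shows "0 < Inf S"
    and "0 < \<delta> \<Longrightarrow> \<exists>a \<eta> T. 0 < \<eta> \<and> 0 < T \<and> sqrt (2 * T) < Inf S + \<delta> \<and> a < 1 \<and> \<alpha> < a \<and> w a (- \<eta>) T = 0 \<and>
      (\<forall>\<tau>. 0 \<le> \<tau> \<longrightarrow> \<tau> < T \<longrightarrow> w a (- \<eta>) \<tau> > 0) \<and> (\<forall>\<tau>. 0 \<le> \<tau> \<longrightarrow> \<tau> \<le> T \<longrightarrow> k a (- \<eta>) \<tau> < 0)"
proof -
  have fg': "f s = g s" if "0 < s" "s < 1" for s using fg that by simp
  have ne: "S \<noteq> {}"
  proof -
    obtain a T where "0 < a" "a < 1" "0 < T" "w a 0 T = 0" "\<And>\<tau>. 0 \<le> \<tau> \<Longrightarrow> \<tau> < T \<Longrightarrow> w a 0 \<tau> > 0"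
      using ex_zero by blast
    then have "dirichlet_ball_solution f (sqrt (2 * T)) (\<lambda>x::'a. w a 0 (x \<bullet> x / 2))"
      by (intro radial_dirichlet_solution[OF nD fg'])
    then have "sqrt (2 * T) \<in> S" using \<open>0 < T\<close> by (auto simp: S_def)
    then show ?thesis by blast
  qed
  have rad: "\<exists>a. 0 < a \<and> a < 1 \<and> w a 0 (R\<^sup>2 / 2) = 0 \<and> (\<forall>\<tau>. 0 \<le> \<tau> \<longrightarrow> \<tau> < R\<^sup>2 / 2 \<longrightarrow> w a 0 \<tau> > 0)" if "R \<in> S" for R
  proof -
    obtain \<Psi> :: "'a \<Rightarrow> real" where \<Psi>: "dirichlet_ball_solution f R \<Psi>" and R: "R > 0" using \<open>R \<in> S\<close> by (auto simp: S_def)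
    show ?thesis
    proof (rule radial_from_dirichlet_solution[OF nD _ \<Psi> R])
      fix a assume "0 < a" "a < 1" "w a 0 (R\<^sup>2 / 2) = 0" "\<And>\<tau>. 0 \<le> \<tau> \<Longrightarrow> \<tau> < R\<^sup>2 / 2 \<Longrightarrow> w a 0 \<tau> > 0"
      then show ?thesis by blast
    qed (rule fg')
  qed
  define c where "c = sqrt (2 * \<alpha> / L)"
  have c: "c > 0" using \<alpha> L by (simp add: c_def)
  have "c \<le> R" if "R \<in> S" for R
  proof -
    have R: "R > 0" using that by (simp add: S_def)
    have "\<alpha> \<le> L * (R\<^sup>2 / 2)" using rad[OF that] zero_lower_bound[of _ "R\<^sup>2 / 2"] R by auto
    then have "2 * \<alpha> / L \<le> R\<^sup>2" using L by (simp add: field_simps)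
    then show ?thesis unfolding c_def using R by (intro real_le_lsqrt) auto
  qed
  then have "c \<le> Inf S" by (intro cInf_greatest ne)
  with c show "0 < Inf S" by linarith
  assume \<delta>: "0 < \<delta>"
  obtain R where R: "R \<in> S" "R < Inf S + \<delta>" using cInf_lessD[OF ne, of "Inf S + \<delta>"] \<delta> by auto
  have R0: "R > 0" using R by (simp add: S_def)
  obtain a where a: "0 < a" "a < 1" "w a 0 (R\<^sup>2 / 2) = 0" "\<And>\<tau>. 0 \<le> \<tau> \<Longrightarrow> \<tau> < R\<^sup>2 / 2 \<Longrightarrow> w a 0 \<tau> > 0"
    using rad[OF R(1)] by blast
  have T: "0 < R\<^sup>2 / 2" using R0 by simp
  have less: "R\<^sup>2 / 2 < (Inf S + \<delta>)\<^sup>2 / 2" using R R0 by (intro divide_strict_right_mono power_strict_mono) auto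
  show "\<exists>a \<eta> T. 0 < \<eta> \<and> 0 < T \<and> sqrt (2 * T) < Inf S + \<delta> \<and> a < 1 \<and> \<alpha> < a \<and> w a (- \<eta>) T = 0 \<and>
      (\<forall>\<tau>. 0 \<le> \<tau> \<longrightarrow> \<tau> < T \<longrightarrow> w a (- \<eta>) \<tau> > 0) \<and> (\<forall>\<tau>. 0 \<le> \<tau> \<longrightarrow> \<tau> \<le> T \<longrightarrow> k a (- \<eta>) \<tau> < 0)"
  proof (rule strict_profile[OF a(2) T a(3,4) less])
    fix \<eta> T'
    assume T': "\<eta> > 0" "0 < T'" "T' < (Inf S + \<delta>)\<^sup>2 / 2" "w a (- \<eta>) T' = 0"
      "\<And>\<tau>. 0 \<le> \<tau> \<Longrightarrow> \<tau> < T' \<Longrightarrow> w a (- \<eta>) \<tau> > 0" "\<And>\<tau>. 0 \<le> \<tau> \<Longrightarrow> \<tau> \<le> T' \<Longrightarrow> k a (- \<eta>) \<tau> < 0" "\<alpha> < a"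
    have "sqrt (2 * T') < Inf S + \<delta>"
      using T' R R0 by (intro real_less_lsqrt) auto
    then show ?thesis using T' a(2) by blast
  qed
qed

end

text \<open>Composing \<open>f\<close> with the projection onto \<open>[0, 1]\<close> makes it
  bounded and globally Lipschitz, as the Picard iteration requires, and changes nothing in the range
  of the solutions.\<close>

lemma bistable_radial_family:
  assumes f: "bistable f f' \<alpha>" and n: "1 \<le> n"
  obtains g L w where "radial_family g L \<alpha> n w" "\<And>s. 0 \<le> s \<Longrightarrow> s \<le> 1 \<Longrightarrow> f s = g s"
proof -
  have fd: "\<And>s. (f has_real_derivative f' s) (at s)" and f'c: "continuous_on UNIV f'"
    and \<alpha>: "0 < \<alpha>" "\<alpha> < 1" and z: "f 0 = 0" "f \<alpha> = 0" "f 1 = 0"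
    and neg: "\<And>s. 0 < s \<Longrightarrow> s < \<alpha> \<Longrightarrow> f s < 0" and pos: "\<And>s. \<alpha> < s \<Longrightarrow> s < 1 \<Longrightarrow> 0 < f s"
    and int: "integral {0..1} f > 0"
    using f unfolding bistable_def by auto
  have "bounded (f' ` {0..1})"
    by (intro compact_imp_bounded compact_continuous_image continuous_on_subset[OF f'c]) auto
  then obtain L where L: "L > 0" and bd: "\<And>s. s \<in> {0..1} \<Longrightarrow> \<bar>f' s\<bar> \<le> L"
    unfolding bounded_pos by (metis imageI real_norm_def)
  have flip: "\<bar>f x - f y\<bar> \<le> L * \<bar>x - y\<bar>" if "x \<in> {0..1}" "y \<in> {0..1}" for x y
    using field_differentiable_bound[of "{0..1}" f f' L x y] that fd bd
    by (auto intro: has_field_derivative_at_within)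
  define c where "c s = max 0 (min 1 s)" for s :: real
  define g where "g s = f (c s)" for s
  have c: "c s \<in> {0..1}" "\<bar>c s - c t\<bar> \<le> \<bar>s - t\<bar>" for s t by (auto simp: c_def max_def min_def)
  have fg: "f s = g s" if "0 \<le> s" "s \<le> 1" for s using that by (simp add: g_def c_def)
  have lip: "\<bar>g x - g y\<bar> \<le> L * \<bar>x - y\<bar>" for x y
  proof -
    have "\<bar>g x - g y\<bar> \<le> L * \<bar>c x - c y\<bar>" unfolding g_def by (intro flip c)
    also have "\<dots> \<le> L * \<bar>x - y\<bar>" using L c(2) by (intro mult_left_mono) auto
    finally show ?thesis .
  qed
  have bdd: "\<bar>g x\<bar> \<le> L" for x
  proof -
    have "\<bar>g x\<bar> \<le> L * \<bar>c x\<bar>" using flip[OF c(1)[of x], of 0] z by (simp add: g_def)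
    also have "\<dots> \<le> L * 1" using c(1)[of x] L by (intro mult_left_mono) auto
    finally show ?thesis by simp
  qed
  show thesis
  proof (rule radial_ode_family[OF L lip bdd, of n])
    fix w
    assume w: "\<And>a \<mu>. w a \<mu> 0 = a"
      "\<And>a \<mu> \<tau>. (w a \<mu> has_real_derivative slope g n \<mu> (w a \<mu>) \<tau>) (at \<tau>)"
      "\<And>a \<mu> a' \<mu>' \<tau>. \<bar>w a \<mu> \<tau> - w a' \<mu>' \<tau>\<bar> \<le> exp (2 * L * \<bar>\<tau>\<bar>) * (2 * \<bar>a - a'\<bar> + \<bar>\<mu> - \<mu>'\<bar> / L)"
      "\<And>c \<mu> \<tau>. g c + \<mu> = 0 \<Longrightarrow> w c \<mu> \<tau> = c"
    have "radial_family g L \<alpha> n w"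
    proof
      show "g \<alpha> = 0" using fg[of \<alpha>] \<alpha> z by simp
      show "g s < 0" if "0 < s" "s < \<alpha>" for s using fg[of s] neg[OF that] that \<alpha> by simp
      show "0 < g s" if "\<alpha> < s" "s < 1" for s using fg[of s] pos[OF that] that \<alpha> by simp
      show "g s = 0" if "s \<le> 0" for s using that z by (simp add: g_def c_def)
      show "g s = 0" if "1 \<le> s" for s using that z by (simp add: g_def c_def)
      have "integral {0..1} g = integral {0..1} f" by (rule integral_cong) (use fg in auto)
      then show "0 < integral {0..1} g" using int by simp
    qed (use n L lip \<alpha> w in auto)
    from that[OF this fg] show thesis .
  qed
qed

section \<open>Parabolic comparison\<close>

lemma continuous_on_slice:
  assumes "continuous_on (S \<times> D) (\<lambda>(t, x). h t x)" "t \<in> S"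
  shows "continuous_on D (h t)"
proof -
  have "continuous_on D (\<lambda>x. (t, x))" by (intro continuous_intros)
  from continuous_on_compose2[OF assms(1) this] assms(2) show ?thesis by (simp add: image_subset_iff)
qed

lemma neumann_solution_nonneg:
  assumes u: "neumann_solution f (- K) u" and ub: "\<And>t x. x \<in> - K \<Longrightarrow> 0 < u t x"
    and x: "x \<in> closure (- K)"
  shows "0 \<le> u t x"
proof -
  have "continuous_on (closure (- K)) (u t)"
    by (rule continuous_on_slice[where S = UNIV and h = u]) (use u in \<open>simp_all add: neumann_solution_def\<close>)
  from continuous_ge_on_closure[OF this x] show ?thesis using ub less_imp_le by blast
qed

text \<open>A frontier point has \<open>g p \<ge> 0\<close>, since otherwise a whole neighbourhood
  would lie in \<open>K\<close>; and \<open>g\<close> increases along \<open>G\<close>. So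
  \<open>G\<close> points from the wall into the domain.\<close>

lemma inward_direction:
  fixes K :: "'a::euclidean_space set"
  assumes lf: "local_defining_fun K p r g G" and p: "p \<in> frontier K"
  obtains d where "d > 0" "\<And>s. 0 < s \<Longrightarrow> s < d \<Longrightarrow> p + s *\<^sub>R G p \<notin> K"
proof -
  have r: "r > 0" and g: "(g has_derivative (\<lambda>h. G p \<bullet> h)) (at p)" and G: "G p \<noteq> 0"
    and K: "\<And>x. x \<in> ball p r \<Longrightarrow> x \<in> K \<longleftrightarrow> g x \<le> 0"
    using lf unfolding local_defining_fun_def by auto
  have "0 \<le> g p"
  proof (rule ccontr)
    assume "\<not> 0 \<le> g p"
    then have neg: "g p < 0" by simp
    have "isCont g p" using g by (rule has_derivative_continuous)
    then have "eventually (\<lambda>x. g x < 0) (nhds p)"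
      using neg by (auto simp: isCont_def tendsto_at_iff_tendsto_nhds intro: order_tendstoD)
    moreover have "eventually (\<lambda>x. x \<in> ball p r) (nhds p)" using r by (intro eventually_nhds_in_open) auto
    ultimately have "eventually (\<lambda>x. x \<in> K) (nhds p)" by eventually_elim (use K in auto)
    then have "p \<in> interior K" unfolding eventually_nhds interior_def by auto
    then show False using p by (auto simp: frontier_def)
  qed
  have "((\<lambda>s. p + s *\<^sub>R G p) has_derivative (\<lambda>h. h *\<^sub>R G p)) (at (0::real))"
    by (auto intro!: derivative_eq_intros)
  from has_derivative_compose[OF this, of g "\<lambda>h. G p \<bullet> h"] g
  have "((\<lambda>s. g (p + s *\<^sub>R G p)) has_derivative (\<lambda>s. s * (G p \<bullet> G p))) (at 0)" by simp
  moreover have "(\<lambda>s. s * (G p \<bullet> G p)) = (*) (G p \<bullet> G p)" by (auto simp: fun_eq_iff)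
  ultimately have "((\<lambda>s. g (p + s *\<^sub>R G p)) has_real_derivative G p \<bullet> G p) (at 0)"
    by (simp add: has_field_derivative_def)
  from DERIV_pos_inc_right[OF this] G obtain e where e: "e > 0"
    "\<And>s. 0 < s \<Longrightarrow> s < e \<Longrightarrow> g p < g (p + s *\<^sub>R G p)" by auto
  show thesis
  proof (rule that[of "min e (r / norm (G p))"])
    show "0 < min e (r / norm (G p))" using e r G by simp
    fix s assume s: "0 < s" "s < min e (r / norm (G p))"
    then have "s * norm (G p) < r" using G by (simp add: field_simps)
    then have "p + s *\<^sub>R G p \<in> ball p r" using s by (simp add: dist_norm)
    moreover have "0 < g (p + s *\<^sub>R G p)" using e(2)[of s] s \<open>0 \<le> g p\<close> by auto
    ultimately show "p + s *\<^sub>R G p \<notin> K" using K by auto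
  qed
qed

text \<open>A maximum principle on a compact cylinder in space-time. The conditions on
  \<open>h\<close> are imposed only where it is positive and exceeds \<open>u\<close>: a bump cut
  off at zero has a kink at its rim, and where \<open>h \<le> 0\<close> the nonnegativity of
  \<open>u\<close> settles the matter. At a negative minimum of the weighted difference, the
  exponential factor beats the Lipschitz bound on \<open>f\<close>; on the wall,
  \<open>0 < z \<bullet> G x\<close> contradicts the Neumann condition.\<close>

lemma comparison:
  fixes u h :: "real \<Rightarrow> 'a::euclidean_space \<Rightarrow> real"
  assumes K: "closed K" and u: "neumann_solution f (- K) u"
    and ub: "\<And>t x. x \<in> - K \<Longrightarrow> 0 < u t x \<and> u t x < 1"
    and lip: "\<And>x y. x \<in> {0..1} \<Longrightarrow> y \<in> {0..1} \<Longrightarrow> \<bar>f x - f y\<bar> \<le> L * \<bar>x - y\<bar>"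
    and hc: "continuous_on ({T0..T1} \<times> (cball Q r \<inter> closure (- K))) (\<lambda>(t, x). h t x)"
    and init: "\<And>x. x \<in> cball Q r \<Longrightarrow> x \<in> closure (- K) \<Longrightarrow> h T0 x \<le> u T0 x"
    and h1: "\<And>t x. T0 \<le> t \<Longrightarrow> t \<le> T1 \<Longrightarrow> h t x \<le> 1"
    and inside: "\<And>t x. T0 < t \<Longrightarrow> t \<le> T1 \<Longrightarrow> x \<in> cball Q r \<Longrightarrow> x \<in> closure (- K) \<Longrightarrow> u t x < h t x \<Longrightarrow> 0 < h t x \<Longrightarrow>
        x \<in> ball Q r"
    and sub: "\<And>t x. T0 < t \<Longrightarrow> t \<le> T1 \<Longrightarrow> x \<in> ball Q r \<Longrightarrow> x \<in> - K \<Longrightarrow> u t x < h t x \<Longrightarrow> 0 < h t x \<Longrightarrow>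
        \<exists>Dh A ht. eventually (\<lambda>y. (h t has_derivative (\<lambda>v. Dh y \<bullet> v)) (at y)) (nhds x) \<and>
          (Dh has_derivative A) (at x) \<and> ((\<lambda>s. h s x) has_real_derivative ht) (at t) \<and>
          ht \<le> (\<Sum>b\<in>Basis. A b \<bullet> b) + f (h t x)"
    and bdry: "\<And>t x. T0 < t \<Longrightarrow> t \<le> T1 \<Longrightarrow> x \<in> ball Q r \<Longrightarrow> x \<in> frontier K \<Longrightarrow> u t x < h t x \<Longrightarrow> 0 < h t x \<Longrightarrow>
        \<exists>z \<rho> g G. (h t has_derivative (\<lambda>v. z \<bullet> v)) (at x) \<and> local_defining_fun K x \<rho> g G \<and> 0 < z \<bullet> G x"
    and t: "T0 \<le> t" "t \<le> T1" and x: "x \<in> cball Q r" "x \<in> closure (- K)"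
  shows "h t x \<le> u t x"
proof (rule ccontr)
  assume neg: "\<not> h t x \<le> u t x"
  \<comment> \<open>Exceeding the Lipschitz constant by 1 leaves the positive term
    \<open>h - u\<close> over at the minimum.\<close>
  define \<Lambda> where "\<Lambda> = L + 1"
  define C where "C = {T0..T1} \<times> (cball Q r \<inter> closure (- K))"
  define W where "W = (\<lambda>(t, x). exp (- \<Lambda> * t) * (u t x - h t x))"
  have "compact C" unfolding C_def by (intro compact_Times compact_Icc compact_Int_closed) auto
  moreover have "C \<noteq> {}" using t x by (auto simp: C_def)
  moreover have "continuous_on C W"
  proof -
    have "continuous_on C (\<lambda>(t, x). u t x)"
      by (rule continuous_on_subset[of "UNIV \<times> closure (- K)"]) (use u in \<open>auto simp: neumann_solution_def C_def\<close>)
    then show ?thesis using hc unfolding W_def C_def case_prod_beta by (intro continuous_intros)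
  qed
  ultimately have "\<exists>q\<in>C. \<forall>q'\<in>C. W q \<le> W q'" by (rule continuous_attains_inf)
  then obtain s y where C: "(s, y) \<in> C" and min: "\<And>t x. (t, x) \<in> C \<Longrightarrow> W (s, y) \<le> W (t, x)" by auto
  have "W (s, y) \<le> W (t, x)" using t x by (intro min) (auto simp: C_def)
  also have "\<dots> < 0" using neg by (simp add: W_def mult_pos_neg)
  finally have less: "u s y < h s y" by (simp add: W_def mult_less_0_iff)
  have y: "y \<in> cball Q r" "y \<in> closure (- K)" and s: "T0 \<le> s" "s \<le> T1" using C by (auto simp: C_def)
  have s0: "T0 < s" using init[OF y] less s by (cases "s = T0") auto
  have u0: "0 \<le> u s y" using neumann_solution_nonneg[OF u _ y(2)] ub by blast
  then have h0: "0 < h s y" using less by simp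
  have yb: "y \<in> ball Q r" by (rule inside[OF s0 s(2) y less h0])
  have space_min: "u s y - h s y \<le> u s z - h s z" if "z \<in> cball Q r" "z \<in> closure (- K)" for z
    using min[of s z] that s by (auto simp: C_def W_def)
  show False
  proof (cases "y \<in> K")
    case False
    then have yK: "y \<in> - K" by simp
    obtain Dh A ht where Dh: "eventually (\<lambda>y. (h s has_derivative (\<lambda>v. Dh y \<bullet> v)) (at y)) (nhds y)"
      and A: "(Dh has_derivative A) (at y)" and ht: "((\<lambda>s. h s y) has_real_derivative ht) (at s)"
      and hle: "ht \<le> (\<Sum>b\<in>Basis. A b \<bullet> b) + f (h s y)"
      using sub[OF s0 s(2) yb yK less h0] by blast
    obtain Du D2u where Du: "\<And>x. x \<in> - K \<Longrightarrow> (u s has_derivative blinfun_apply (Du x)) (at x)"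
      and D2u: "(Du has_derivative blinfun_apply (D2u y)) (at y)"
      and ut: "((\<lambda>s. u s y) has_real_derivative (laplace_of (D2u y) + f (u s y))) (at s)"
      using u yK unfolding neumann_solution_def by blast
    have nbh: "eventually (\<lambda>z. z \<in> ball Q r \<inter> - K) (nhds y)"
      using yb yK K by (intro eventually_nhds_in_open) auto
    let ?p' = "\<lambda>z v. blinfun_apply (Du z) v - Dh z \<bullet> v"
    have "0 \<le> D2u y b b - A b \<bullet> b" for b
    proof (rule second_order_min(2)[where p = "\<lambda>z. u s z - h s z" and p' = ?p' and x = y])
      show "eventually (\<lambda>z. ((\<lambda>z. u s z - h s z) has_derivative ?p' z) (at z)) (nhds y)"
        using nbh Dh by eventually_elim (intro has_derivative_diff, auto intro: Du)
      show "eventually (\<lambda>z. u s y - h s y \<le> u s z - h s z) (nhds y)"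
        using nbh by eventually_elim (rule space_min, use closure_subset[of "- K"] in auto)
      show "((\<lambda>s. ?p' (y + s *\<^sub>R b) b) has_real_derivative D2u y b b - A b \<bullet> b) (at 0)"
        by (intro DERIV_diff gradient_directional_derivative blinfun_directional_derivative A D2u)
    qed
    then have "0 \<le> (\<Sum>b\<in>Basis. D2u y b b - A b \<bullet> b)" by (intro sum_nonneg) auto
    then have lap: "(\<Sum>b\<in>Basis. A b \<bullet> b) \<le> laplace_of (D2u y)" by (simp add: sum_subtractf laplace_of_def)
    let ?d = "exp (- \<Lambda> * s) * (- \<Lambda> * (u s y - h s y) + (laplace_of (D2u y) + f (u s y) - ht))"
    have der: "((\<lambda>t. W (t, y)) has_real_derivative ?d) (at s)"
    proof -
      have "((\<lambda>t. exp (- \<Lambda> * t)) has_real_derivative exp (- \<Lambda> * s) * (- \<Lambda>)) (at s)"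
        by (auto intro!: derivative_eq_intros)
      from DERIV_mult[OF this DERIV_diff[OF ut ht]]
      show ?thesis by (simp add: W_def algebra_simps)
    qed
    \<comment> \<open>Only earlier times are compared, because the minimum may lie at the final time
      \<open>T1\<close>.\<close>
    have "?d \<le> 0"
    proof (rule ccontr)
      assume "\<not> ?d \<le> 0"
      then have "0 < ?d" by simp
      from DERIV_pos_inc_left[OF der this] obtain e where e: "e > 0" "\<And>h. 0 < h \<Longrightarrow> h < e \<Longrightarrow> W (s - h, y) < W (s, y)"
        by auto
      define \<sigma> where "\<sigma> = min (e / 2) (s - T0)"
      have "0 < \<sigma>" "\<sigma> < e" "\<sigma> \<le> s - T0" using e s0 by (auto simp: \<sigma>_def)
      then show False using e(2)[of \<sigma>] min[of "s - \<sigma>" y] y s by (auto simp: C_def)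
    qed
    then have "- \<Lambda> * (u s y - h s y) + (laplace_of (D2u y) + f (u s y) - ht) \<le> 0" by (simp add: mult_le_0_iff)
    with hle lap have "- \<Lambda> * (u s y - h s y) + f (u s y) - f (h s y) \<le> 0" by linarith
    moreover have "\<bar>f (u s y) - f (h s y)\<bar> \<le> L * \<bar>u s y - h s y\<bar>"
      using h1[OF s, of y] h0 u0 less by (intro lip) auto
    moreover have "L * \<bar>u s y - h s y\<bar> = - L * (u s y - h s y)" using less by (simp add: algebra_simps)
    ultimately have "- \<Lambda> * (u s y - h s y) + L * (u s y - h s y) \<le> 0" by linarith
    then show False using less by (simp add: \<Lambda>_def algebra_simps)
  next
    case True
    have yf: "y \<in> frontier K" using True y K by (simp add: frontier_closures)
    obtain z \<rho> g G where hz: "(h s has_derivative (\<lambda>v. z \<bullet> v)) (at y)"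
      and lf: "local_defining_fun K y \<rho> g G" and zG: "0 < z \<bullet> G y"
      using bdry[OF s0 s(2) yb yf less h0] by blast
    have "\<exists>Du. (u s has_derivative Du) (at y within closure (- K)) \<and>
        (\<forall>r g G. local_defining_fun K y r g G \<longrightarrow> Du (G y) = 0)"
      using u yf unfolding neumann_solution_def frontier_complement double_complement by blast
    then obtain Du where Du: "(u s has_derivative Du) (at y within closure (- K))" and DuG: "Du (G y) = 0"
      using lf by blast
    obtain d where d: "d > 0" "\<And>\<sigma>. 0 < \<sigma> \<Longrightarrow> \<sigma> < d \<Longrightarrow> y + \<sigma> *\<^sub>R G y \<notin> K"
      using inward_direction[OF lf yf] by blast
    \<comment> \<open>Along \<open>G y\<close>, which enters the domain, \<open>u\<close> has
      derivative 0 and \<open>h\<close> has derivative \<open>z \<bullet> G y > 0\<close>, so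
      \<open>u - h\<close> would fall below its minimum. The derivative is one-sided because that of
      \<open>u\<close> is taken within the closed domain.\<close>
    let ?l = "\<lambda>\<sigma>. y + \<sigma> *\<^sub>R G y"
    have cl: "?l \<sigma> \<in> closure (- K)" if "\<sigma> \<in> {0..<d}" for \<sigma>
      using that d(2)[of \<sigma>] y closure_subset[of "- K"] by (cases "\<sigma> = 0") auto
    have "((\<lambda>z. u s z - h s z) has_derivative (\<lambda>v. Du v - z \<bullet> v)) (at y within closure (- K))"
      by (intro has_derivative_diff Du has_derivative_at_withinI[OF hz])
    then have "((\<lambda>z. u s z - h s z) has_derivative (\<lambda>v. Du v - z \<bullet> v)) (at (?l 0) within ?l ` {0..<d})"
      using cl by (auto intro: has_derivative_subset)
    moreover have "(?l has_derivative (\<lambda>k. k *\<^sub>R G y)) (at 0 within {0..<d})"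
      by (auto intro!: derivative_eq_intros)
    ultimately have "((\<lambda>\<sigma>. u s (?l \<sigma>) - h s (?l \<sigma>)) has_derivative (\<lambda>k. Du (k *\<^sub>R G y) - z \<bullet> (k *\<^sub>R G y))) (at 0 within {0..<d})"
      by (rule has_derivative_in_compose[rotated])
    moreover have "(\<lambda>k. Du (k *\<^sub>R G y) - z \<bullet> (k *\<^sub>R G y)) = (*) (- (z \<bullet> G y))"
      using linear_cmul[OF has_derivative_linear[OF Du]] DuG by (auto simp: fun_eq_iff)
    ultimately have "((\<lambda>\<sigma>. u s (?l \<sigma>) - h s (?l \<sigma>)) has_real_derivative - (z \<bullet> G y)) (at 0 within {0..<d})"
      by (simp add: has_field_derivative_def)
    from has_real_derivative_neg_dec_right[OF this] zG obtain e where e: "e > 0"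
      "\<And>\<sigma>. \<sigma> > 0 \<Longrightarrow> \<sigma> < d \<Longrightarrow> \<sigma> < e \<Longrightarrow> u s (?l \<sigma>) - h s (?l \<sigma>) < u s y - h s y" by auto
    have Gn: "norm (G y) > 0" using lf by (simp add: local_defining_fun_def)
    \<comment> \<open>The third bound keeps the test point in \<open>cball Q r\<close>, where the
      minimum was taken.\<close>
    define \<sigma> where "\<sigma> = Min {d / 2, e / 2, (r - dist Q y) / norm (G y)}"
    have \<sigma>: "0 < \<sigma>" "\<sigma> < d" "\<sigma> < e" "\<sigma> \<le> (r - dist Q y) / norm (G y)"
      using d e yb Gn by (auto simp: \<sigma>_def min_less_iff_disj)
    have "dist Q (?l \<sigma>) \<le> dist Q y + \<sigma> * norm (G y)"
      using dist_triangle[of Q "?l \<sigma>" y] \<sigma> by (simp add: dist_norm)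
    also have "\<dots> \<le> r" using \<sigma>(4) Gn by (simp add: pos_le_divide_eq)
    finally have "?l \<sigma> \<in> cball Q r" by simp
    from space_min[OF this cl] e(2)[OF \<sigma>(1-3)] \<sigma> show False by auto
  qed
qed

section \<open>Normals of the wall\<close>

text \<open>A decreasing radial function centred at \<open>P\<close> has its gradient in direction
  \<open>P - x\<close>, and \<open>G x\<close> points out of the wall. The inequality makes such a
  function strictly increase into the domain, the sign that \<open>comparison\<close> asks for on
  the wall.\<close>

definition faces_center :: "'a::euclidean_space set \<Rightarrow> real \<Rightarrow> 'a \<Rightarrow> bool" where
  "faces_center K \<rho> P \<longleftrightarrow> (\<forall>x\<in>frontier K. dist P x < \<rho> \<longrightarrow>
     (\<exists>r g G. local_defining_fun K x r g G \<and> 0 < (P - x) \<bullet> G x))"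

text \<open>A ball touches the wall from outside. If the claim failed, the vector
  \<open>v = (Q - x) - G x\<close> would point both into \<open>K\<close> and into the open
  ball.\<close>

lemma touching_normal:
  fixes K :: "'a::euclidean_space set"
  assumes lf: "local_defining_fun K x r g G" and x: "x \<in> K" and d: "dist Q x = R" and R: "R > 0"
    and out: "\<And>k. k \<in> K \<Longrightarrow> R \<le> dist Q k"
  shows "0 < (Q - x) \<bullet> G x"
proof (rule ccontr)
  let ?n = "Q - x"
  assume "\<not> 0 < ?n \<bullet> G x"
  then have nG: "?n \<bullet> G x \<le> 0" by simp
  have r: "r > 0" and g: "(g has_derivative (\<lambda>h. G x \<bullet> h)) (at x)" and G: "G x \<noteq> 0"
    and K: "\<And>y. y \<in> ball x r \<Longrightarrow> y \<in> K \<longleftrightarrow> g y \<le> 0"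
    using lf unfolding local_defining_fun_def by auto
  define v where "v = ?n - G x"
  have nn: "?n \<bullet> ?n = R\<^sup>2" using d by (simp add: dist_norm flip: power2_norm_eq_inner)
  have vG: "G x \<bullet> v < 0"
  proof -
    have "0 < G x \<bullet> G x" using G by simp
    moreover have "G x \<bullet> v = ?n \<bullet> G x - G x \<bullet> G x" by (simp only: v_def inner_diff_right inner_commute)
    ultimately show ?thesis using nG by linarith
  qed
  have vn: "?n \<bullet> v > 0"
  proof -
    have "0 < R\<^sup>2" using R by simp
    moreover have "?n \<bullet> v = ?n \<bullet> ?n - ?n \<bullet> G x" unfolding v_def by (rule inner_diff_right)
    ultimately show ?thesis using nG nn by linarith
  qed
  have "((\<lambda>s. x + s *\<^sub>R v) has_derivative (\<lambda>h. h *\<^sub>R v)) (at (0::real))"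
    by (auto intro!: derivative_eq_intros)
  from has_derivative_compose[OF this, of g "\<lambda>h. G x \<bullet> h"] g
  have "((\<lambda>s. g (x + s *\<^sub>R v)) has_derivative (\<lambda>s. s * (G x \<bullet> v))) (at 0)" by simp
  moreover have "(\<lambda>s. s * (G x \<bullet> v)) = (*) (G x \<bullet> v)" by (auto simp: fun_eq_iff)
  ultimately have "((\<lambda>s. g (x + s *\<^sub>R v)) has_real_derivative G x \<bullet> v) (at 0)"
    by (simp add: has_field_derivative_def)
  from DERIV_neg_dec_right[OF this vG] obtain e where e: "e > 0"
    "\<And>s. 0 < s \<Longrightarrow> s < e \<Longrightarrow> g (x + s *\<^sub>R v) < g x" by auto
  have v0: "v \<noteq> 0" using vn by auto
  then have vv: "v \<bullet> v > 0" by simp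
  \<comment> \<open>Small enough that \<open>g\<close> decreases along \<open>v\<close>, that
    \<open>?y\<close> stays in the chart, and that \<open>?y\<close> is closer to \<open>Q\<close>
    than \<open>R\<close>: the squared distance changes by
    \<open>s^2 * (v \<bullet> v) - 2 * s * (?n \<bullet> v)\<close>.\<close>
  define s where "s = Min {e / 2, r / (2 * norm v), (?n \<bullet> v) / (v \<bullet> v)}"
  have "r / (2 * norm v) < r / norm v" "0 < (?n \<bullet> v) / (v \<bullet> v)" "0 < r / (2 * norm v)"
    using r v0 vn vv by (auto simp: field_simps)
  then have s: "0 < s" "s < e" "s < r / norm v" "s \<le> (?n \<bullet> v) / (v \<bullet> v)"
    using e by (auto simp: s_def min_less_iff_disj)
  let ?y = "x + s *\<^sub>R v"
  have "s * norm v < r" using s v0 by (simp add: field_simps)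
  then have "?y \<in> ball x r" using s by (simp add: dist_norm)
  moreover have "g ?y \<le> 0" using e(2)[OF s(1,2)] K[of x] x r by auto
  ultimately have "?y \<in> K" using K by auto
  then have "R \<le> norm (?n - s *\<^sub>R v)" using out[of ?y] by (simp add: dist_norm algebra_simps)
  then have "R\<^sup>2 \<le> (norm (?n - s *\<^sub>R v))\<^sup>2" using R by (intro power_mono) auto
  also have "\<dots> = R\<^sup>2 - 2 * s * (?n \<bullet> v) + s * (s * (v \<bullet> v))"
    unfolding power2_norm_eq_inner nn[symmetric] by (simp add: inner_diff_left inner_diff_right inner_commute algebra_simps)
  finally have "2 * s * (?n \<bullet> v) \<le> s * (s * (v \<bullet> v))" by simp
  then have "2 * (?n \<bullet> v) \<le> s * (v \<bullet> v)" using s by simp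
  moreover have "s * (v \<bullet> v) \<le> ?n \<bullet> v" using s(4) vv by (simp add: pos_le_divide_eq)
  ultimately show False using vn by simp
qed

text \<open>Violations with margins tending to 0 would accumulate at a point of
  \<open>\<Gamma>\<close> and a wall point at distance exactly \<open>R\<close>. There
  \<open>touching_normal\<close> gives a strict inequality, which persists nearby because
  \<open>G\<close> is continuous.\<close>

lemma faces_center_near:
  fixes K :: "'a::euclidean_space set"
  assumes \<Gamma>: "compact \<Gamma>" and K: "closed K" and R: "R > 0"
    and out: "\<And>P k. P \<in> \<Gamma> \<Longrightarrow> k \<in> K \<Longrightarrow> R \<le> dist P k"
    and sm: "\<And>p. p \<in> frontier K \<Longrightarrow> \<exists>r g G. local_defining_fun K p r g G"
  obtains \<delta> where "\<delta> > 0" "\<And>P Q. Q \<in> \<Gamma> \<Longrightarrow> dist P Q < \<delta> \<Longrightarrow> faces_center K (R + \<delta>) P"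
proof (rule ccontr)
  assume not: "\<not> thesis"
  define e where "e j = inverse (real (Suc j))" for j
  have e: "0 < e j" "e j \<le> 1" for j by (auto simp: e_def inverse_le_1_iff)
  have "\<exists>P Q x. Q \<in> \<Gamma> \<and> dist P Q < e j \<and> x \<in> frontier K \<and> dist P x < R + e j \<and>
     \<not> (\<exists>r g G. local_defining_fun K x r g G \<and> 0 < (P - x) \<bullet> G x)" for j
    using not that[OF e(1)[of j]] unfolding faces_center_def by blast
  then obtain P Q x where Q: "\<And>j. Q j \<in> \<Gamma>" and PQ: "\<And>j. dist (P j) (Q j) < e j"
    and x: "\<And>j. x j \<in> frontier K" and Px: "\<And>j. dist (P j) (x j) < R + e j"
    and bad: "\<And>j r g G. local_defining_fun K (x j) r g G \<Longrightarrow> \<not> 0 < (P j - x j) \<bullet> G (x j)"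
    by metis
  obtain B where B: "\<And>q. q \<in> \<Gamma> \<Longrightarrow> norm q \<le> B"
    using compact_imp_bounded[OF \<Gamma>] by (auto simp: bounded_iff)
  have xB: "x j \<in> frontier K \<inter> cball 0 (B + R + 2)" for j
  proof -
    have "norm (x j) \<le> norm (Q j) + dist (P j) (Q j) + dist (P j) (x j)"
      using norm_triangle_sub[of "x j" "Q j"] dist_triangle[of "x j" "Q j" "P j"]
      by (simp add: dist_norm norm_minus_commute)
    also have "\<dots> \<le> B + 1 + (R + 1)" using B[OF Q[of j]] PQ[of j] Px[of j] e(2)[of j] by linarith
    finally show ?thesis using x[of j] by simp
  qed
  have "compact (\<Gamma> \<times> (frontier K \<inter> cball 0 (B + R + 2)))"
    by (intro compact_Times \<Gamma> closed_Int_compact) auto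
  moreover have "\<forall>j. (Q j, x j) \<in> \<Gamma> \<times> (frontier K \<inter> cball 0 (B + R + 2))" using Q xB by auto
  ultimately obtain l \<sigma> where l: "l \<in> \<Gamma> \<times> (frontier K \<inter> cball 0 (B + R + 2))" and \<sigma>: "strict_mono \<sigma>"
    and lim: "((\<lambda>j. (Q j, x j)) \<circ> \<sigma>) \<longlonglongrightarrow> l"
    unfolding compact_def by meson
  obtain q y where ly: "l = (q, y)" by (cases l)
  have Ql: "(\<lambda>j. Q (\<sigma> j)) \<longlonglongrightarrow> q" using tendsto_fst[OF lim] by (simp add: ly o_def)
  have xl: "(\<lambda>j. x (\<sigma> j)) \<longlonglongrightarrow> y" using tendsto_snd[OF lim] by (simp add: ly o_def)
  have q: "q \<in> \<Gamma>" and y: "y \<in> frontier K" using l ly by auto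
  have yK: "y \<in> K" using y K by (metis frontier_subset_eq subsetD)
  have el: "(\<lambda>j. e (\<sigma> j)) \<longlonglongrightarrow> 0"
    using LIMSEQ_subseq_LIMSEQ[OF LIMSEQ_inverse_real_of_nat \<sigma>] by (simp add: e_def[abs_def] o_def)
  have Pl: "(\<lambda>j. P (\<sigma> j)) \<longlonglongrightarrow> q"
  proof -
    have "(\<lambda>j. P (\<sigma> j) - Q (\<sigma> j)) \<longlonglongrightarrow> 0"
      by (rule Lim_null_comparison[OF _ el]) (use PQ in \<open>auto simp: dist_norm less_imp_le\<close>)
    from tendsto_add[OF this Ql] show ?thesis by simp
  qed
  have "dist q y \<le> R + 0"
    by (rule LIMSEQ_le[OF tendsto_dist[OF Pl xl] tendsto_add[OF tendsto_const el]])
      (use Px in \<open>auto simp: less_imp_le\<close>)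
  then have d: "dist q y = R" using out[OF q yK] by simp
  obtain r g G where lf: "local_defining_fun K y r g G" using sm[OF y] by blast
  have pos: "0 < (q - y) \<bullet> G y" by (rule touching_normal[OF lf yK d R out[OF q]])
  have Gc: "isCont G y" using lf unfolding local_defining_fun_def
    by (metis centre_in_ball continuous_on_eq_continuous_at open_ball)
  have "(\<lambda>j. (P (\<sigma> j) - x (\<sigma> j)) \<bullet> G (x (\<sigma> j))) \<longlonglongrightarrow> (q - y) \<bullet> G y"
    by (intro tendsto_intros Pl xl isCont_tendsto_compose[OF Gc])
  then have "eventually (\<lambda>j. 0 < (P (\<sigma> j) - x (\<sigma> j)) \<bullet> G (x (\<sigma> j))) sequentially"
    using pos by (rule order_tendstoD)
  moreover have "eventually (\<lambda>j. x (\<sigma> j) \<in> ball y r) sequentially"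
    using lf by (intro topological_tendstoD[OF xl]) (auto simp: local_defining_fun_def)
  ultimately obtain j where j: "0 < (P (\<sigma> j) - x (\<sigma> j)) \<bullet> G (x (\<sigma> j))" "x (\<sigma> j) \<in> ball y r"
    using eventually_happens'[OF sequentially_bot eventually_conj] by blast
  \<comment> \<open>The chart at the limit point \<open>y\<close> also serves at nearby wall points,
    on a smaller ball.\<close>
  let ?r = "r - dist y (x (\<sigma> j))"
  have sub: "ball (x (\<sigma> j)) ?r \<subseteq> ball y r"
  proof
    fix z assume "z \<in> ball (x (\<sigma> j)) ?r"
    then show "z \<in> ball y r" using dist_triangle[of y z "x (\<sigma> j)"] by simp
  qed
  have "local_defining_fun K (x (\<sigma> j)) ?r g G"
    unfolding local_defining_fun_def
  proof (intro conjI)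
    show "continuous_on (ball (x (\<sigma> j)) ?r) G"
      using lf sub continuous_on_subset unfolding local_defining_fun_def by blast
    show "\<forall>z\<in>ball (x (\<sigma> j)) ?r. (g has_derivative (\<lambda>h. G z \<bullet> h)) (at z)"
      using lf sub unfolding local_defining_fun_def by blast
    show "K \<inter> ball (x (\<sigma> j)) ?r = {z \<in> ball (x (\<sigma> j)) ?r. g z \<le> 0}"
      using lf sub unfolding local_defining_fun_def by blast
  qed (use j in auto)
  from bad[OF this] j show False by blast
qed

lemma faces_center_mono: "faces_center K \<rho>' P \<Longrightarrow> \<rho> \<le> \<rho>' \<Longrightarrow> faces_center K \<rho> P"
  unfolding faces_center_def by (meson less_le_trans)

lemma abs_fst_diff_le_dist: "\<bar>fst x - fst y\<bar> \<le> dist x y" for x y :: "real \<times> 'b::real_normed_vector"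
  using dist_fst_le[of x y] by (simp add: dist_real_def)

lemma dist_le_same_snd:
  fixes P Q k :: "real \<times> 'b::real_normed_vector"
  assumes "snd P = snd Q" "\<bar>fst P - fst k\<bar> \<le> \<bar>fst Q - fst k\<bar>"
  shows "dist P k \<le> dist Q k"
  using assms unfolding dist_prod_def dist_real_def
  by (intro real_sqrt_le_mono add_mono power_mono) auto

text \<open>Vacuous, since the open ball of radius \<open>\<rho>\<close> around such a centre misses
  the slab.\<close>

lemma faces_center_outside_slab:
  fixes K :: "(real \<times> 'b::euclidean_space) set"
  assumes K: "closed K" "K \<subseteq> {x. 0 \<le> fst x \<and> fst x \<le> M}" and P: "fst P \<le> - \<rho> \<or> M + \<rho> \<le> fst P"
  shows "faces_center K \<rho> P"
  unfolding faces_center_def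
proof (intro ballI impI)
  fix x assume x: "x \<in> frontier K" and d: "dist P x < \<rho>"
  have "x \<in> K" using x K(1) frontier_subset_eq by blast
  then have "0 \<le> fst x" "fst x \<le> M" using K(2) by auto
  with P d abs_fst_diff_le_dist[of P x] show "\<exists>r g G. local_defining_fun K x r g G \<and> 0 < (P - x) \<bullet> G x" by linarith
qed

section \<open>Moving bumps\<close>

locale moving_bump = radial_family g L \<alpha> n w
  for g :: "real \<Rightarrow> real" and L \<alpha> :: real and n :: nat and w :: "real \<Rightarrow> real \<Rightarrow> real \<Rightarrow> real" +
  fixes a \<eta> T :: real and K :: "'a::euclidean_space set" and f :: "real \<Rightarrow> real" and u :: "real \<Rightarrow> 'a \<Rightarrow> real"
  assumes nD: "n = DIM('a)" and \<eta>: "\<eta> > 0" and T: "T > 0" and a1: "a < 1" and a\<alpha>: "\<alpha> < a"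
    and zero: "w a (- \<eta>) T = 0"
    and pos: "\<And>\<tau>. 0 \<le> \<tau> \<Longrightarrow> \<tau> < T \<Longrightarrow> w a (- \<eta>) \<tau> > 0"
    and neg: "\<And>\<tau>. 0 \<le> \<tau> \<Longrightarrow> \<tau> \<le> T \<Longrightarrow> k a (- \<eta>) \<tau> < 0"
    and K: "closed K" and u: "neumann_solution f (- K) u"
    and ub: "\<And>t x. x \<in> - K \<Longrightarrow> 0 < u t x \<and> u t x < 1"
    and fg: "\<And>s. 0 \<le> s \<Longrightarrow> s \<le> 1 \<Longrightarrow> f s = g s"
begin

text \<open>The cap at \<open>T\<close> freezes the profile at its first zero, which extends it
  continuously by 0 outside its ball.\<close>

definition bump :: "'a \<Rightarrow> real" where "bump x = w a (- \<eta>) (min (x \<bullet> x / 2) T)"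

abbreviation radius :: real where "radius \<equiv> sqrt (2 * T)"

definition covers :: "real \<Rightarrow> 'a \<Rightarrow> bool" where
  "covers t P \<longleftrightarrow> (\<forall>x\<in>closure (- K). bump (x - P) \<le> u t x)"

lemma u_nonneg: "x \<in> closure (- K) \<Longrightarrow> 0 \<le> u t x"
  using neumann_solution_nonneg[OF u] ub by blast

lemma f_lip: "x \<in> {0..1} \<Longrightarrow> y \<in> {0..1} \<Longrightarrow> \<bar>f x - f y\<bar> \<le> L * \<bar>x - y\<bar>"
  using lip fg by auto

lemma inside_radius: "x \<bullet> x / 2 < T \<longleftrightarrow> norm x < radius"
proof -
  have "norm x < radius \<longleftrightarrow> sqrt (x \<bullet> x) < sqrt (2 * T)" by (simp only: norm_eq_sqrt_inner)
  then show ?thesis by (simp add: field_simps)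
qed

lemma bump_pos_iff: "0 < bump x \<longleftrightarrow> x \<bullet> x / 2 < T"
proof (cases "x \<bullet> x / 2 < T")
  case True
  then show ?thesis using pos[of "x \<bullet> x / 2"] by (simp add: bump_def min_absorb1)
next
  case False
  then have "min (x \<bullet> x / 2) T = T" by linarith
  then show ?thesis using False by (simp only: bump_def zero less_irrefl)
qed

lemma bump_le: "bump x \<le> a"
proof -
  have "w a (- \<eta>) (min (x \<bullet> x / 2) T) \<le> w a (- \<eta>) 0"
    using neg T by (intro decreasing_le) (auto simp: less_imp_le)
  then show ?thesis by (simp add: bump_def)
qed

lemma bump_zero: "bump 0 = a"
  using T by (simp add: bump_def)

lemma bump_outside: "radius \<le> norm x \<Longrightarrow> bump x = 0"
proof -
  assume "radius \<le> norm x"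
  then have "min (x \<bullet> x / 2) T = T" using inside_radius[of x] by linarith
  then show ?thesis by (simp only: bump_def zero)
qed

lemma bump_cont: "continuous_on S bump"
  unfolding bump_def by (intro continuous_on_compose2[OF w_cont1[of UNIV]] continuous_intros) auto

section \<open>Derivatives of the moving bump\<close>

lemma bump_deriv:
  assumes "(x - P) \<bullet> (x - P) / 2 < T"
  shows "((\<lambda>y. bump (y - P)) has_derivative
    (\<lambda>v. (k a (- \<eta>) ((x - P) \<bullet> (x - P) / 2) *\<^sub>R (x - P)) \<bullet> v)) (at x)"
proof -
  have "((\<lambda>y. y - P) has_derivative (\<lambda>v. v)) (at x)" by (auto intro!: derivative_eq_intros)
  from has_derivative_compose[OF this radial_has_derivative[OF w_deriv]]
  have "((\<lambda>y. w a (- \<eta>) ((y - P) \<bullet> (y - P) / 2)) has_derivative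
    (\<lambda>v. (k a (- \<eta>) ((x - P) \<bullet> (x - P) / 2) *\<^sub>R (x - P)) \<bullet> v)) (at x)" .
  moreover have "open {y. (y - P) \<bullet> (y - P) / 2 < T}" by (intro open_Collect_less continuous_intros) auto
  ultimately show ?thesis
    by (rule has_derivative_transform_within_open) (use assms in \<open>auto simp: bump_def\<close>)
qed

lemma bump_time_deriv:
  assumes "(x - P t) \<bullet> (x - P t) / 2 < T" and P: "(P has_vector_derivative P') (at t)"
  shows "((\<lambda>s. bump (x - P s)) has_real_derivative
    - (k a (- \<eta>) ((x - P t) \<bullet> (x - P t) / 2) * ((x - P t) \<bullet> P'))) (at t)"
proof -
  have "((\<lambda>s. x - P s) has_derivative (\<lambda>h. - (h *\<^sub>R P'))) (at t)"
    using P by (auto intro!: derivative_eq_intros simp: has_vector_derivative_def)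
  moreover have "(bump has_derivative (\<lambda>v. (k a (- \<eta>) ((x - P t) \<bullet> (x - P t) / 2) *\<^sub>R (x - P t)) \<bullet> v)) (at (x - P t))"
    using bump_deriv[of "x - P t" 0] assms(1) by simp
  ultimately have "((\<lambda>s. bump (x - P s)) has_derivative
      (\<lambda>h. (k a (- \<eta>) ((x - P t) \<bullet> (x - P t) / 2) *\<^sub>R (x - P t)) \<bullet> - (h *\<^sub>R P'))) (at t)"
    by (rule has_derivative_compose)
  moreover have "(\<lambda>h. (k a (- \<eta>) ((x - P t) \<bullet> (x - P t) / 2) *\<^sub>R (x - P t)) \<bullet> - (h *\<^sub>R P'))
      = (*) (- (k a (- \<eta>) ((x - P t) \<bullet> (x - P t) / 2) * ((x - P t) \<bullet> P')))"
    by (auto simp: fun_eq_iff)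
  ultimately show ?thesis by (simp only: has_field_derivative_def)
qed

lemma bump_laplacian:
  assumes "(x - P) \<bullet> (x - P) / 2 < T"
  obtains A where "((\<lambda>y. k a (- \<eta>) ((y - P) \<bullet> (y - P) / 2) *\<^sub>R (y - P)) has_derivative A) (at x)"
    "(\<Sum>b\<in>Basis. A b \<bullet> b) = \<eta> - f (bump (x - P))"
proof -
  obtain A where A: "((\<lambda>y. k a (- \<eta>) (y \<bullet> y / 2) *\<^sub>R y) has_derivative A) (at (x - P))"
    "(\<Sum>b\<in>Basis. A b \<bullet> b) = - (g (w a (- \<eta>) ((x - P) \<bullet> (x - P) / 2)) + - \<eta>)"
    by (rule radial_laplacian[OF nD, of "- \<eta>" a "x - P"])
  have "((\<lambda>y. y - P) has_derivative (\<lambda>v. v)) (at x)" by (auto intro!: derivative_eq_intros)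
  from has_derivative_compose[OF this A(1)] show thesis
  proof (rule that)
    have "0 < bump (x - P)" "bump (x - P) \<le> 1" using assms bump_pos_iff[of "x - P"] bump_le[of "x - P"] a1 by auto
    then have "f (bump (x - P)) = g (bump (x - P))" by (intro fg) auto
    then show "(\<Sum>b\<in>Basis. A b \<bullet> b) = \<eta> - f (bump (x - P))"
      using A(2) assms by (simp add: bump_def)
  qed
qed

text \<open>A bump whose centre moves with speed \<open>\<sigma>\<close> changes in time at rate at
  most \<open>|k| * radius * \<sigma>\<close>. The margin \<open>\<eta>\<close>, by which the
  resting bump is a strict subsolution, has to cover this.\<close>

lemma speed:
  obtains \<sigma> where "\<sigma> > 0"
    "\<And>\<tau>. 0 \<le> \<tau> \<Longrightarrow> \<tau> \<le> T \<Longrightarrow> \<bar>k a (- \<eta>) \<tau>\<bar> * (radius * \<sigma>) \<le> \<eta>"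
proof -
  have "bounded (k a (- \<eta>) ` {0..T})"
    by (rule compact_imp_bounded[OF compact_continuous_image[OF k_cont1 compact_Icc]])
  then obtain B where B: "B > 0" "\<And>\<tau>. \<tau> \<in> {0..T} \<Longrightarrow> \<bar>k a (- \<eta>) \<tau>\<bar> \<le> B"
    unfolding bounded_pos by (metis imageI real_norm_def)
  define \<sigma> where "\<sigma> = \<eta> / (B * radius)"
  have r: "radius > 0" using T by simp
  have s: "\<sigma> > 0" using \<eta> B r by (simp add: \<sigma>_def)
  show thesis
  proof (rule that[OF s])
    fix \<tau> assume "0 \<le> \<tau>" "\<tau> \<le> T"
    then have "\<bar>k a (- \<eta>) \<tau>\<bar> * (radius * \<sigma>) \<le> B * (radius * \<sigma>)"
      using B s r by (intro mult_right_mono mult_nonneg_nonneg) auto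
    also have "\<dots> = \<eta>" using B r by (simp add: \<sigma>_def)
    finally show "\<bar>k a (- \<eta>) \<tau>\<bar> * (radius * \<sigma>) \<le> \<eta>" .
  qed
qed

text \<open>\<open>comparison\<close> is applied to \<open>bump (x - P t)\<close>: the transport
  term is paid for by \<open>\<eta>\<close>, and the wall condition follows from
  \<open>faces_center\<close> and the negative slope of the profile.\<close>

lemma slide:
  assumes \<sigma>: "\<And>\<tau>. 0 \<le> \<tau> \<Longrightarrow> \<tau> \<le> T \<Longrightarrow> \<bar>k a (- \<eta>) \<tau>\<bar> * (radius * \<sigma>) \<le> \<eta>"
    and P: "\<And>t. T0 \<le> t \<Longrightarrow> t \<le> T1 \<Longrightarrow> (P has_vector_derivative P' t) (at t)"
    and P': "\<And>t. T0 \<le> t \<Longrightarrow> t \<le> T1 \<Longrightarrow> norm (P' t) \<le> \<sigma>"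
    and face: "\<And>t. T0 \<le> t \<Longrightarrow> t \<le> T1 \<Longrightarrow> faces_center K radius (P t)"
    and init: "covers T0 (P T0)" and t: "T0 \<le> t" "t \<le> T1"
  shows "covers t (P t)"
  unfolding covers_def
proof
  fix x assume x: "x \<in> closure (- K)"
  have Pc: "continuous_on {T0..T1} P"
    using P by (intro continuous_at_imp_continuous_on ballI has_vector_derivative_continuous) auto
  obtain B where B: "\<And>t. t \<in> {T0..T1} \<Longrightarrow> norm (P t) \<le> B"
    using compact_imp_bounded[OF compact_continuous_image[OF Pc compact_Icc]]
    unfolding bounded_iff by (metis imageI)
  \<comment> \<open>One ball contains the positive part of the bump at all times concerned, which
    gives \<open>comparison\<close> a compact set; outside it the bump is at most 0 and
    \<open>u\<close> is nonnegative.\<close>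
  define r where "r = B + radius + 1"
  have in_ball: "y \<in> ball 0 r" if "(y - P s) \<bullet> (y - P s) / 2 < T" "T0 \<le> s" "s \<le> T1" for s y
  proof -
    have "norm (y - P s) < radius" using that(1) inside_radius by blast
    moreover have "norm (P s) \<le> B" using B that by simp
    ultimately show ?thesis using norm_triangle_sub[of y "P s"] by (simp add: r_def)
  qed
  show "bump (x - P t) \<le> u t x"
  proof (cases "x \<in> cball 0 r")
    case False
    then have "x \<notin> ball 0 r" by auto
    then have "\<not> (x - P t) \<bullet> (x - P t) / 2 < T" using in_ball t by blast
    then have "\<not> 0 < bump (x - P t)" by (simp add: bump_pos_iff)
    then show ?thesis using u_nonneg[OF x, of t] by simp
  next
    case True
    show ?thesis
    proof (rule comparison[OF K u ub f_lip, where h = "\<lambda>t x. bump (x - P t)" and ?T0.0 = T0 and ?T1.0 = T1 and Q = 0 and r = r])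
      show "continuous_on ({T0..T1} \<times> (cball 0 r \<inter> closure (- K))) (\<lambda>(t, x). bump (x - P t))"
        unfolding case_prod_beta
        by (intro continuous_on_compose2[OF bump_cont[of UNIV]] continuous_intros continuous_on_compose2[OF Pc]) auto
      show "bump (x - P T0) \<le> u T0 x" if "x \<in> closure (- K)" for x using init that by (simp add: covers_def)
      show "bump (x - P t) \<le> 1" for t x using bump_le[of "x - P t"] a1 by simp
      show "x \<in> ball 0 r" if "T0 < t" "t \<le> T1" "0 < bump (x - P t)" for t x
        using that by (intro in_ball[of _ t]) (auto simp: bump_pos_iff)
    next
      fix s y assume s: "T0 < s" "s \<le> T1" and h0: "0 < bump (y - P s)"
      let ?\<tau> = "(y - P s) \<bullet> (y - P s) / 2"
      have \<tau>: "0 \<le> ?\<tau>" "?\<tau> < T" using h0 by (auto simp: bump_pos_iff)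
      obtain A where A: "((\<lambda>z. k a (- \<eta>) ((z - P s) \<bullet> (z - P s) / 2) *\<^sub>R (z - P s)) has_derivative A) (at y)"
        "(\<Sum>b\<in>Basis. A b \<bullet> b) = \<eta> - f (bump (y - P s))"
        using bump_laplacian[OF \<tau>(2)] by blast
      have op: "open {z. (z - P s) \<bullet> (z - P s) / 2 < T}" by (intro open_Collect_less continuous_intros) auto
      have "eventually (\<lambda>z. z \<in> {z. (z - P s) \<bullet> (z - P s) / 2 < T}) (nhds y)"
        using \<tau>(2) by (intro eventually_nhds_in_open op) simp
      then have ev: "eventually (\<lambda>z. ((\<lambda>x. bump (x - P s)) has_derivative
          (\<lambda>v. (k a (- \<eta>) ((z - P s) \<bullet> (z - P s) / 2) *\<^sub>R (z - P s)) \<bullet> v)) (at z)) (nhds y)"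
        by (rule eventually_mono) (rule bump_deriv, simp)
      have "- (k a (- \<eta>) ?\<tau> * ((y - P s) \<bullet> P' s)) \<le> \<bar>k a (- \<eta>) ?\<tau>\<bar> * \<bar>(y - P s) \<bullet> P' s\<bar>"
        by (metis abs_ge_minus_self abs_mult)
      also have "\<dots> \<le> \<bar>k a (- \<eta>) ?\<tau>\<bar> * (radius * \<sigma>)"
      proof (rule mult_left_mono)
        have "\<bar>(y - P s) \<bullet> P' s\<bar> \<le> norm (y - P s) * norm (P' s)" by (rule Cauchy_Schwarz_ineq2)
        also have "\<dots> \<le> radius * \<sigma>"
          using iffD1[OF inside_radius \<tau>(2)] P'[of s] s T by (intro mult_mono) auto
        finally show "\<bar>(y - P s) \<bullet> P' s\<bar> \<le> radius * \<sigma>" .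
      qed simp
      also have "\<dots> \<le> \<eta>" using \<tau> by (intro \<sigma>) auto
      also have "\<dots> = (\<Sum>b\<in>Basis. A b \<bullet> b) + f (bump (y - P s))" using A(2) by simp
      finally show "\<exists>Dh A ht. eventually (\<lambda>z. ((\<lambda>x. bump (x - P s)) has_derivative (\<lambda>v. Dh z \<bullet> v)) (at z)) (nhds y) \<and>
          (Dh has_derivative A) (at y) \<and> ((\<lambda>t. bump (y - P t)) has_real_derivative ht) (at s) \<and>
          ht \<le> (\<Sum>b\<in>Basis. A b \<bullet> b) + f (bump (y - P s))"
        using ev A(1) bump_time_deriv[OF \<tau>(2) P[of s]] s by (meson less_imp_le)
    next
      fix s y assume s: "T0 < s" "s \<le> T1" and y: "y \<in> frontier K" and h0: "0 < bump (y - P s)"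
      let ?\<tau> = "(y - P s) \<bullet> (y - P s) / 2"
      have \<tau>: "0 \<le> ?\<tau>" "?\<tau> < T" using h0 by (auto simp: bump_pos_iff)
      have "dist (P s) y < radius"
        using iffD1[OF inside_radius \<tau>(2)] by (simp add: dist_norm norm_minus_commute)
      then obtain \<rho> g' G where lf: "local_defining_fun K y \<rho> g' G" and G: "0 < (P s - y) \<bullet> G y"
        using face[of s] s y unfolding faces_center_def by auto
      have "0 < - k a (- \<eta>) ?\<tau> * ((P s - y) \<bullet> G y)"
        by (intro mult_pos_pos) (use neg[of ?\<tau>] \<tau> G in linarith)+
      then have "0 < (k a (- \<eta>) ?\<tau> *\<^sub>R (y - P s)) \<bullet> G y" by (simp add: inner_diff_left algebra_simps)
      then show "\<exists>z \<rho> g G. ((\<lambda>x. bump (x - P s)) has_derivative (\<lambda>v. z \<bullet> v)) (at y) \<and>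
          local_defining_fun K y \<rho> g G \<and> 0 < z \<bullet> G y"
        using lf bump_deriv[OF \<tau>(2)] by blast
    qed (use t x True in auto)
  qed
qed

section \<open>Transport along curves and growth towards 1\<close>

lemma stay:
  assumes "faces_center K radius P" "covers t P" "t \<le> t'"
  shows "covers t' P"
proof -
  obtain \<sigma> where \<sigma>: "\<sigma> > 0" "\<And>\<tau>. 0 \<le> \<tau> \<Longrightarrow> \<tau> \<le> T \<Longrightarrow> \<bar>k a (- \<eta>) \<tau>\<bar> * (radius * \<sigma>) \<le> \<eta>"
    using speed by blast
  show ?thesis
    by (rule slide[OF \<sigma>(2), where P = "\<lambda>_. P" and P' = "\<lambda>_. 0" and ?T0.0 = t and ?T1.0 = t'])
      (use assms \<sigma> in auto)
qed

lemma travel: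
  assumes \<sigma>: "\<sigma> > 0" "\<And>\<tau>. 0 \<le> \<tau> \<Longrightarrow> \<tau> \<le> T \<Longrightarrow> \<bar>k a (- \<eta>) \<tau>\<bar> * (radius * \<sigma>) \<le> \<eta>"
    and p: "\<And>s. s \<in> {0..1} \<Longrightarrow> (p has_vector_derivative p' s) (at s)"
    and B: "B > 0" "\<And>s. s \<in> {0..1} \<Longrightarrow> norm (p' s) \<le> B"
    and face: "\<And>s. s \<in> {0..1} \<Longrightarrow> faces_center K radius (p s)"
    and init: "covers t (p 0)"
  shows "covers (t + B / \<sigma>) (p 1)"
proof -
  \<comment> \<open>Running through the curve at rate \<open>c\<close> keeps the speed at most
    \<open>\<sigma>\<close> and takes time \<open>B / \<sigma>\<close>.\<close>
  define c where "c = \<sigma> / B"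
  have c: "c > 0" using \<sigma> B by (simp add: c_def)
  let ?l = "\<lambda>s. (s - t) * c"
  have l: "?l s \<in> {0..1}" if "t \<le> s" "s \<le> t + B / \<sigma>" for s
  proof -
    have "(s - t) * c \<le> (B / \<sigma>) * c" using that c by (intro mult_right_mono) auto
    also have "\<dots> = 1" using \<sigma> B by (simp add: c_def)
    finally show ?thesis using that c by simp
  qed
  have "covers (t + B / \<sigma>) (p (?l (t + B / \<sigma>)))"
  proof (rule slide[OF \<sigma>(2), where P = "\<lambda>s. p (?l s)" and P' = "\<lambda>s. c *\<^sub>R p' (?l s)" and ?T0.0 = t and ?T1.0 = "t + B / \<sigma>"])
    fix s assume s: "t \<le> s" "s \<le> t + B / \<sigma>"
    have "(?l has_real_derivative c) (at s)" by (auto intro!: derivative_eq_intros)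
    then have "(?l has_vector_derivative c) (at s)" by (simp add: has_real_derivative_iff_has_vector_derivative)
    from vector_diff_chain_at[OF this p[OF l[OF s]]]
    show "((\<lambda>s. p (?l s)) has_vector_derivative c *\<^sub>R p' (?l s)) (at s)" by (simp add: o_def)
    have "c * norm (p' (?l s)) \<le> c * B" using B(2)[OF l[OF s]] c by (intro mult_left_mono) auto
    also have "\<dots> = \<sigma>" using B by (simp add: c_def)
    finally show "norm (c *\<^sub>R p' (?l s)) \<le> \<sigma>" using c by simp
    show "faces_center K radius (p (?l s))" by (rule face[OF l[OF s]])
  qed (use init \<sigma> B in \<open>auto simp: less_imp_le\<close>)
  moreover have "?l (t + B / \<sigma>) = 1" using \<sigma> B by (simp add: c_def)
  ultimately show ?thesis by (simp only:)
qed

lemma travel_segment: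
  assumes \<sigma>: "\<sigma> > 0" "\<And>\<tau>. 0 \<le> \<tau> \<Longrightarrow> \<tau> \<le> T \<Longrightarrow> \<bar>k a (- \<eta>) \<tau>\<bar> * (radius * \<sigma>) \<le> \<eta>"
    and face: "\<And>Q. Q \<in> closed_segment P P' \<Longrightarrow> faces_center K radius Q"
    and init: "covers t P"
  shows "covers (t + dist P P' / \<sigma>) P'"
proof (cases "P = P'")
  case False
  have "covers (t + dist P P' / \<sigma>) (P + 1 *\<^sub>R (P' - P))"
  proof (rule travel[OF \<sigma>, where p = "\<lambda>s. P + s *\<^sub>R (P' - P)" and p' = "\<lambda>_. P' - P"])
    show "((\<lambda>s. P + s *\<^sub>R (P' - P)) has_vector_derivative P' - P) (at s)" for s
      by (auto intro!: derivative_eq_intros)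
    show "faces_center K radius (P + s *\<^sub>R (P' - P))" if "s \<in> {0..1}" for s
      using that by (intro face) (auto simp: closed_segment_def algebra_simps intro!: exI[of _ s])
  qed (use False init in \<open>auto simp: dist_norm norm_minus_commute\<close>)
  then show ?thesis by simp
qed (use init in auto)

text \<open>Above \<open>\<alpha>\<close> the reaction alone lifts the solution. The subsolution is
  a paraboloid that starts as the constant \<open>a\<close>, keeps the value \<open>a\<close> on the
  sphere around \<open>P\<close>, and reaches \<open>b\<close> at \<open>P\<close> after time
  \<open>\<theta>\<close>. The reaction is at least \<open>m > 0\<close> on \<open>[a, b]\<close>
  and pays for its Laplacian and its growth. Neither \<open>r\<close> nor \<open>\<theta>\<close>
  depends on \<open>P\<close> or \<open>t\<close>.\<close>

lemma invade:
  assumes b: "a < b" "b < 1"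
  obtains r \<theta> where "r > 0" "\<theta> > 0"
    "\<And>P t. cball P r \<subseteq> - K \<Longrightarrow> (\<And>s x. t \<le> s \<Longrightarrow> x \<in> cball P r \<Longrightarrow> a \<le> u s x) \<Longrightarrow> b \<le> u (t + \<theta>) P"
proof -
  obtain y where y: "y \<in> {a..b}" "\<And>s. s \<in> {a..b} \<Longrightarrow> g y \<le> g s"
    using continuous_attains_inf[of "{a..b}" g] continuous_on_subset[OF g_cont] b by auto
  define m where "m = g y"
  have m: "m > 0" unfolding m_def using y a\<alpha> b by (intro g_pos) auto
  \<comment> \<open>The paraboloid has height at most 1, so its Laplacian is at least
    \<open>- 2 * n / r^2 = - m / 2\<close>.\<close>
  define r where "r = sqrt (4 * n / m)"
  have r: "r > 0" using m n by (simp add: r_def)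
  have r2: "r\<^sup>2 = 4 * n / m" using m by (simp add: r_def)
  \<comment> \<open>The growth rate is at most \<open>1 / \<theta> = m / 2\<close>, the other half
    of the reaction.\<close>
  define \<theta> where "\<theta> = 2 / m"
  have \<theta>: "\<theta> > 0" using m by (simp add: \<theta>_def)
  show thesis
  proof (rule that[OF r \<theta>])
    fix P t assume PK: "cball P r \<subseteq> - K" and ge: "\<And>s x. t \<le> s \<Longrightarrow> x \<in> cball P r \<Longrightarrow> a \<le> u s x"
    define \<iota> where "\<iota> = 1 / r\<^sup>2"
    have \<iota>: "\<iota> > 0" "\<iota> * r\<^sup>2 = 1" using r by (simp_all add: \<iota>_def)
    define s where "s \<tau> = (\<tau> - t) / \<theta> * (b - a)" for \<tau>
    define h where "h \<tau> x = a + s \<tau> * (1 - \<iota> * ((x - P) \<bullet> (x - P)))" for \<tau> x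
    have s01: "0 \<le> s \<tau>" "s \<tau> \<le> b - a" if "t \<le> \<tau>" "\<tau> \<le> t + \<theta>" for \<tau>
    proof -
      show "0 \<le> s \<tau>" using that b \<theta> by (simp add: s_def)
      have "s \<tau> \<le> 1 * (b - a)" unfolding s_def using that b \<theta> by (intro mult_right_mono) auto
      then show "s \<tau> \<le> b - a" by simp
    qed
    have h_le: "h \<tau> x \<le> b" if "t \<le> \<tau>" "\<tau> \<le> t + \<theta>" for \<tau> x
    proof -
      have "s \<tau> * (1 - \<iota> * ((x - P) \<bullet> (x - P))) \<le> s \<tau> * 1" using s01[OF that] \<iota> by (intro mult_left_mono) auto
      then show ?thesis using s01[OF that] by (simp add: h_def)
    qed
    have h_ge: "a \<le> h \<tau> x" if "t \<le> \<tau>" "\<tau> \<le> t + \<theta>" "x \<in> cball P r" for \<tau> x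
    proof -
      have "(norm (x - P))\<^sup>2 \<le> r\<^sup>2" using that(3) by (intro power_mono) (auto simp: dist_norm norm_minus_commute)
      then have "\<iota> * ((x - P) \<bullet> (x - P)) \<le> \<iota> * r\<^sup>2"
        using \<iota> by (intro mult_left_mono) (simp_all add: power2_norm_eq_inner)
      then show ?thesis using s01[OF that(1,2)] \<iota> by (simp add: h_def)
    qed
    have "h (t + \<theta>) P \<le> u (t + \<theta>) P"
    proof (rule comparison[OF K u ub f_lip, where h = h and ?T0.0 = t and ?T1.0 = "t + \<theta>" and Q = P and r = r])
      show "continuous_on ({t..t + \<theta>} \<times> (cball P r \<inter> closure (- K))) (\<lambda>(t, x). h t x)"
        unfolding h_def s_def case_prod_beta using \<theta> r by (intro continuous_intros) auto
      show "h t x \<le> u t x" if "x \<in> cball P r" for x using ge[OF order_refl that] by (simp add: h_def s_def)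
      show "h \<tau> x \<le> 1" if "t \<le> \<tau>" "\<tau> \<le> t + \<theta>" for \<tau> x using h_le[OF that, of x] b by simp
    next
      fix \<tau> x assume \<tau>: "t < \<tau>" "\<tau> \<le> t + \<theta>" and x: "x \<in> cball P r" and less: "u \<tau> x < h \<tau> x"
      show "x \<in> ball P r"
      proof (rule ccontr)
        assume "x \<notin> ball P r"
        then have "norm (x - P) = r" using x by (simp add: dist_norm norm_minus_commute)
        then have "(x - P) \<bullet> (x - P) = r\<^sup>2" by (simp flip: power2_norm_eq_inner)
        then have "h \<tau> x = a" using \<iota> by (simp add: h_def)
        then show False using less ge[of \<tau> x] \<tau> x by simp
      qed
    next
      fix \<tau> x assume \<tau>: "t < \<tau>" "\<tau> \<le> t + \<theta>" and x: "x \<in> ball P r"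
      let ?D = "\<lambda>y. (- 2 * s \<tau> * \<iota>) *\<^sub>R (y - P)" and ?A = "\<lambda>v. (- 2 * s \<tau> * \<iota>) *\<^sub>R (v::'a)"
      let ?ht = "(b - a) / \<theta> * (1 - \<iota> * ((x - P) \<bullet> (x - P)))"
      have "(h \<tau> has_derivative (\<lambda>v. ?D y \<bullet> v)) (at y)" for y
        unfolding h_def[abs_def]
        by (auto intro!: derivative_eq_intros simp: fun_eq_iff inner_commute algebra_simps inner_diff_left)
      moreover have "(?D has_derivative ?A) (at x)" by (auto intro!: derivative_eq_intros)
      moreover have "((\<lambda>\<tau>. h \<tau> x) has_real_derivative ?ht) (at \<tau>)"
        unfolding h_def s_def using \<theta> by (auto intro!: derivative_eq_intros)
      moreover have "?ht \<le> (\<Sum>b\<in>Basis. ?A b \<bullet> b) + f (h \<tau> x)"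
      proof -
        have "?ht \<le> (b - a) / \<theta> * 1" using b \<theta> \<iota> by (intro mult_left_mono) auto
        also have "\<dots> \<le> 1 / \<theta>" using b \<theta> a\<alpha> \<alpha> by (simp add: divide_right_mono)
        also have "\<dots> = m / 2" by (simp add: \<theta>_def)
        finally have 1: "?ht \<le> m / 2" .
        have "(\<Sum>b\<in>Basis. ?A b \<bullet> b) = - (n * (2 * s \<tau> * \<iota>))" by (simp add: nD)
        moreover have "n * (2 * s \<tau> * \<iota>) \<le> m / 2"
        proof -
          have "s \<tau> \<le> 1" using s01[of \<tau>] \<tau> b a\<alpha> \<alpha> by simp
          then have "n * (2 * s \<tau> * \<iota>) \<le> n * (2 * 1 * \<iota>)" using \<iota> by (intro mult_left_mono mult_right_mono) auto
          also have "\<dots> = m / 2" using m n by (simp add: \<iota>_def r2)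
          finally show ?thesis .
        qed
        moreover have "m \<le> f (h \<tau> x)"
        proof -
          have "h \<tau> x \<in> {a..b}" using h_le[of \<tau> x] h_ge[of \<tau> x] \<tau> x by auto
          then have "m \<le> g (h \<tau> x)" "0 \<le> h \<tau> x" "h \<tau> x \<le> 1" using y(2)[of "h \<tau> x"] b a\<alpha> \<alpha> by (auto simp: m_def)
          then show ?thesis by (simp add: fg)
        qed
        ultimately show ?thesis using 1 by linarith
      qed
      ultimately show "\<exists>Dh A ht. eventually (\<lambda>y. (h \<tau> has_derivative (\<lambda>v. Dh y \<bullet> v)) (at y)) (nhds x) \<and>
          (Dh has_derivative A) (at x) \<and> ((\<lambda>s. h s x) has_real_derivative ht) (at \<tau>) \<and>
          ht \<le> (\<Sum>b\<in>Basis. A b \<bullet> b) + f (h \<tau> x)"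
        by (intro exI[of _ ?D] exI[of _ ?A] exI[of _ ?ht]) simp
    next
      fix x assume "x \<in> ball P r" "x \<in> frontier K"
      then have False using PK K frontier_subset_eq by force
      then show "\<exists>z \<rho> g G. (h \<tau> has_derivative (\<lambda>v. z \<bullet> v)) (at x) \<and> local_defining_fun K x \<rho> g G \<and> 0 < z \<bullet> G x" for \<tau> ..
    qed (use PK r \<theta> closure_subset in force)+
    moreover have "h (t + \<theta>) P = b" using \<theta> by (simp add: h_def s_def)
    ultimately show "b \<le> u (t + \<theta>) P" by simp
  qed
qed

end

section \<open>Propagation\<close>

theorem theorem4p1:
  fixes f f' :: "real \<Rightarrow> real" and \<alpha> c M R0 :: real and \<phi> :: "real \<Rightarrow> real"
    and K :: "(real \<times> 'b::euclidean_space) set"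
    and u :: "real \<Rightarrow> real \<times> 'b \<Rightarrow> real" and v :: "real \<times> 'b \<Rightarrow> real"
    and \<gamma> :: "real \<Rightarrow> real \<times> 'b"
  assumes f_bistable: "bistable f f' \<alpha>"
    and c_pos: "0 < c"
    and tw: "traveling_wave f \<alpha> c \<phi>"
    and K_wall: "wall K M"
    and u_sol: "neumann_solution f (- K) u"
    and u_bounds: "\<forall>t. \<forall>x\<in>- K. 0 < u t x \<and> u t x < 1"
    and u_past: "\<forall>\<epsilon>>0. \<exists>T. \<forall>t\<le>T. \<forall>x\<in>- K. \<bar>u t x - \<phi> (fst x - c * t)\<bar> < \<epsilon>"
    and v_lim: "\<forall>x\<in>- K. ((\<lambda>t. u t x) \<longlongrightarrow> v x) at_top"
    and R0_def: "R0 = Inf {R. 0 < R \<and> (\<exists>\<Psi> :: real \<times> 'b \<Rightarrow> real. dirichlet_ball_solution f R \<Psi>)}"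
    and \<gamma>_path: "path \<gamma>"
    and \<gamma>_start: "fst (pathstart \<gamma>) < 0"
    and \<gamma>_finish: "fst (pathfinish \<gamma>) > M"
    and \<gamma>_far: "\<forall>s\<in>{0..1}. (\<forall>k\<in>K. dist (\<gamma> s) k \<ge> R0)"
  shows "\<forall>\<epsilon>>0. \<exists>L. \<forall>x. L \<le> fst x \<longrightarrow> \<bar>v x - 1\<bar> < \<epsilon>"
proof -
  have M: "0 < M" and K: "closed K" and slab: "K \<subseteq> {x. 0 \<le> fst x \<and> fst x \<le> M}"
    and sm: "\<And>p. p \<in> frontier K \<Longrightarrow> \<exists>r g G. local_defining_fun K p r g G"
    using K_wall unfolding wall_def unif_smooth_boundary_def by (simp_all, blast)
  obtain g L w where fam: "radial_family g L \<alpha> DIM(real \<times> 'b) w"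
    and fg: "\<And>s. 0 \<le> s \<Longrightarrow> s \<le> 1 \<Longrightarrow> f s = g s"
    using bistable_radial_family[OF f_bistable, of "DIM(real \<times> 'b)"] DIM_positive[where 'a = "real \<times> 'b"]
    by (metis Suc_leI One_nat_def)
  have "\<forall>s\<in>{0..1}. f s = g s" using fg by simp
  note crit = radial_family.critical_radius[OF fam refl this, folded R0_def]
  have R0: "0 < R0" by (rule crit(1))
  define P1 P2 where "P1 = pathstart \<gamma>" and "P2 = pathfinish \<gamma>"
  have P: "fst P1 < 0" "fst P2 > M" using \<gamma>_start \<gamma>_finish by (auto simp: P1_def P2_def)
  \<comment> \<open>The curve is prolonged horizontally at both ends. The length
    \<open>R0 + 1\<close> exceeds the radius of the bump, as \<open>\<delta> \<le> 1\<close>, so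
    bumps at \<open>Q1\<close> and \<open>Q2\<close> miss the slab.\<close>
  define Q1 Q2 where "Q1 = (fst P1 - (R0 + 1), snd P1)" and "Q2 = (fst P2 + (R0 + 1), snd P2)"
  define \<Gamma> where "\<Gamma> = path_image \<gamma> \<union> closed_segment Q1 P1 \<union> closed_segment P2 Q2"
  have far_\<gamma>: "R0 \<le> dist P k" if "P \<in> path_image \<gamma>" "k \<in> K" for P k
    using that \<gamma>_far by (auto simp: path_image_def)
  have P_in: "P1 \<in> path_image \<gamma>" "P2 \<in> path_image \<gamma>" by (auto simp: P1_def P2_def)
  have "compact \<Gamma>" unfolding \<Gamma>_def by (intro compact_Un compact_path_image \<gamma>_path compact_segment)
  moreover have "R0 \<le> dist Q k" if "Q \<in> \<Gamma>" and k: "k \<in> K" for Q k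
  proof -
    have k0: "0 \<le> fst k" "fst k \<le> M" using slab k by auto
    consider "Q \<in> path_image \<gamma>" | "Q \<in> closed_segment Q1 P1" | "Q \<in> closed_segment P2 Q2"
      using \<open>Q \<in> \<Gamma>\<close> by (auto simp: \<Gamma>_def)
    then show ?thesis
    proof cases
      case 1 then show ?thesis using far_\<gamma> k by blast
    next
      case 2
      then obtain t where t: "0 \<le> t" "t \<le> 1" "Q = (1 - t) *\<^sub>R Q1 + t *\<^sub>R P1" by (auto simp: closed_segment_def)
      have "fst Q = fst P1 - (1 - t) * (R0 + 1)" "snd Q = snd P1"
        by (simp_all add: t(3) Q1_def algebra_simps scaleR_add_left[symmetric])
      moreover have "0 \<le> (1 - t) * (R0 + 1)" using t R0 by simp
      \<comment> \<open>Moving away from the slab along the first axis does not decrease the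
        distance to any point of the wall.\<close>
      ultimately have "dist P1 k \<le> dist Q k" using P k0 by (intro dist_le_same_snd) auto
      then show ?thesis using far_\<gamma>[OF P_in(1) k] by linarith
    next
      case 3
      then obtain t where t: "0 \<le> t" "t \<le> 1" "Q = (1 - t) *\<^sub>R P2 + t *\<^sub>R Q2" by (auto simp: closed_segment_def)
      have "fst Q = fst P2 + t * (R0 + 1)" "snd Q = snd P2"
        by (simp_all add: t(3) Q2_def algebra_simps scaleR_add_left[symmetric])
      moreover have "0 \<le> t * (R0 + 1)" using t R0 by simp
      ultimately have "dist P2 k \<le> dist Q k" using P k0 by (intro dist_le_same_snd) auto
      then show ?thesis using far_\<gamma>[OF P_in(2) k] by linarith
    qed
  qed
  ultimately obtain \<delta>' where \<delta>': "\<delta>' > 0" "\<And>P Q. Q \<in> \<Gamma> \<Longrightarrow> dist P Q < \<delta>' \<Longrightarrow> faces_center K (R0 + \<delta>') P"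
    using faces_center_near[OF _ K R0 _ sm] by metis
  define \<delta> where "\<delta> = min \<delta>' 1"
  have \<delta>: "0 < \<delta>" "\<delta> \<le> \<delta>'" "\<delta> \<le> 1" using \<delta>' by (auto simp: \<delta>_def)
  obtain a \<eta> T where \<eta>: "0 < \<eta>" and T: "0 < T" and radius: "sqrt (2 * T) < R0 + \<delta>" and a: "a < 1" "\<alpha> < a"
    and z: "w a (- \<eta>) T = 0" and pos: "\<And>\<tau>. 0 \<le> \<tau> \<Longrightarrow> \<tau> < T \<Longrightarrow> w a (- \<eta>) \<tau> > 0"
    and neg: "\<And>\<tau>. 0 \<le> \<tau> \<Longrightarrow> \<tau> \<le> T \<Longrightarrow> slope g DIM(real \<times> 'b) (- \<eta>) (w a (- \<eta>)) \<tau> < 0"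
    using crit(2)[OF \<delta>(1)] by blast
  have "moving_bump g L \<alpha> DIM(real \<times> 'b) w a \<eta> T K f u"
    using fam \<eta> T a z pos neg K u_sol u_bounds fg by (auto simp: moving_bump_def moving_bump_axioms_def)
  then interpret moving_bump g L \<alpha> "DIM(real \<times> 'b)" w a \<eta> T K f u .
  have near: "faces_center K radius P" if "Q \<in> \<Gamma>" "dist P Q < \<delta>'" for P Q
    using faces_center_mono[OF \<delta>'(2)[OF that]] radius \<delta> by simp
  have outside: "faces_center K radius P" if "fst P \<le> - radius \<or> M + radius \<le> fst P" for P
    using faces_center_outside_slab[OF K slab that] .
  obtain \<sigma> where \<sigma>: "\<sigma> > 0" "\<And>\<tau>. 0 \<le> \<tau> \<Longrightarrow> \<tau> \<le> T \<Longrightarrow> \<bar>k a (- \<eta>) \<tau>\<bar> * (radius * \<sigma>) \<le> \<eta>"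
    using speed by blast
  have Q1: "fst Q1 \<le> - radius" using P radius \<delta> by (simp add: Q1_def)
  have Q2: "M + radius \<le> fst Q2" using P radius \<delta> by (simp add: Q2_def)
  have "\<exists>t Q0. snd Q0 = snd Q1 \<and> fst Q0 \<le> fst Q1 \<and> covers t Q0"
  proof -
    \<comment> \<open>The bump is at most \<open>a = 1 - 2 * e\<close>: one \<open>e\<close> for the
      distance of \<open>u\<close> from the wave, one for that of the wave from 1.\<close>
    define e where "e = (1 - a) / 2"
    have e: "e > 0" using a by (simp add: e_def)
    obtain t where t: "\<And>x. x \<in> - K \<Longrightarrow> \<bar>u t x - \<phi> (fst x - c * t)\<bar> < e" using u_past e by blast
    have "(\<phi> \<longlongrightarrow> 1) at_bot" using tw by (simp add: traveling_wave_def)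
    then have "eventually (\<lambda>s. 1 - e < \<phi> s) at_bot" using e by (intro order_tendstoD(1)) auto
    then obtain S where S: "\<And>s. s \<le> S \<Longrightarrow> 1 - e < \<phi> s" by (auto simp: eventually_at_bot_linorder)
    \<comment> \<open>Far enough left for the bump to lie in \<open>fst x < 0\<close>, off the wall,
      and where the wave exceeds \<open>1 - e\<close>.\<close>
    define Q0 where "Q0 = (min (fst Q1) (S + c * t - radius), snd Q1)"
    have "covers t Q0" unfolding covers_def
    proof
      fix x assume x: "x \<in> closure (- K)"
      show "bump (x - Q0) \<le> u t x"
      proof (cases "radius \<le> norm (x - Q0)")
        case True
        then show ?thesis using bump_outside u_nonneg[OF x] by simp
      next
        case False
        then have "\<bar>fst x - fst Q0\<bar> < radius" using abs_fst_diff_le_dist[of x Q0] by (simp add: dist_norm)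
        then have fx: "fst x < 0" "fst x - c * t \<le> S" using Q1 by (auto simp: Q0_def)
        then have "x \<in> - K" using slab by auto
        from t[OF this] S[OF fx(2)] have "1 - 2 * e < u t x" by (simp add: abs_less_iff)
        then show ?thesis using bump_le[of "x - Q0"] by (simp add: e_def field_simps)
      qed
    qed
    then show ?thesis by (intro exI[of _ t] exI[of _ Q0]) (simp add: Q0_def)
  qed
  then obtain t0 Q0 where Q0: "snd Q0 = snd Q1" "fst Q0 \<le> fst Q1" and cov0: "covers t0 Q0" by blast
  have "faces_center K radius Q" if Q: "Q \<in> closed_segment Q0 Q1" for Q
  proof (rule outside, rule disjI1)
    obtain s where s: "0 \<le> s" "s \<le> 1" "Q = (1 - s) *\<^sub>R Q0 + s *\<^sub>R Q1" using Q by (auto simp: closed_segment_def)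
    have "(1 - s) * fst Q0 \<le> (1 - s) * fst Q1" using s Q0 by (intro mult_left_mono) auto
    then have "fst Q \<le> fst Q1" by (simp add: s(3) algebra_simps)
    then show "fst Q \<le> - radius" using Q1 by simp
  qed
  from travel_segment[OF \<sigma> this cov0] obtain t1 where cov1: "covers t1 Q1" by blast
  have "faces_center K radius Q" if "Q \<in> closed_segment Q1 P1" for Q
    using that \<delta>' by (intro near[of Q]) (auto simp: \<Gamma>_def)
  from travel_segment[OF \<sigma> this cov1] obtain t2 where cov2: "covers t2 P1" by blast
  \<comment> \<open>The centre of a bump has to move differentiably. A polynomial path with the
    endpoints of \<open>\<gamma>\<close> and within \<open>\<delta>'\<close> of it stays where the
    wall faces the centre.\<close>
  obtain p where p: "polynomial_function p" "pathstart p = P1" "pathfinish p = P2"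
    and pg: "\<And>s. s \<in> {0..1} \<Longrightarrow> norm (p s - \<gamma> s) < \<delta>'"
    using path_approx_polynomial_function[OF \<gamma>_path \<delta>'(1)] by (metis P1_def P2_def)
  obtain p' where p': "polynomial_function p'" "\<And>x. (p has_vector_derivative p' x) (at x)"
    using has_vector_derivative_polynomial_function[OF p(1)] by blast
  have "bounded (p' ` {0..1})"
    by (intro compact_imp_bounded compact_continuous_image continuous_on_polymonial_function p'(1)) auto
  then obtain B where B: "B > 0" "\<And>s. s \<in> {0..1} \<Longrightarrow> norm (p' s) \<le> B" unfolding bounded_pos by blast
  have "covers (t2 + B / \<sigma>) (p 1)"
  proof (rule travel[OF \<sigma> p'(2) B])
    show "faces_center K radius (p s)" if "s \<in> {0..1}" for s
      by (rule near[of "\<gamma> s"]) (use that pg[OF that] in \<open>auto simp: \<Gamma>_def path_image_def dist_norm\<close>)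
    show "covers t2 (p 0)" using cov2 p by (simp add: pathstart_def)
  qed
  then obtain t3 where cov3: "covers t3 P2" using p by (auto simp: pathfinish_def)
  have "faces_center K radius Q" if "Q \<in> closed_segment P2 Q2" for Q
    using that \<delta>' by (intro near[of Q]) (auto simp: \<Gamma>_def)
  from travel_segment[OF \<sigma> this cov3] obtain t4 where cov4: "covers t4 Q2" by blast
  \<comment> \<open>To the right of the slab the centre may be led to any \<open>y\<close>, where
    the bump takes the value \<open>a\<close>. The waiting time depends on \<open>y\<close>, which
    is harmless for a limit in time.\<close>
  have right: "a \<le> u t y" if y: "M + radius \<le> fst y" and t: "t4 + dist Q2 y / \<sigma> \<le> t" for y t
  proof -
    have "faces_center K radius Q" if Q: "Q \<in> closed_segment Q2 y" for Q
    proof (rule outside, rule disjI2)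
      obtain s where s: "0 \<le> s" "s \<le> 1" "Q = (1 - s) *\<^sub>R Q2 + s *\<^sub>R y" using Q by (auto simp: closed_segment_def)
      have "(1 - s) * (M + radius) \<le> (1 - s) * fst Q2" "s * (M + radius) \<le> s * fst y"
        using s Q2 y by (auto intro: mult_left_mono)
      then show "M + radius \<le> fst Q" by (simp add: s(3) algebra_simps)
    qed
    from travel_segment[OF \<sigma> this cov4] have "covers (t4 + dist Q2 y / \<sigma>) y" .
    then have "covers t y" using stay outside y t by blast
    moreover have "y \<in> - K"
    proof -
      have "0 < radius" using T by simp
      then have "M < fst y" using y by linarith
      then show ?thesis using slab by auto
    qed
    ultimately show ?thesis using closure_subset[of "- K"] bump_zero by (force simp: covers_def)
  qed
  show ?thesis
  proof (intro allI impI)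
    fix \<epsilon> :: real assume \<epsilon>: "\<epsilon> > 0"
    define b where "b = max ((a + 1) / 2) (1 - \<epsilon> / 2)"
    have "(a + 1) / 2 \<le> b" "1 - \<epsilon> / 2 \<le> b" "b < 1" using a \<epsilon> by (auto simp: b_def)
    then have b: "a < b" "b < 1" "1 - b < \<epsilon>" using a \<epsilon> by (simp_all add: field_simps)
    show "\<exists>L. \<forall>x. L \<le> fst x \<longrightarrow> \<bar>v x - 1\<bar> < \<epsilon>"
    proof (rule invade[OF b(1,2)])
      fix r \<theta> :: real
      assume r: "r > 0" and \<theta>: "\<theta> > 0"
        and inv: "\<And>P t. cball P r \<subseteq> - K \<Longrightarrow> (\<And>s x. t \<le> s \<Longrightarrow> x \<in> cball P r \<Longrightarrow> a \<le> u s x) \<Longrightarrow> b \<le> u (t + \<theta>) P"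
      show ?thesis
      proof (intro exI allI impI)
        \<comment> \<open>The threshold \<open>M + radius + r\<close> is uniform in the other
          coordinates; only the time \<open>s\<close> depends on \<open>x\<close>.\<close>
        fix x :: "real \<times> 'b" assume x: "M + radius + r \<le> fst x"
        have y: "M + radius \<le> fst y" if "y \<in> cball x r" for y
          using that x abs_fst_diff_le_dist[of x y] by simp
        have rad: "0 < radius" using T by simp
        have sub: "cball x r \<subseteq> - K"
        proof
          fix y' assume "y' \<in> cball x r"
          from y[OF this] have "M < fst y'" using rad by linarith
          then show "y' \<in> - K" using slab by auto
        qed
        then have xK: "x \<in> - K" using r centre_in_cball[of x r] by (meson less_imp_le subsetD)
        define s where "s = t4 + (dist Q2 x + r) / \<sigma>"
        have ge: "b \<le> u t x" if "s + \<theta> \<le> t" for t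
        proof -
          have "b \<le> u ((t - \<theta>) + \<theta>) x"
          proof (rule inv[OF sub])
            fix t' y' assume t': "t - \<theta> \<le> t'" and y': "y' \<in> cball x r"
            have "dist Q2 y' \<le> dist Q2 x + r" using dist_triangle[of Q2 y' x] y' by simp
            then have "dist Q2 y' / \<sigma> \<le> (dist Q2 x + r) / \<sigma>" using \<sigma> by (intro divide_right_mono) auto
            then show "a \<le> u t' y'" using t' that by (intro right y[OF y']) (simp add: s_def)
          qed
          then show ?thesis by simp
        qed
        have lim: "((\<lambda>t. u t x) \<longlongrightarrow> v x) at_top" using v_lim xK by blast
        have "b \<le> v x"
          by (rule tendsto_lowerbound[OF lim]) (auto simp: eventually_at_top_linorder intro!: exI[of _ "s + \<theta>"] ge)
        moreover have "v x \<le> 1"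
          by (rule tendsto_upperbound[OF lim]) (use ub xK in \<open>auto simp: less_imp_le\<close>)
        ultimately show "\<bar>v x - 1\<bar> < \<epsilon>" using b by simp
      qed
    qed
  qed
qed

end
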